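(* Let $(\pi,\mathcal V)=\mathbf{St}_e(\tau)$ be the level $0$ discrete series representation of $G=\mathrm{GL}_n(F)$ attached to $\tau$, let $(J,\lambda)$ be the associated simple type, and let $\chi$ be the character of $\mathcal H_\lambda$ afforded by the one-dimensional module $\mathrm{Hom}_J(W,\mathcal V)$. Let $${}_\chi\bar{\mathcal H}_\lambda=\{\Psi\in\bar{\mathcal H}_\lambda\ ;\ \varphi\star\Psi=\chi(\varphi)\Psi\ \text{ for all }\varphi\in\mathcal H_\lambda\}.$$ Then $\dim_{\mathbb C}\,{}_\chi\bar{\mathcal H}_\lambda\leqslant 1$.
   Context: $F$ is a non-archimedean, non-discrete, locally compact field of any characteristic, with ring of integers $\mathfrak o_F$, maximal ideal $\mathfrak p_F$, uniformizer $\varpi_F$, residue field $k_F$ of cardinality $q$, normalized absolute value $\|\ \|$. All representations are on complex vector spaces. Fix $n\geqslant 2$, positive integers $e,f$ with $ef=n$, and put $G=\mathrm{GL}_n(F)$. Representation: $\tau$ is an irreducible unitary level $0$ supercuspidal representation of $\mathrm{GL}_f(F)$ with central character $\omega_\tau$; that is, there are an irreducible cuspidal representation $\bar\lambda_0$ of $\mathrm{GL}_f(k_F)$, with inflation $\lambda_0$ to $\mathrm{GL}_f(\mathfrak o_F)$ (space $X_0$), and an extension $\Lambda_0$ of $\lambda_0$ to $F^\times\mathrm{GL}_f(\mathfrak o_F)$ with $\tau\simeq \mathrm{ind}_{F^\times \mathrm{GL}_f(\mathfrak o_F)}^{\mathrm{GL}_f(F)}\Lambda_0$. Write $\tau^a=\|\det\|^a\tau$.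 $\mathbf{St}_e(\tau)$ is the unique irreducible quotient of the representation of $G$ obtained by normalized parabolic induction from the representation $\tau^{(1-e)/2}\otimes\tau^{(3-e)/2}\otimes\cdots\otimes\tau^{(e-1)/2}$ of the standard Levi subgroup $\mathrm{GL}_f(F)^{e}$. Put $(\pi,\mathcal V)=\mathbf{St}_e(\tau)$, with contragredient $(\tilde\pi,\tilde{\mathcal V})$. Type: $\mathfrak A$ is the $\mathfrak o_F$-order of $f\times f$ block matrices $(a_{ij})_{1\le i,j\le e}$ with $a_{ij}\in M_f(\mathfrak o_F)$ if $j\ge i$ and $a_{ij}\in\mathfrak p_F M_f(\mathfrak o_F)$ if $j<i$; $\mathfrak P$ is its Jacobson radical, $J=\mathfrak A^\times$, $J^1=1+\mathfrak P$, so $J/J^1\simeq\mathrm{GL}_f(k_F)^e$. $\lambda$ is the inflation of $\bar\lambda_0^{\otimes e}$ to $J$, with space $W=X_0^{\otimes e}$; $(\tilde\lambda,\tilde W)$ is its contragredient. Hecke algebra: $\bar{\mathcal H}_\lambda$ is the space of all functions $\Psi:G\to\mathrm{End}_{\mathbb C}(\tilde W)$ (no support condition) with $\Psi(j_1gj_2)=\tilde\lambda(j_1)\circ\Psi(g)\circ\tilde\lambda(j_2)$ for $j_1,j_2\in J$, $g\in G$; $\mathcal H_\lambda\subset\bar{\mathcal H}_\lambda$ is the subspace of compactly supported ones. For $\varphi\in\mathcal H_\lambda,\Psi\in\bar{\mathcal H}_\lambda$, $(\varphi\star\Psi)(g)=\sum_{x\in J\backslash G}\varphi(gx^{-1})\Psi(x)$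 (a finite sum); this makes $\mathcal H_\lambda$ an algebra (convolution for the Haar measure on $G$ giving $J$ volume $1$). Module: $\mathrm{ind}_J^G\lambda$ is the space of compactly supported $f:G\to W$ with $f(jg)=\lambda(j)f(g)$, $G$ acting by right translation. For $\varphi\in\mathcal H_\lambda$ put $\tilde\varphi(g)={}^t\varphi(g^{-1})\in\mathrm{End}_{\mathbb C}(W)$ and $(\tilde\varphi\star f)(g)=\sum_{x\in G/J}\tilde\varphi(x)f(x^{-1}g)$. $\mathrm{Hom}_J(W,\mathcal V)\simeq\mathrm{Hom}_G(\mathrm{ind}_J^G\lambda,\mathcal V)$ is a left $\mathcal H_\lambda$-module by $(\varphi\cdot\alpha)(f)=\alpha(\tilde\varphi\star f)$. It is known to be one-dimensional; $\chi$ is the resulting character of $\mathcal H_\lambda$. *)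

theory Defs
  imports
    "HOL-Analysis.Abstract_Metric_Spaces"
    "HOL-Analysis.Function_Topology"
    "HOL-Library.Function_Algebras"
    "HOL-Algebra.Left_Coset"
    "Jordan_Normal_Form.Determinant"
begin

section \<open>Complex vector spaces\<close>

class complex_vector = ab_group_add +
  fixes scaleC :: "complex \<Rightarrow> 'a \<Rightarrow> 'a"  (infixr \<open>*\<^sub>C\<close> 75)
  assumes scaleC_add_right: "c *\<^sub>C (x + y) = c *\<^sub>C x + c *\<^sub>C y"
    and scaleC_add_left: "(c + d) *\<^sub>C x = c *\<^sub>C x + d *\<^sub>C x"
    and scaleC_scaleC: "c *\<^sub>C d *\<^sub>C x = (c * d) *\<^sub>C x"
    and scaleC_one: "1 *\<^sub>C x = x"

instantiation complex :: complex_vector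
begin
definition scaleC_complex :: "complex \<Rightarrow> complex \<Rightarrow> complex"
  where "scaleC_complex c x = c * x"
instance
  by standard (simp_all add: scaleC_complex_def algebra_simps)
end

instantiation "fun" :: (type, complex_vector) complex_vector
begin
definition scaleC_fun :: "complex \<Rightarrow> ('a \<Rightarrow> 'b) \<Rightarrow> 'a \<Rightarrow> 'b"
  where "scaleC_fun c f = (\<lambda>x. c *\<^sub>C f x)"
instance
  by standard (simp_all add: scaleC_fun_def fun_eq_iff scaleC_add_right scaleC_add_left
      scaleC_scaleC scaleC_one)
end

global_interpretation cvec: vector_space "scaleC :: complex \<Rightarrow> 'a \<Rightarrow> 'a::complex_vector"
  defines csubspace = cvec.subspace
    and cspan = cvec.span
    and cdim = cvec.dim
  by standard (simp_all add: scaleC_add_right scaleC_add_left scaleC_scaleC scaleC_one)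

text \<open>Every space below is a subspace \<open>V\<close> of some ambient type.  Functions defined on \<open>V\<close> (or on a
  group) are total functions that vanish outside their domain, so that equality of functions,
  composition, spans and dimensions are the intended ones.\<close>

definition linear_maps ::
  "'a::complex_vector set \<Rightarrow> 'b::complex_vector set \<Rightarrow> ('a \<Rightarrow> 'b) set"
  where "linear_maps V W = {T. (\<forall>x\<in>V. T x \<in> W)
    \<and> (\<forall>x\<in>V. \<forall>y\<in>V. T (x + y) = T x + T y)
    \<and> (\<forall>c. \<forall>x\<in>V. T (c *\<^sub>C x) = c *\<^sub>C T x)
    \<and> (\<forall>x. x \<notin> V \<longrightarrow> T x = 0)}"

abbreviation endomorphisms :: "'a::complex_vector set \<Rightarrow> ('a \<Rightarrow> 'a) set"
  where "endomorphisms V \<equiv> linear_maps V V"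

definition dual_space :: "'a::complex_vector set \<Rightarrow> ('a \<Rightarrow> complex) set"
  where "dual_space V = linear_maps V UNIV"

text \<open>The transpose of an endomorphism of the dual of a finite-dimensional space \<open>W\<close>, as an
  endomorphism of \<open>W\<close> (which is identified with its bidual).\<close>

definition transpose_map ::
  "'a::complex_vector set \<Rightarrow> (('a \<Rightarrow> complex) \<Rightarrow> ('a \<Rightarrow> complex)) \<Rightarrow> 'a \<Rightarrow> 'a"
  where "transpose_map W A = (\<lambda>w. if w \<in> W
    then (THE w'. w' \<in> W \<and> (\<forall>\<xi>\<in>dual_space W. \<xi> w' = A \<xi> w)) else 0)"

text \<open>The tensor power \<open>X\<^sup>\<otimes>\<^sup>e\<close> is realized inside the multilinear forms on \<open>e\<close>-tuples of functionals:
  \<open>x\<^sub>0 \<otimes> \<dots> \<otimes> x\<^bsub>e-1\<^esub>\<close> is the form \<open>(\<xi>\<^sub>i) \<mapsto> \<Prod>\<^sub>i \<xi>\<^sub>i(x\<^sub>i)\<close>.  Since functionals separate points, this is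
  the algebraic tensor power for \<open>X\<close> of any dimension.  Only the entries \<open>\<xi> i\<close> with \<open>i < e\<close> matter.\<close>

type_synonym 'a tensor = "(nat \<Rightarrow> 'a \<Rightarrow> complex) \<Rightarrow> complex"

definition pure_tensor :: "nat \<Rightarrow> 'a::complex_vector set \<Rightarrow> (nat \<Rightarrow> 'a) \<Rightarrow> 'a tensor"
  where "pure_tensor e X x =
    (\<lambda>\<xi>. if \<forall>i<e. \<xi> i \<in> dual_space X then \<Prod>i<e. \<xi> i (x i) else 0)"

definition tensor_power :: "nat \<Rightarrow> 'a::complex_vector set \<Rightarrow> 'a tensor set"
  where "tensor_power e X = cspan {pure_tensor e X x | x. \<forall>i<e. x i \<in> X}"

text \<open>The endomorphism \<open>T\<^sub>0 \<otimes> \<dots> \<otimes> T\<^bsub>e-1\<^esub>\<close>, which maps \<open>x\<^sub>0 \<otimes> \<dots> \<otimes> x\<^bsub>e-1\<^esub>\<close> to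
  \<open>T\<^sub>0 x\<^sub>0 \<otimes> \<dots> \<otimes> T\<^bsub>e-1\<^esub> x\<^bsub>e-1\<^esub>\<close>.\<close>

definition tensor_map ::
  "nat \<Rightarrow> 'a::complex_vector set \<Rightarrow> (nat \<Rightarrow> 'a \<Rightarrow> 'a) \<Rightarrow> 'a tensor \<Rightarrow> 'a tensor"
  where "tensor_map e X T = (\<lambda>t. if t \<in> tensor_power e X
    then (\<lambda>\<xi>. if \<forall>i<e. \<xi> i \<in> dual_space X then t (\<lambda>i. \<xi> i \<circ> T i) else 0) else 0)"


section \<open>Representations of abstract groups\<close>

definition group_rep ::
  "('g, 'm) monoid_scheme \<Rightarrow> 'v::complex_vector set \<Rightarrow> ('g \<Rightarrow> 'v \<Rightarrow> 'v) \<Rightarrow> bool"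
  where "group_rep G V \<rho> \<longleftrightarrow> csubspace V
    \<and> (\<forall>g\<in>carrier G. \<rho> g \<in> endomorphisms V)
    \<and> (\<forall>x\<in>V. \<rho> \<one>\<^bsub>G\<^esub> x = x)
    \<and> (\<forall>g\<in>carrier G. \<forall>h\<in>carrier G. \<rho> (g \<otimes>\<^bsub>G\<^esub> h) = \<rho> g \<circ> \<rho> h)"

definition irreducible_rep ::
  "('g, 'm) monoid_scheme \<Rightarrow> 'v::complex_vector set \<Rightarrow> ('g \<Rightarrow> 'v \<Rightarrow> 'v) \<Rightarrow> bool"
  where "irreducible_rep G V \<rho> \<longleftrightarrow> group_rep G V \<rho> \<and> V \<noteq> {0}
    \<and> (\<forall>S. csubspace S \<and> S \<subseteq> V \<and> (\<forall>g\<in>carrier G. \<rho> g ` S \<subseteq> S) \<longrightarrow> S = {0} \<or> S = V)"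

definition intertwiners :: "'g set \<Rightarrow> 'v::complex_vector set \<Rightarrow> ('g \<Rightarrow> 'v \<Rightarrow> 'v)
    \<Rightarrow> 'w::complex_vector set \<Rightarrow> ('g \<Rightarrow> 'w \<Rightarrow> 'w) \<Rightarrow> ('v \<Rightarrow> 'w) set"
  where "intertwiners H V \<rho> W \<sigma> =
    {T \<in> linear_maps V W. \<forall>h\<in>H. \<forall>x\<in>V. T (\<rho> h x) = \<sigma> h (T x)}"

definition isomorphic_reps :: "'g set \<Rightarrow> 'v::complex_vector set \<Rightarrow> ('g \<Rightarrow> 'v \<Rightarrow> 'v)
    \<Rightarrow> 'w::complex_vector set \<Rightarrow> ('g \<Rightarrow> 'w \<Rightarrow> 'w) \<Rightarrow> bool"
  where "isomorphic_reps H V \<rho> W \<sigma> \<longleftrightarrow>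
    (\<exists>T\<in>intertwiners H V \<rho> W \<sigma>. bij_betw T V W)"

definition contragredient :: "('g, 'm) monoid_scheme \<Rightarrow> 'w::complex_vector set
    \<Rightarrow> ('g \<Rightarrow> 'w \<Rightarrow> 'w) \<Rightarrow> 'g \<Rightarrow> ('w \<Rightarrow> complex) \<Rightarrow> ('w \<Rightarrow> complex)"
  where "contragredient G W \<sigma> g = (\<lambda>\<xi>. if \<xi> \<in> dual_space W
    then (\<lambda>w. if w \<in> W then \<xi> (\<sigma> (inv\<^bsub>G\<^esub> g) w) else 0) else 0)"

text \<open>Unitary means unitarizable: there is an invariant inner product (no completeness required).\<close>

definition unitary_rep ::
  "('g, 'm) monoid_scheme \<Rightarrow> 'v::complex_vector set \<Rightarrow> ('g \<Rightarrow> 'v \<Rightarrow> 'v) \<Rightarrow> bool"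
  where "unitary_rep G V \<rho> \<longleftrightarrow> group_rep G V \<rho> \<and>
    (\<exists>ip :: 'v \<Rightarrow> 'v \<Rightarrow> complex.
      (\<forall>x\<in>V. \<forall>y\<in>V. \<forall>z\<in>V. ip (x + y) z = ip x z + ip y z)
    \<and> (\<forall>c. \<forall>x\<in>V. \<forall>y\<in>V. ip (c *\<^sub>C x) y = c * ip x y)
    \<and> (\<forall>x\<in>V. \<forall>y\<in>V. ip y x = cnj (ip x y))
    \<and> (\<forall>x\<in>V. x \<noteq> 0 \<longrightarrow> Re (ip x x) > 0)
    \<and> (\<forall>g\<in>carrier G. \<forall>x\<in>V. \<forall>y\<in>V. ip (\<rho> g x) (\<rho> g y) = ip x y))"

definition right_translation ::
  "('g, 'm) monoid_scheme \<Rightarrow> ('g \<Rightarrow> 'v::complex_vector) set \<Rightarrow> 'g \<Rightarrow> ('g \<Rightarrow> 'v) \<Rightarrow> ('g \<Rightarrow> 'v)"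
  where "right_translation G S g = (\<lambda>\<phi>. if \<phi> \<in> S
    then (\<lambda>x. if x \<in> carrier G then \<phi> (x \<otimes>\<^bsub>G\<^esub> g) else 0) else 0)"

definition equivariant_functions ::
  "('g, 'm) monoid_scheme \<Rightarrow> 'g set \<Rightarrow> 'v::complex_vector set \<Rightarrow> ('g \<Rightarrow> 'v \<Rightarrow> 'v) \<Rightarrow> ('g \<Rightarrow> 'v) set"
  where "equivariant_functions G H V \<rho> = {\<phi>. (\<forall>g\<in>carrier G. \<phi> g \<in> V)
    \<and> (\<forall>g. g \<notin> carrier G \<longrightarrow> \<phi> g = 0)
    \<and> (\<forall>h\<in>H. \<forall>g\<in>carrier G. \<phi> (h \<otimes>\<^bsub>G\<^esub> g) = \<rho> h (\<phi> g))}"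


section \<open>The local field and its residue field\<close>

definition field_topology :: "('F::field \<Rightarrow> real) \<Rightarrow> 'F topology"
  where "field_topology absF = Metric_space.mtopology UNIV (\<lambda>x y. absF (x - y))"

definition integer_ring :: "('F::field \<Rightarrow> real) \<Rightarrow> 'F set"
  where "integer_ring absF = {x. absF x \<le> 1}"

definition maximal_ideal :: "('F::field \<Rightarrow> real) \<Rightarrow> 'F set"
  where "maximal_ideal absF = {x. absF x < 1}"

definition uniformizer :: "('F::field \<Rightarrow> real) \<Rightarrow> 'F \<Rightarrow> bool"
  where "uniformizer absF w \<longleftrightarrow> maximal_ideal absF = (\<lambda>x. w * x) ` integer_ring absF"

text \<open>A non-archimedean, non-discrete, locally compact field \<open>'F\<close>, presented by its normalized
  absolute value, with residue field \<open>'k\<close> and reduction map \<open>red\<close> from the integers onto \<open>'k\<close>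
  (the values of \<open>red\<close> outside the ring of integers are irrelevant).\<close>

locale nonarch_local_field =
  fixes absF :: "'F::field \<Rightarrow> real" and red :: "'F \<Rightarrow> 'k::field"
  assumes abs_nonneg: "0 \<le> absF x"
    and abs_eq_0: "absF x = 0 \<longleftrightarrow> x = 0"
    and abs_mult: "absF (x * y) = absF x * absF y"
    and abs_ultrametric: "absF (x + y) \<le> max (absF x) (absF y)"
    and nondiscrete: "\<exists>x. x \<noteq> 0 \<and> absF x \<noteq> 1"
    and locally_compact: "locally_compact_space (field_topology absF)"
    and red_add: "x \<in> integer_ring absF \<Longrightarrow> y \<in> integer_ring absF \<Longrightarrow> red (x + y) = red x + red y"
    and red_mult: "x \<in> integer_ring absF \<Longrightarrow> y \<in> integer_ring absF \<Longrightarrow> red (x * y) = red x * red y"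
    and red_one: "red 1 = 1"
    and red_surj: "red ` integer_ring absF = UNIV"
    and red_kernel: "x \<in> integer_ring absF \<Longrightarrow> red x = 0 \<longleftrightarrow> x \<in> maximal_ideal absF"
    and normalized: "uniformizer absF w \<Longrightarrow> absF w = 1 / real (card (UNIV :: 'k set))"


section \<open>General linear groups\<close>

definition GL :: "nat \<Rightarrow> 'a::field mat monoid"
  where "GL n = units_of (ring_mat TYPE('a) n ())"

definition order_units :: "nat \<Rightarrow> 'a::field mat set \<Rightarrow> 'a mat set"
  where "order_units n R = Units ((ring_mat TYPE('a) n ()) \<lparr>carrier := R\<rparr>)"

definition integral_matrices :: "('F::field \<Rightarrow> real) \<Rightarrow> nat \<Rightarrow> 'F mat set"
  where "integral_matrices absF n =
    {A \<in> carrier_mat n n. \<forall>i<n. \<forall>j<n. A $$ (i, j) \<in> integer_ring absF}"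

definition GL_integers :: "('F::field \<Rightarrow> real) \<Rightarrow> nat \<Rightarrow> 'F mat set"
  where "GL_integers absF n = order_units n (integral_matrices absF n)"

definition center_GL_integers :: "('F::field \<Rightarrow> real) \<Rightarrow> nat \<Rightarrow> 'F mat set"
  where "center_GL_integers absF n = {c \<cdot>\<^sub>m g | c g. c \<noteq> 0 \<and> g \<in> GL_integers absF n}"

text \<open>The topology of \<open>GL\<^sub>n(F)\<close> as a subspace of \<open>M\<^sub>n(F)\<close>, a product of \<open>n\<^sup>2\<close> copies of \<open>F\<close>.\<close>

definition mat_topology :: "('F::field \<Rightarrow> real) \<Rightarrow> nat \<Rightarrow> 'F mat topology"
  where "mat_topology absF n = pullback_topology (carrier_mat n n)
    (\<lambda>A. \<lambda>ij\<in>{..<n} \<times> {..<n}. A $$ ij)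
    (product_topology (\<lambda>_. field_topology absF) ({..<n} \<times> {..<n}))"

definition GL_topology :: "('F::field \<Rightarrow> real) \<Rightarrow> nat \<Rightarrow> 'F mat topology"
  where "GL_topology absF n = subtopology (mat_topology absF n) (carrier (GL n))"

definition open_subgroup :: "('F::field \<Rightarrow> real) \<Rightarrow> nat \<Rightarrow> 'F mat set \<Rightarrow> bool"
  where "open_subgroup absF n K \<longleftrightarrow> subgroup K (GL n) \<and> openin (GL_topology absF n) K"

definition smooth_rep :: "('F::field \<Rightarrow> real) \<Rightarrow> nat \<Rightarrow> 'v::complex_vector set
    \<Rightarrow> ('F mat \<Rightarrow> 'v \<Rightarrow> 'v) \<Rightarrow> bool"
  where "smooth_rep absF n V \<rho> \<longleftrightarrow> group_rep (GL n) V \<rho>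
    \<and> (\<forall>x\<in>V. \<exists>K. open_subgroup absF n K \<and> (\<forall>k\<in>K. \<rho> k x = x))"

text \<open>Support contained in \<open>HC\<close> with \<open>C\<close> compact.  For \<open>H\<close> trivial this is compact support.\<close>

definition compact_support_mod :: "('F::field \<Rightarrow> real) \<Rightarrow> nat \<Rightarrow> 'F mat set
    \<Rightarrow> ('F mat \<Rightarrow> 'v::zero) \<Rightarrow> bool"
  where "compact_support_mod absF n H \<phi> \<longleftrightarrow> (\<exists>C. compactin (GL_topology absF n) C
    \<and> {g \<in> carrier (GL n). \<phi> g \<noteq> 0} \<subseteq> H <#>\<^bsub>GL n\<^esub> C)"

abbreviation compact_support :: "('F::field \<Rightarrow> real) \<Rightarrow> nat \<Rightarrow> ('F mat \<Rightarrow> 'v::zero) \<Rightarrow> bool"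
  where "compact_support absF n \<phi> \<equiv> compact_support_mod absF n {1\<^sub>m n} \<phi>"


section \<open>Level zero supercuspidal representations\<close>

text \<open>The unipotent radical of the standard parabolic subgroup of \<open>GL\<^sub>n(k)\<close> whose blocks are the
  intervals of \<open>{0..<n}\<close> cut at the elements of \<open>S \<subseteq> {1..<n}\<close>; the parabolic is proper iff
  \<open>S \<noteq> {}\<close>.\<close>

definition unipotent_radical :: "nat \<Rightarrow> nat set \<Rightarrow> 'k::field mat set"
  where "unipotent_radical n S = {u \<in> carrier (GL n). \<forall>i<n. \<forall>j<n.
    \<not> (\<exists>s\<in>S. i < s \<and> s \<le> j) \<longrightarrow> u $$ (i, j) = (if i = j then 1 else 0)}"

definition cuspidal_rep ::
  "nat \<Rightarrow> 'x::complex_vector set \<Rightarrow> ('k::field mat \<Rightarrow> 'x \<Rightarrow> 'x) \<Rightarrow> bool"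
  where "cuspidal_rep n X \<rho> \<longleftrightarrow> group_rep (GL n) X \<rho>
    \<and> (\<forall>S. S \<subseteq> {1..<n} \<and> S \<noteq> {} \<longrightarrow>
        {x \<in> X. \<forall>u\<in>unipotent_radical n S. \<rho> u x = x} = {0})"

text \<open>No smoothness condition: when \<open>H\<close> is open and the representation is smooth and
  finite-dimensional, right-invariance under an open subgroup is automatic.\<close>

definition compact_induction :: "('F::field \<Rightarrow> real) \<Rightarrow> nat \<Rightarrow> 'F mat set \<Rightarrow> 'v::complex_vector set
    \<Rightarrow> ('F mat \<Rightarrow> 'v \<Rightarrow> 'v) \<Rightarrow> ('F mat \<Rightarrow> 'v) set"
  where "compact_induction absF n H V \<rho> =
    {\<phi> \<in> equivariant_functions (GL n) H V \<rho>. compact_support_mod absF n H \<phi>}"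

definition level_zero_supercuspidal :: "('F::field \<Rightarrow> real) \<Rightarrow> ('F \<Rightarrow> 'k::field) \<Rightarrow> nat
    \<Rightarrow> 'x::complex_vector set \<Rightarrow> ('k mat \<Rightarrow> 'x \<Rightarrow> 'x) \<Rightarrow> ('F mat \<Rightarrow> 'x \<Rightarrow> 'x)
    \<Rightarrow> 'u::complex_vector set \<Rightarrow> ('F mat \<Rightarrow> 'u \<Rightarrow> 'u) \<Rightarrow> bool"
  where "level_zero_supercuspidal absF red f X0 lambar0 Lam0 U \<tau> \<longleftrightarrow>
    smooth_rep absF f U \<tau>
    \<and> irreducible_rep (GL f) X0 lambar0
    \<and> cuspidal_rep f X0 lambar0
    \<and> group_rep ((GL f) \<lparr>carrier := center_GL_integers absF f\<rparr>) X0 Lam0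
    \<and> (\<forall>g\<in>GL_integers absF f. Lam0 g = lambar0 (map_mat red g))
    \<and> (let I = compact_induction absF f (center_GL_integers absF f) X0 Lam0 in
        isomorphic_reps (carrier (GL f)) U \<tau> I (right_translation (GL f) I))"


section \<open>Generalized Steinberg representations\<close>

definition block :: "nat \<Rightarrow> nat \<Rightarrow> nat \<Rightarrow> 'a mat \<Rightarrow> 'a mat"
  where "block f i j A = mat f f (\<lambda>(a, b). A $$ (i * f + a, j * f + b))"

definition standard_parabolic :: "nat \<Rightarrow> nat \<Rightarrow> 'F::field mat set"
  where "standard_parabolic e f =
    {p \<in> carrier (GL (e * f)). \<forall>i<e. \<forall>j<i. block f i j p = 0\<^sub>m f f}"

text \<open>The modulus character \<open>p \<mapsto> \<parallel>det (Ad p | Lie N)\<parallel>\<close>, where \<open>Lie N = \<Oplus>\<^bsub>i<j\<^esub> M\<^sub>f(F)\<close> and the diagonal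
  blocks of \<open>p\<close> act on the \<open>(i,j)\<close> summand by \<open>x \<mapsto> p\<^sub>i\<^sub>i x p\<^sub>j\<^sub>j\<^sup>-\<^sup>1\<close>.\<close>

definition parabolic_modulus :: "('F::field \<Rightarrow> real) \<Rightarrow> nat \<Rightarrow> nat \<Rightarrow> 'F mat \<Rightarrow> real"
  where "parabolic_modulus absF e f p =
    (\<Prod>i<e. \<Prod>j\<in>{i<..<e}. (absF (det (block f i i p)) / absF (det (block f j j p))) ^ f)"

text \<open>\<open>\<tau>\<^sup>a = \<parallel>det\<parallel>\<^sup>a \<tau>\<close>\<close>

definition det_twist :: "('F::field \<Rightarrow> real) \<Rightarrow> real \<Rightarrow> ('F mat \<Rightarrow> 'u::complex_vector \<Rightarrow> 'u)
    \<Rightarrow> 'F mat \<Rightarrow> 'u \<Rightarrow> 'u"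
  where "det_twist absF a \<tau> g = (\<lambda>x. complex_of_real (absF (det g) powr a) *\<^sub>C \<tau> g x)"

text \<open>The representation \<open>\<tau>\<^sup>a \<otimes> \<dots> \<otimes> \<tau>\<^sup>b\<close>, where the exponents run from \<open>a = (1 - e) / 2\<close> to
  \<open>b = (e - 1) / 2\<close> in steps of 1, inflated from the Levi subgroup to the parabolic and twisted by
  the square root of the modulus.\<close>

definition segment_rep :: "('F::field \<Rightarrow> real) \<Rightarrow> nat \<Rightarrow> nat \<Rightarrow> 'u::complex_vector set
    \<Rightarrow> ('F mat \<Rightarrow> 'u \<Rightarrow> 'u) \<Rightarrow> 'F mat \<Rightarrow> 'u tensor \<Rightarrow> 'u tensor"
  where "segment_rep absF e f U \<tau> p =
    (\<lambda>t. complex_of_real (sqrt (parabolic_modulus absF e f p)) *\<^sub>C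
      tensor_map e U (\<lambda>i. det_twist absF ((1 - real e) / 2 + real i) \<tau> (block f i i p)) t)"

definition segment_induction :: "('F::field \<Rightarrow> real) \<Rightarrow> nat \<Rightarrow> nat \<Rightarrow> 'u::complex_vector set
    \<Rightarrow> ('F mat \<Rightarrow> 'u \<Rightarrow> 'u) \<Rightarrow> ('F mat \<Rightarrow> 'u tensor) set"
  where "segment_induction absF e f U \<tau> =
    {\<phi> \<in> equivariant_functions (GL (e * f)) (standard_parabolic e f) (tensor_power e U)
        (segment_rep absF e f U \<tau>).
      \<exists>K. open_subgroup absF (e * f) K \<and>
        (\<forall>g\<in>carrier (GL (e * f)). \<forall>k\<in>K. \<phi> (g * k) = \<phi> g)}"

text \<open>\<open>(\<pi>, V)\<close> is the irreducible quotient of the induced representation (unique up to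
  isomorphism).\<close>

definition generalized_Steinberg :: "('F::field \<Rightarrow> real) \<Rightarrow> nat \<Rightarrow> nat \<Rightarrow> 'u::complex_vector set
    \<Rightarrow> ('F mat \<Rightarrow> 'u \<Rightarrow> 'u) \<Rightarrow> 'v::complex_vector set \<Rightarrow> ('F mat \<Rightarrow> 'v \<Rightarrow> 'v) \<Rightarrow> bool"
  where "generalized_Steinberg absF e f U \<tau> V \<pi> \<longleftrightarrow>
    smooth_rep absF (e * f) V \<pi>
    \<and> irreducible_rep (GL (e * f)) V \<pi>
    \<and> (let I = segment_induction absF e f U \<tau> in
        \<exists>T\<in>intertwiners (carrier (GL (e * f))) I (right_translation (GL (e * f)) I) V \<pi>. T ` I = V)"


section \<open>The simple type\<close>

definition hereditary_order :: "('F::field \<Rightarrow> real) \<Rightarrow> nat \<Rightarrow> nat \<Rightarrow> 'F mat set"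
  where "hereditary_order absF e f = {A \<in> carrier_mat (e * f) (e * f).
    \<forall>i<e. \<forall>j<e. \<forall>a<f. \<forall>b<f. block f i j A $$ (a, b) \<in>
      (if i \<le> j then integer_ring absF else maximal_ideal absF)}"

definition type_group :: "('F::field \<Rightarrow> real) \<Rightarrow> nat \<Rightarrow> nat \<Rightarrow> 'F mat set"
  where "type_group absF e f = order_units (e * f) (hereditary_order absF e f)"

text \<open>Modulo \<open>J\<^sup>1\<close>, an element of \<open>J\<close> is the tuple of the reductions of its diagonal blocks.\<close>

definition type_rep :: "('F::field \<Rightarrow> 'k::field) \<Rightarrow> nat \<Rightarrow> nat \<Rightarrow> 'x::complex_vector set
    \<Rightarrow> ('k mat \<Rightarrow> 'x \<Rightarrow> 'x) \<Rightarrow> 'F mat \<Rightarrow> 'x tensor \<Rightarrow> 'x tensor"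
  where "type_rep red e f X0 lambar0 j =
    tensor_map e X0 (\<lambda>i. lambar0 (map_mat red (block f i i j)))"


section \<open>Hecke algebra and Hecke module\<close>

text \<open>Throughout, \<open>J\<close> is a compact open subgroup of \<open>GL\<^sub>n(F)\<close> and \<open>\<lambda>\<close> a representation of \<open>J\<close> on the
  finite-dimensional space \<open>W\<close>.\<close>

type_synonym ('F, 'w) hecke_fun = "'F mat \<Rightarrow> ('w \<Rightarrow> complex) \<Rightarrow> ('w \<Rightarrow> complex)"

definition Hecke_bar :: "nat \<Rightarrow> 'F::field mat set \<Rightarrow> 'w::complex_vector set
    \<Rightarrow> ('F mat \<Rightarrow> 'w \<Rightarrow> 'w) \<Rightarrow> ('F, 'w) hecke_fun set"
  where "Hecke_bar n J W lam = {\<Psi>. (\<forall>g\<in>carrier (GL n). \<Psi> g \<in> endomorphisms (dual_space W))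
    \<and> (\<forall>g. g \<notin> carrier (GL n) \<longrightarrow> \<Psi> g = 0)
    \<and> (\<forall>j1\<in>J. \<forall>j2\<in>J. \<forall>g\<in>carrier (GL n). \<Psi> (j1 * g * j2) =
        contragredient (GL n) W lam j1 \<circ> \<Psi> g \<circ> contragredient (GL n) W lam j2)}"

definition Hecke_algebra :: "('F::field \<Rightarrow> real) \<Rightarrow> nat \<Rightarrow> 'F mat set \<Rightarrow> 'w::complex_vector set
    \<Rightarrow> ('F mat \<Rightarrow> 'w \<Rightarrow> 'w) \<Rightarrow> ('F, 'w) hecke_fun set"
  where "Hecke_algebra absF n J W lam = {\<phi> \<in> Hecke_bar n J W lam. compact_support absF n \<phi>}"

text \<open>Sum over the cosets of the value at any representative; only finitely many terms are nonzero
  in all uses below.\<close>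

definition coset_sum :: "'g set set \<Rightarrow> ('g \<Rightarrow> 'a::comm_monoid_add) \<Rightarrow> 'a"
  where "coset_sum Q h = (\<Sum>C\<in>{C \<in> Q. h (SOME x. x \<in> C) \<noteq> 0}. h (SOME x. x \<in> C))"

definition Hecke_conv :: "nat \<Rightarrow> 'F::field mat set \<Rightarrow> ('F, 'w) hecke_fun \<Rightarrow> ('F, 'w) hecke_fun
    \<Rightarrow> ('F, 'w::complex_vector) hecke_fun"
  where "Hecke_conv n J \<phi> \<Psi> = (\<lambda>g. if g \<in> carrier (GL n)
    then coset_sum (rcosets\<^bsub>GL n\<^esub> J) (\<lambda>x. \<phi> (g * inv\<^bsub>GL n\<^esub> x) \<circ> \<Psi> x) else 0)"

definition type_induction :: "('F::field \<Rightarrow> real) \<Rightarrow> nat \<Rightarrow> 'F mat set \<Rightarrow> 'w::complex_vector set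
    \<Rightarrow> ('F mat \<Rightarrow> 'w \<Rightarrow> 'w) \<Rightarrow> ('F mat \<Rightarrow> 'w) set"
  where "type_induction absF n J W lam =
    {h \<in> equivariant_functions (GL n) J W lam. compact_support absF n h}"

text \<open>\<open>h \<mapsto> \<phi>\<tilde> \<star> h\<close>, where \<open>\<phi>\<tilde>(g)\<close> is the transpose of \<open>\<phi>(g\<^sup>-\<^sup>1)\<close>.\<close>

definition tilde_conv :: "nat \<Rightarrow> 'F::field mat set \<Rightarrow> 'w::complex_vector set \<Rightarrow> ('F, 'w) hecke_fun
    \<Rightarrow> ('F mat \<Rightarrow> 'w) \<Rightarrow> ('F mat \<Rightarrow> 'w)"
  where "tilde_conv n J W \<phi> h = (\<lambda>g. if g \<in> carrier (GL n)
    then coset_sum (lcosets\<^bsub>GL n\<^esub> J)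
      (\<lambda>x. transpose_map W (\<phi> (inv\<^bsub>GL n\<^esub> x)) (h (inv\<^bsub>GL n\<^esub> x * g))) else 0)"

text \<open>Frobenius reciprocity \<open>Hom\<^sub>G(ind \<lambda>, V) \<rightarrow> Hom\<^sub>J(W, V)\<close>: restrict \<open>\<alpha>\<close> to the copy of \<open>W\<close> formed by
  the functions supported on \<open>J\<close>.\<close>

definition frobenius :: "'F mat set \<Rightarrow> 'w::complex_vector set \<Rightarrow> ('F::field mat \<Rightarrow> 'w \<Rightarrow> 'w)
    \<Rightarrow> (('F mat \<Rightarrow> 'w) \<Rightarrow> 'v::complex_vector) \<Rightarrow> 'w \<Rightarrow> 'v"
  where "frobenius J W lam \<alpha> =
    (\<lambda>w. if w \<in> W then \<alpha> (\<lambda>g. if g \<in> J then lam g w else 0) else 0)"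

text \<open>The action of \<open>\<phi>\<close> on \<open>Hom\<^sub>J(W, V)\<close>: it is \<open>(\<phi> \<cdot> \<alpha>)(h) = \<alpha>(\<phi>\<tilde> \<star> h)\<close> on \<open>Hom\<^sub>G(ind \<lambda>, V)\<close>,
  transported along Frobenius reciprocity.\<close>

definition Hecke_action :: "('F::field \<Rightarrow> real) \<Rightarrow> nat \<Rightarrow> 'F mat set \<Rightarrow> 'w::complex_vector set
    \<Rightarrow> ('F mat \<Rightarrow> 'w \<Rightarrow> 'w) \<Rightarrow> 'v::complex_vector set \<Rightarrow> ('F mat \<Rightarrow> 'v \<Rightarrow> 'v)
    \<Rightarrow> ('F, 'w) hecke_fun \<Rightarrow> ('w \<Rightarrow> 'v) \<Rightarrow> ('w \<Rightarrow> 'v)"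
  where "Hecke_action absF n J W lam V \<pi> \<phi> \<beta> =
    (let I = type_induction absF n J W lam;
         HomG = intertwiners (carrier (GL n)) I (right_translation (GL n) I) V \<pi>;
         \<alpha> = the_inv_into HomG (frobenius J W lam) \<beta>
     in frobenius J W lam (\<lambda>h. if h \<in> I then \<alpha> (tilde_conv n J W \<phi> h) else 0))"

text \<open>The Hecke algebra acts on \<open>Hom\<^sub>J(W, V)\<close> through \<open>chi\<close>.  As \<open>Hom\<^sub>J(W, V)\<close> is one-dimensional for
  generalized Steinberg representations, this determines \<open>chi\<close> on the Hecke algebra.\<close>

definition affords_character :: "('F::field \<Rightarrow> real) \<Rightarrow> nat \<Rightarrow> 'F mat set \<Rightarrow> 'w::complex_vector set
    \<Rightarrow> ('F mat \<Rightarrow> 'w \<Rightarrow> 'w) \<Rightarrow> 'v::complex_vector set \<Rightarrow> ('F mat \<Rightarrow> 'v \<Rightarrow> 'v)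
    \<Rightarrow> (('F, 'w) hecke_fun \<Rightarrow> complex) \<Rightarrow> bool"
  where "affords_character absF n J W lam V \<pi> chi \<longleftrightarrow>
    (\<forall>\<phi>\<in>Hecke_algebra absF n J W lam. \<forall>\<beta>\<in>intertwiners J W lam V \<pi>.
      Hecke_action absF n J W lam V \<pi> \<phi> \<beta> = chi \<phi> *\<^sub>C \<beta>)"

definition Hecke_eigenspace :: "('F::field \<Rightarrow> real) \<Rightarrow> nat \<Rightarrow> 'F mat set \<Rightarrow> 'w::complex_vector set
    \<Rightarrow> ('F mat \<Rightarrow> 'w \<Rightarrow> 'w) \<Rightarrow> (('F, 'w) hecke_fun \<Rightarrow> complex) \<Rightarrow> ('F, 'w) hecke_fun set"
  where "Hecke_eigenspace absF n J W lam chi = {\<Psi> \<in> Hecke_bar n J W lam.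
    \<forall>\<phi>\<in>Hecke_algebra absF n J W lam. Hecke_conv n J \<phi> \<Psi> = chi \<phi> *\<^sub>C \<Psi>}"

end

theory Submission
  imports Defs "HOL-Computational_Algebra.Fundamental_Theorem_Algebra"
begin

text \<open>An element \<open>\<Psi>\<close> of the eigenspace is determined by the scalar by which \<open>\<Psi>(1)\<close> acts.

  Equivariance under \<open>j\<close> on the left and \<open>j\<^sup>-\<^sup>1\<close> on the right makes \<open>\<Psi>(1)\<close> commute with the
  contragredient of \<open>\<lambda>\<close>. As \<open>\<lambda>\<close> is the external tensor power of an irreducible representation of
  \<open>GL\<^sub>f(k)\<close>, and \<open>J\<close> maps onto \<open>GL\<^sub>f(k)\<^sup>e\<close>, Schur's lemma (\<open>Schur_tensor_power\<close>) makes \<open>\<Psi>(1)\<close> a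
  scalar.

  If this scalar is zero, the eigenvalue equation at \<open>1\<close> gives \<open>(\<phi> \<star> \<Psi>)(1) = \<chi>(\<phi>) \<Psi>(1) = 0\<close> for
  every \<open>\<phi>\<close> in the Hecke algebra. The pairing \<open>(\<phi>, \<Psi>) \<mapsto> (\<phi> \<star> \<Psi>)(1)\<close> has no kernel in \<open>\<Psi>\<close>
  (\<open>Hecke_pairing_nondegenerate\<close>): choose a \<open>J\<close>-invariant inner product on the dual of \<open>W\<close> and let
  \<open>\<phi>(x\<^sup>-\<^sup>1)\<close> be the adjoint of \<open>\<Psi>(x)\<close> for \<open>x\<close> in the double coset \<open>J g J\<close>, and \<open>0\<close> elsewhere. This
  is an element of the Hecke algebra, and \<open>\<langle>(\<phi> \<star> \<Psi>)(1) \<xi>, \<xi>\<rangle>\<close> is the sum of the \<open>\<parallel>\<Psi>(x) \<xi>\<parallel>\<^sup>2\<close> over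
  the cosets \<open>J x\<close> in \<open>J g J\<close>. Hence \<open>\<Psi> = 0\<close>, and the eigenspace embeds into the complex numbers.

  Two finiteness statements support this. The residue field \<open>k\<close> is finite, because the ring of
  integers is compact; so \<open>\<lambda>\<close> is a representation on a finite-dimensional space through a finite
  group, which provides the inner product. The group \<open>J\<close> is compact and open, because it is a
  union of residue classes of integral matrices modulo the maximal ideal; so compact sets meet
  only finitely many of its cosets, double cosets are compact, and convolutions are finite sums.\<close>

section \<open>Linear forms on finite-dimensional spaces\<close>

lemma scaleC_complex_eq [simp]: "c *\<^sub>C (z::complex) = c * z"
  by (simp add: scaleC_complex_def)

lemma scaleC_fun_apply [simp]: "(c *\<^sub>C f) x = c *\<^sub>C f x"
  by (simp add: scaleC_fun_def)

lemma cspan_induct [consumes 1, case_names base step]: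
  assumes "x \<in> cspan B" and "P 0"
    and "\<And>c b y. b \<in> B \<Longrightarrow> y \<in> cspan B \<Longrightarrow> P y \<Longrightarrow> P (c *\<^sub>C b + y)"
  shows "P x"
proof -
  have "x \<in> cspan B \<and> P x"
    using assms(1)
    by (induction rule: cvec.span_induct_alt)
      (auto simp: assms cvec.span_zero cvec.span_add cvec.span_scale cvec.span_base)
  then show ?thesis by simp
qed

lemma zero_in_csubspace: "csubspace V \<Longrightarrow> 0 \<in> V"
  by (rule cvec.subspace_0)

lemma linear_maps_in: "T \<in> linear_maps V W \<Longrightarrow> x \<in> V \<Longrightarrow> T x \<in> W"
  by (simp add: linear_maps_def)

lemma linear_maps_add: "T \<in> linear_maps V W \<Longrightarrow> x \<in> V \<Longrightarrow> y \<in> V \<Longrightarrow> T (x + y) = T x + T y"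
  by (simp add: linear_maps_def)

lemma linear_maps_scale: "T \<in> linear_maps V W \<Longrightarrow> x \<in> V \<Longrightarrow> T (c *\<^sub>C x) = c *\<^sub>C T x"
  by (simp add: linear_maps_def)

lemma linear_maps_outside: "T \<in> linear_maps V W \<Longrightarrow> x \<notin> V \<Longrightarrow> T x = 0"
  by (simp add: linear_maps_def)

lemma linear_maps_0:
  assumes "T \<in> linear_maps V W" "csubspace V"
  shows "T 0 = 0"
  using linear_maps_scale[OF assms(1) zero_in_csubspace[OF assms(2)], of 0] by simp

lemma linear_maps_diff:
  assumes T: "T \<in> linear_maps V W" and V: "csubspace V" and x: "x \<in> V" and y: "y \<in> V"
  shows "T (x - y) = T x - T y"
  using linear_maps_add[OF T cvec.subspace_diff[OF V x y] y] by simp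

lemma linear_maps_sum:
  assumes T: "T \<in> linear_maps V W" and V: "csubspace V" and x: "\<And>i. i \<in> I \<Longrightarrow> x i \<in> V"
  shows "T (\<Sum>i\<in>I. x i) = (\<Sum>i\<in>I. T (x i))"
  using x
proof (induction I rule: infinite_finite_induct)
  case (insert i I)
  then show ?case
    by (simp add: linear_maps_add[OF T] cvec.subspace_sum[OF V])
qed (simp_all add: linear_maps_0[OF T V])

lemma linear_maps_eqI:
  assumes S: "S \<in> linear_maps V W" and T: "T \<in> linear_maps V W'"
    and eq: "\<And>x. x \<in> V \<Longrightarrow> S x = T x"
  shows "S = T"
proof
  fix x show "S x = T x"
    by (cases "x \<in> V") (simp_all add: eq linear_maps_outside[OF S] linear_maps_outside[OF T])
qed

lemma linear_maps_comp:
  assumes S: "S \<in> linear_maps V W" and T: "T \<in> linear_maps U V" and V: "csubspace V"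
  shows "S \<circ> T \<in> linear_maps U W"
  unfolding linear_maps_def
  using linear_maps_in[OF T] linear_maps_outside[OF T] linear_maps_0[OF S V]
  by (auto simp: linear_maps_in[OF S] linear_maps_add[OF T] linear_maps_add[OF S]
      linear_maps_scale[OF T] linear_maps_scale[OF S])

lemma csubspace_linear_maps:
  assumes "csubspace W"
  shows "csubspace (linear_maps V W)"
  by (rule cvec.subspaceI)
    (auto simp: linear_maps_def algebra_simps scaleC_add_right scaleC_scaleC
      cvec.subspace_0[OF assms] cvec.subspace_add[OF assms] cvec.subspace_scale[OF assms])

lemma csubspace_dual_space: "csubspace (dual_space V)"
  unfolding dual_space_def by (rule csubspace_linear_maps) (rule cvec.subspace_UNIV)

lemma dual_spaceI:
  assumes "\<And>x y. x \<in> V \<Longrightarrow> y \<in> V \<Longrightarrow> \<xi> (x + y) = \<xi> x + \<xi> y"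
    and "\<And>c x. x \<in> V \<Longrightarrow> \<xi> (c *\<^sub>C x) = c * \<xi> x" and "\<And>x. x \<notin> V \<Longrightarrow> \<xi> x = 0"
  shows "\<xi> \<in> dual_space V"
  unfolding dual_space_def linear_maps_def using assms by simp

lemma dual_space_add: "\<xi> \<in> dual_space V \<Longrightarrow> x \<in> V \<Longrightarrow> y \<in> V \<Longrightarrow> \<xi> (x + y) = \<xi> x + \<xi> y"
  unfolding dual_space_def by (rule linear_maps_add)

lemma dual_space_scale: "\<xi> \<in> dual_space V \<Longrightarrow> x \<in> V \<Longrightarrow> \<xi> (c *\<^sub>C x) = c * \<xi> x"
  unfolding dual_space_def by (simp add: linear_maps_scale)

lemma dual_space_outside: "\<xi> \<in> dual_space V \<Longrightarrow> x \<notin> V \<Longrightarrow> \<xi> x = 0"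
  unfolding dual_space_def by (rule linear_maps_outside)

lemma dual_space_comp:
  "\<xi> \<in> dual_space V \<Longrightarrow> T \<in> endomorphisms V \<Longrightarrow> csubspace V \<Longrightarrow> \<xi> \<circ> T \<in> dual_space V"
  unfolding dual_space_def by (rule linear_maps_comp)

text \<open>Membership in \<open>dual_space V\<close> also fixes the values outside \<open>V\<close>, so it does not pass to
  subspaces; this notion does.\<close>

definition linear_form_on :: "'a::complex_vector set \<Rightarrow> ('a \<Rightarrow> complex) \<Rightarrow> bool"
  where "linear_form_on V \<xi> \<longleftrightarrow> (\<forall>x\<in>V. \<forall>y\<in>V. \<xi> (x + y) = \<xi> x + \<xi> y)
    \<and> (\<forall>c. \<forall>x\<in>V. \<xi> (c *\<^sub>C x) = c * \<xi> x)"

lemma linear_form_on_dual: "\<xi> \<in> dual_space V \<Longrightarrow> linear_form_on V \<xi>"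
  by (simp add: linear_form_on_def dual_space_add dual_space_scale)

lemma linear_form_on_mono: "linear_form_on V \<xi> \<Longrightarrow> W \<subseteq> V \<Longrightarrow> linear_form_on W \<xi>"
  unfolding linear_form_on_def by (meson subsetD)

lemma linear_form_on_0: "linear_form_on V \<xi> \<Longrightarrow> csubspace V \<Longrightarrow> \<xi> 0 = 0"
  unfolding linear_form_on_def using zero_in_csubspace[of V]
  by (metis cvec.scale_zero_left mult_zero_left)

lemma linear_form_on_eq_on_span:
  assumes "linear_form_on (cspan B) \<xi>" "linear_form_on (cspan B) \<eta>"
    and "\<And>b. b \<in> B \<Longrightarrow> \<xi> b = \<eta> b" and "x \<in> cspan B"
  shows "\<xi> x = \<eta> x"
  using assms(4)
proof (induction rule: cspan_induct)
  case base
  then show ?case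
    using linear_form_on_0[OF assms(1)] linear_form_on_0[OF assms(2)] by simp
next
  case (step c b y)
  then have "c *\<^sub>C b \<in> cspan B" "b \<in> cspan B" by (simp_all add: cvec.span_base cvec.span_scale)
  then show ?case
    using assms(1,2) assms(3)[OF step(1)] step(2,3) unfolding linear_form_on_def by simp
qed

text \<open>Induction on the number of generators. Pick \<open>\<xi> \<in> D\<close> with \<open>\<xi> b \<noteq> 0\<close> for one generator \<open>b\<close>;
  the kernel of \<open>\<xi>\<close> needs one generator less, \<open>D\<close> still separates its points, and a form that
  agrees with an element of \<open>D\<close> on \<open>ker \<xi>\<close> differs from it by a multiple of \<open>\<xi>\<close>.\<close>

lemma separating_forms_exhaust:
  assumes "finite B" and D: "csubspace D"
    and "\<And>\<xi>. \<xi> \<in> D \<Longrightarrow> linear_form_on (cspan B) \<xi>"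
    and "\<And>x. x \<in> cspan B \<Longrightarrow> (\<And>\<xi>. \<xi> \<in> D \<Longrightarrow> \<xi> x = 0) \<Longrightarrow> x = 0"
    and "linear_form_on (cspan B) \<eta>"
  shows "\<exists>\<xi>\<in>D. \<forall>x\<in>cspan B. \<xi> x = \<eta> x"
  using assms(1,3-5)
proof (induction "card B" arbitrary: B \<eta> rule: less_induct)
  case (less B)
  show ?case
  proof (cases "cspan B = {0}")
    case True
    then show ?thesis
      using zero_in_csubspace[OF D] linear_form_on_0[OF less.prems(4)]
      by (intro bexI[of _ 0]) simp_all
  next
    case False
    have "\<not> B \<subseteq> {0}"
    proof
      assume "B \<subseteq> {0}"
      then have "cspan B \<subseteq> {0}" by (rule cvec.span_minimal) (rule cvec.subspace_single_0)
      then show False using False cvec.span_zero[of B] by auto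
    qed
    then obtain b where b: "b \<in> B" "b \<noteq> 0" by auto
    have bB: "b \<in> cspan B" using b by (simp add: cvec.span_base)
    then obtain \<xi> where \<xi>: "\<xi> \<in> D" "\<xi> b \<noteq> 0" using less.prems(3) b(2) by blast
    define p where "p x = x - (\<xi> x / \<xi> b) *\<^sub>C b" for x
    have lin: "linear_form_on (cspan B) \<xi>" by (rule less.prems(2)[OF \<xi>(1)])
    have p_add: "p (x + y) = p x + p y" if "x \<in> cspan B" "y \<in> cspan B" for x y
      using lin that unfolding linear_form_on_def p_def
      by (simp add: add_divide_distrib scaleC_add_left)
    have p_scale: "p (c *\<^sub>C x) = c *\<^sub>C p x" if "x \<in> cspan B" for c x
      using lin that unfolding linear_form_on_def p_def
      by (simp add: cvec.scale_right_diff_distrib scaleC_scaleC)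
    have pb: "p b = 0" using \<xi>(2) by (simp add: p_def scaleC_one)
    define E where "E = p ` (B - {b})"
    have p_span: "p x \<in> cspan E" if "x \<in> cspan B" for x
      using that
    proof (induction rule: cspan_induct)
      case base
      then show ?case
        using linear_form_on_0[OF lin] by (simp add: p_def cvec.span_zero)
    next
      case (step c a y)
      have a: "a \<in> cspan B" using step(1) by (rule cvec.span_base)
      have "p a \<in> cspan E"
        using step(1) pb by (cases "a = b") (auto simp: E_def cvec.span_zero intro: cvec.span_base)
      then show ?case
        using a step by (simp add: p_add p_scale cvec.span_scale cvec.span_add)
    qed
    have sub: "cspan E \<subseteq> cspan B"
    proof (rule cvec.span_minimal)
      show "E \<subseteq> cspan B"
        using bB by (auto simp: E_def p_def intro!: cvec.span_diff cvec.span_scale intro: cvec.span_base)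
    qed simp
    have "card E < card B"
      unfolding E_def using card_image_le[of "B - {b}" p] card_Diff1_less[OF less.prems(1) b(1)]
        less.prems(1) by simp
    then have "\<exists>\<delta>\<in>D. \<forall>x\<in>cspan E. \<delta> x = \<eta> x"
    proof (rule less.hyps)
      show "finite E" using less.prems(1) by (simp add: E_def)
      show "linear_form_on (cspan E) \<zeta>" if "\<zeta> \<in> D" for \<zeta>
        by (rule linear_form_on_mono[OF less.prems(2)[OF that] sub])
      show "x = 0" if "x \<in> cspan E" "\<And>\<zeta>. \<zeta> \<in> D \<Longrightarrow> \<zeta> x = 0" for x
        by (rule less.prems(3)) (use that sub in blast)+
      show "linear_form_on (cspan E) \<eta>" by (rule linear_form_on_mono[OF less.prems(4) sub])
    qed
    then obtain \<delta> where \<delta>: "\<delta> \<in> D" "\<And>x. x \<in> cspan E \<Longrightarrow> \<delta> x = \<eta> x" by blast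
    define c where "c = (\<eta> b - \<delta> b) / \<xi> b"
    have "\<delta> x + c * \<xi> x = \<eta> x" if x: "x \<in> cspan B" for x
    proof -
      have px: "p x \<in> cspan B" using p_span[OF x] sub by blast
      have expand: "\<zeta> x = \<zeta> (p x) + \<xi> x / \<xi> b * \<zeta> b" if "linear_form_on (cspan B) \<zeta>" for \<zeta>
      proof -
        have "\<zeta> x = \<zeta> (p x + (\<xi> x / \<xi> b) *\<^sub>C b)" by (simp add: p_def)
        also have "\<dots> = \<zeta> (p x) + \<zeta> ((\<xi> x / \<xi> b) *\<^sub>C b)"
          using that px cvec.span_scale[OF bB] unfolding linear_form_on_def by blast
        also have "\<zeta> ((\<xi> x / \<xi> b) *\<^sub>C b) = \<xi> x / \<xi> b * \<zeta> b"
          using that bB unfolding linear_form_on_def by blast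
        finally show ?thesis .
      qed
      show ?thesis
        using expand[OF less.prems(4)] expand[OF less.prems(2)[OF \<delta>(1)]] \<delta>(2)[OF p_span[OF x]]
          \<xi>(2) by (simp add: c_def field_simps)
    qed
    moreover have "\<delta> + c *\<^sub>C \<xi> \<in> D"
      using D \<delta>(1) \<xi>(1) by (simp add: cvec.subspace_add cvec.subspace_scale)
    ultimately show ?thesis by (intro bexI[of _ "\<delta> + c *\<^sub>C \<xi>"]) simp_all
  qed
qed

lemma sum_fun_apply: "(sum f A) x = (\<Sum>a\<in>A. f a x)"
  by (induction A rule: infinite_finite_induct) auto

lemma dual_basis:
  assumes "finite B"
  obtains E and coord :: "'a::complex_vector \<Rightarrow> 'a \<Rightarrow> complex" where
    "finite E" "cspan E = cspan B" "\<And>b. b \<in> E \<Longrightarrow> coord b \<in> dual_space (cspan B)"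
    "\<And>b b'. b \<in> E \<Longrightarrow> b' \<in> E \<Longrightarrow> coord b b' = (if b = b' then 1 else 0)"
    "\<And>x. x \<in> cspan B \<Longrightarrow> x = (\<Sum>b\<in>E. coord b x *\<^sub>C b)"
proof -
  obtain E where E: "E \<subseteq> B" "\<not> cvec.dependent E" "B \<subseteq> cspan E"
    using cvec.maximal_independent_subset[of B] by blast
  have fin: "finite E" using E(1) assms by (rule finite_subset)
  have sp: "cspan E = cspan B" using E(1,3) cvec.span_mono cvec.span_minimal cvec.subspace_span
    by (metis subset_antisym)
  define coord where "coord b x = (if x \<in> cspan B then cvec.representation E x b else 0)" for b x
  show thesis
  proof
    show "finite E" "cspan E = cspan B" by (fact fin sp)+
    show "coord b \<in> dual_space (cspan B)" for b
      by (rule dual_spaceI)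
        (simp_all add: coord_def cvec.span_add cvec.span_scale cvec.representation_add[OF E(2)]
          cvec.representation_scale[OF E(2)] sp)
    show "coord b b' = (if b = b' then 1 else 0)" if "b \<in> E" "b' \<in> E" for b b'
      using that cvec.span_base[of b' E] by (simp add: coord_def sp cvec.representation_basis[OF E(2)])
    show "x = (\<Sum>b\<in>E. coord b x *\<^sub>C b)" if "x \<in> cspan B" for x
      using that cvec.sum_representation_eq[OF E(2), of x E] fin by (simp add: coord_def sp)
  qed
qed

lemma finite_dimensional_dual:
  assumes "finite B"
  obtains C where "finite C" "cspan C = dual_space (cspan B)"
proof -
  obtain E and coord where E: "finite E" "cspan E = cspan B"
    "\<And>b. b \<in> E \<Longrightarrow> coord b \<in> dual_space (cspan B)"
    "\<And>b b'. b \<in> E \<Longrightarrow> b' \<in> E \<Longrightarrow> coord b b' = (if b = b' then 1 else 0 :: complex)"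
    "\<And>x. x \<in> cspan B \<Longrightarrow> x = (\<Sum>b\<in>E. coord b x *\<^sub>C b)"
    using dual_basis[OF assms] by blast
  have "\<xi> \<in> cspan (coord ` E)" if \<xi>: "\<xi> \<in> dual_space (cspan B)" for \<xi>
  proof -
    have \<xi>': "\<xi> \<in> linear_maps (cspan B) UNIV" using \<xi> by (simp add: dual_space_def)
    have bB: "b \<in> cspan B" if "b \<in> E" for b using that E(2) cvec.span_base by blast
    have "\<xi> x = (\<Sum>b\<in>E. \<xi> b *\<^sub>C coord b) x" for x
    proof (cases "x \<in> cspan B")
      case True
      have "\<xi> x = \<xi> (\<Sum>b\<in>E. coord b x *\<^sub>C b)" using E(5)[OF True] by simp
      also have "\<dots> = (\<Sum>b\<in>E. \<xi> (coord b x *\<^sub>C b))"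
        by (rule linear_maps_sum[OF \<xi>']) (simp_all add: bB cvec.span_scale)
      also have "\<dots> = (\<Sum>b\<in>E. \<xi> b *\<^sub>C coord b) x"
        by (simp add: sum_fun_apply dual_space_scale[OF \<xi> bB] mult.commute)
      finally show ?thesis .
    next
      case False
      then show ?thesis
        using E(3) by (simp add: sum_fun_apply dual_space_outside[OF \<xi>] dual_space_outside[OF E(3)])
    qed
    then have "\<xi> = (\<Sum>b\<in>E. \<xi> b *\<^sub>C coord b)" by blast
    then show ?thesis
      by (metis (no_types, lifting) cvec.span_sum cvec.span_scale cvec.span_base imageI)
  qed
  moreover have "cspan (coord ` E) \<subseteq> dual_space (cspan B)"
    by (rule cvec.span_minimal) (use E(3) csubspace_dual_space in auto)
  ultimately have "cspan (coord ` E) = dual_space (cspan B)" by blast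
  with E(1) show thesis using that[of "coord ` E"] by simp
qed

lemma dual_space_separates:
  assumes "finite B" "x \<in> cspan B" "\<And>\<xi>. \<xi> \<in> dual_space (cspan B) \<Longrightarrow> \<xi> x = 0"
  shows "x = 0"
proof -
  obtain E and coord where E: "\<And>b. b \<in> E \<Longrightarrow> coord b \<in> dual_space (cspan B)"
    "\<And>x. x \<in> cspan B \<Longrightarrow> x = (\<Sum>b\<in>E. coord b x *\<^sub>C b)"
    using dual_basis[OF assms(1)] by metis
  show ?thesis using E(2)[OF assms(2)] assms(3)[OF E(1)] by simp
qed

section \<open>Schur's lemma\<close>

lemma exists_annihilating_polynomial:
  assumes "finite B" and "\<And>i. x i \<in> cspan B"
  obtains p :: "complex poly" where "p \<noteq> 0" "degree p \<le> card B"
    "(\<Sum>i\<le>card B. coeff p i *\<^sub>C x i) = 0"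
proof (cases "inj_on x {..card B}")
  case True
  let ?S = "x ` {..card B}"
  have "card ?S = Suc (card B)" using card_image[OF True] by simp
  then have "cvec.dependent ?S"
    using cvec.independent_span_bound[OF assms(1), of ?S] assms(2) by auto
  then obtain u where u: "\<exists>v\<in>?S. u v \<noteq> 0" "(\<Sum>v\<in>?S. u v *\<^sub>C v) = 0"
    using cvec.dependent_finite[of ?S] by auto
  define p where "p = (\<Sum>i\<le>card B. monom (u (x i)) i)"
  have coeff: "coeff p i = (if i \<le> card B then u (x i) else 0)" for i
    by (simp add: p_def coeff_sum)
  show thesis
  proof
    show "p \<noteq> 0" using u(1) coeff by (metis (mono_tags, lifting) atMost_iff coeff_0 imageE)
    show "degree p \<le> card B" by (rule degree_le) (simp add: coeff)
    show "(\<Sum>i\<le>card B. coeff p i *\<^sub>C x i) = 0"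
    proof -
      have "(\<Sum>i\<le>card B. coeff p i *\<^sub>C x i) = (\<Sum>i\<le>card B. u (x i) *\<^sub>C x i)"
        by (rule sum.cong) (simp_all add: coeff)
      then show ?thesis using u(2) by (simp add: sum.reindex[OF True])
    qed
  qed
next
  case False
  then obtain i j where ij: "i \<le> card B" "j \<le> card B" "i \<noteq> j" "x i = x j"
    by (auto simp: inj_on_def)
  define p where "p = monom (1::complex) i - monom 1 j"
  show thesis
  proof
    show "p \<noteq> 0" using ij(3) by (auto simp: p_def poly_eq_iff)
    show "degree p \<le> card B" using ij
      by (intro degree_le) (simp add: p_def)
    have "(\<Sum>k\<le>card B. coeff p k *\<^sub>C x k)
      = (\<Sum>k\<le>card B. (if k = i then x i else 0) - (if k = j then x j else 0))"
      by (rule sum.cong) (auto simp: p_def scaleC_one)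
    also have "\<dots> = 0" using ij by (simp add: sum_subtractf)
    finally show "(\<Sum>k\<le>card B. coeff p k *\<^sub>C x k) = 0" .
  qed
qed

text \<open>Some nonzero polynomial in \<open>T\<close> kills a chosen nonzero vector; peel off its linear factors
  one by one until the vector is no longer killed.\<close>

lemma eigenvector_exists:
  assumes "finite B" and "cspan B \<noteq> {0}"
    and T: "T \<in> endomorphisms (cspan B)"
  obtains c x where "x \<in> cspan B" "x \<noteq> 0" "T x = c *\<^sub>C x"
proof -
  obtain v where v: "v \<in> cspan B" "v \<noteq> 0" using assms(2) cvec.span_zero by blast
  have Tv: "(T ^^ i) v \<in> cspan B" for i
    by (induction i) (simp_all add: v linear_maps_in[OF T])
  define E where "E p = (\<Sum>i\<le>card B. coeff p i *\<^sub>C (T ^^ i) v)" for p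
  have E_in: "E p \<in> cspan B" for p
    unfolding E_def by (intro cvec.span_sum cvec.span_scale Tv)
  have E_shift: "E ([:- c, 1:] * q) = T (E q) - c *\<^sub>C E q" if q: "degree q < card B" for c q
  proof -
    have "T (E q) = (\<Sum>i\<le>card B. coeff q i *\<^sub>C (T ^^ Suc i) v)"
      unfolding E_def using linear_maps_sum[OF T, of "{..card B}" "\<lambda>i. coeff q i *\<^sub>C (T ^^ i) v"]
      by (simp add: cvec.span_scale Tv linear_maps_scale[OF T Tv])
    also have "\<dots> = (\<Sum>i<card B. coeff q i *\<^sub>C (T ^^ Suc i) v)"
      using q by (simp add: lessThan_Suc_atMost[symmetric] coeff_eq_0)
    also have "\<dots> = (\<Sum>i<Suc (card B). coeff (pCons 0 q) i *\<^sub>C (T ^^ i) v)"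
      by (subst sum.lessThan_Suc_shift) simp
    finally have "T (E q) = E (pCons 0 q)" by (simp add: E_def lessThan_Suc_atMost)
    moreover have "[:- c, 1:] * q = pCons 0 q - smult c q" by simp
    ultimately show ?thesis
      by (simp add: E_def scaleC_scaleC cvec.scale_left_diff_distrib sum_subtractf
          cvec.scale_sum_right del: mult_pCons_left)
  qed
  have "\<exists>c x. x \<in> cspan B \<and> x \<noteq> 0 \<and> T x = c *\<^sub>C x"
    if "p \<noteq> 0" "degree p \<le> card B" "E p = 0" for p
    using that
  proof (induction "degree p" arbitrary: p rule: less_induct)
    case less
    show ?case
    proof (cases "degree p = 0")
      case True
      then obtain a where a: "p = [:a:]" by (rule degree_eq_zeroE)
      have "E p = (\<Sum>i\<le>card B. if i = 0 then a *\<^sub>C v else 0)"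
        unfolding E_def by (rule sum.cong) (auto simp: a coeff_pCons split: nat.split)
      also have "\<dots> = a *\<^sub>C v" by simp
      finally show ?thesis using less.prems a v(2) by simp
    next
      case False
      then obtain c where "poly p c = 0"
        using fundamental_theorem_of_algebra[of p] by (auto simp: constant_degree)
      then obtain q where q: "p = [:- c, 1:] * q" by (auto simp: poly_eq_0_iff_dvd dvd_def)
      with less.prems have q0: "q \<noteq> 0" by auto
      then have deg: "degree p = Suc (degree q)" unfolding q by (subst degree_mult_eq) auto
      have "T (E q) = c *\<^sub>C E q" using E_shift[of q c] less.prems deg by (simp add: q)
      moreover have ?thesis if "E q = 0"
        by (rule less.hyps[of q]) (use deg less.prems q0 that in auto)
      ultimately show ?thesis using E_in by blast
    qed
  qed
  moreover obtain p where "p \<noteq> 0" "degree p \<le> card B" "E p = 0"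
    using exists_annihilating_polynomial[OF assms(1), of "\<lambda>i. (T ^^ i) v"] Tv unfolding E_def by blast
  ultimately show thesis using that by blast
qed

text \<open>The evaluations at points form a space of functionals that separates the linear forms.\<close>

lemma bidual_evaluation:
  assumes B: "finite B" and \<phi>: "linear_form_on (dual_space (cspan B)) \<phi>"
  shows "\<exists>x\<in>cspan B. \<forall>\<eta>\<in>dual_space (cspan B). \<phi> \<eta> = \<eta> x"
proof -
  let ?X' = "dual_space (cspan B)"
  obtain C where C: "finite C" "cspan C = ?X'"
    using finite_dimensional_dual[OF B] by blast
  let ?D = "{\<psi>. \<exists>x\<in>cspan B. \<forall>\<eta>\<in>?X'. \<psi> \<eta> = \<eta> x}"
  have "csubspace ?D"
  proof (rule cvec.subspaceI)
    show "0 \<in> ?D"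
      using cvec.span_zero[of B] linear_form_on_0[OF linear_form_on_dual] by auto
    show "\<psi> + \<psi>' \<in> ?D" if \<psi>: "\<psi> \<in> ?D" and \<psi>': "\<psi>' \<in> ?D" for \<psi> \<psi>'
    proof -
      obtain x where x: "x \<in> cspan B" "\<And>\<eta>. \<eta> \<in> ?X' \<Longrightarrow> \<psi> \<eta> = \<eta> x" using \<psi> by auto
      obtain y where y: "y \<in> cspan B" "\<And>\<eta>. \<eta> \<in> ?X' \<Longrightarrow> \<psi>' \<eta> = \<eta> y" using \<psi>' by auto
      show ?thesis using x y by (auto intro!: bexI[of _ "x + y"] simp: dual_space_add cvec.span_add)
    qed
    show "c *\<^sub>C \<psi> \<in> ?D" if \<psi>: "\<psi> \<in> ?D" for c \<psi>
    proof -
      obtain x where x: "x \<in> cspan B" "\<And>\<eta>. \<eta> \<in> ?X' \<Longrightarrow> \<psi> \<eta> = \<eta> x" using \<psi> by auto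
      show ?thesis using x by (auto intro!: bexI[of _ "c *\<^sub>C x"] simp: dual_space_scale cvec.span_scale)
    qed
  qed
  moreover have "linear_form_on ?X' \<psi>" if \<psi>: "\<psi> \<in> ?D" for \<psi>
  proof -
    obtain x where x: "\<And>\<eta>. \<eta> \<in> ?X' \<Longrightarrow> \<psi> \<eta> = \<eta> x" using \<psi> by blast
    show ?thesis
      unfolding linear_form_on_def
      by (simp add: x cvec.subspace_add[OF csubspace_dual_space]
          cvec.subspace_scale[OF csubspace_dual_space])
  qed
  moreover have "\<eta> = 0" if \<eta>: "\<eta> \<in> ?X'" and "\<And>\<psi>. \<psi> \<in> ?D \<Longrightarrow> \<psi> \<eta> = 0" for \<eta>
  proof
    fix x show "\<eta> x = 0 x"
    proof (cases "x \<in> cspan B")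
      case True
      then have "(\<lambda>\<eta>. \<eta> x) \<in> ?D" by auto
      then show ?thesis using that(2) by fastforce
    qed (simp add: dual_space_outside[OF \<eta>])
  qed
  ultimately have "\<exists>\<psi>\<in>?D. \<forall>\<eta>\<in>?X'. \<psi> \<eta> = \<phi> \<eta>"
    using separating_forms_exhaust[OF C(1), of ?D \<phi>] \<phi> unfolding C(2) by blast
  then show ?thesis by auto
qed

text \<open>Schur's lemma in the bilinear form that applies to a single slot of a tensor product.
  Through the bidual, \<open>F x \<eta> = \<eta> (T x)\<close> for an endomorphism \<open>T\<close>; an eigenvector of \<open>T\<close> lies in the
  subrepresentation of all \<open>x\<close> with \<open>F x \<eta> = c * \<eta> x\<close>, which is therefore everything.\<close>

lemma Schur_bilinear:
  assumes B: "finite B" "cspan B = X" and irr: "irreducible_rep G X \<rho>"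
    and add1: "\<And>x y \<eta>. x \<in> X \<Longrightarrow> y \<in> X \<Longrightarrow> \<eta> \<in> dual_space X \<Longrightarrow> F (x + y) \<eta> = F x \<eta> + F y \<eta>"
    and scale1: "\<And>c x \<eta>. x \<in> X \<Longrightarrow> \<eta> \<in> dual_space X \<Longrightarrow> F (c *\<^sub>C x) \<eta> = c * F x \<eta>"
    and lin2: "\<And>x. x \<in> X \<Longrightarrow> linear_form_on (dual_space X) (F x)"
    and inv: "\<And>g x \<eta>. g \<in> carrier G \<Longrightarrow> x \<in> X \<Longrightarrow> \<eta> \<in> dual_space X \<Longrightarrow> F (\<rho> g x) \<eta> = F x (\<eta> \<circ> \<rho> g)"
  obtains c where "\<And>x \<eta>. x \<in> X \<Longrightarrow> \<eta> \<in> dual_space X \<Longrightarrow> F x \<eta> = c * \<eta> x"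
proof -
  have X: "csubspace X" and \<rho>: "\<And>g. g \<in> carrier G \<Longrightarrow> \<rho> g \<in> endomorphisms X"
    using irr by (auto simp: irreducible_rep_def group_rep_def)
  have "\<exists>y\<in>X. \<forall>\<eta>\<in>dual_space X. F x \<eta> = \<eta> y" if "x \<in> X" for x
    using bidual_evaluation[OF B(1)] lin2[OF that] unfolding B(2) by blast
  then obtain T where T: "\<And>x. x \<in> X \<Longrightarrow> T x \<in> X"
    "\<And>x \<eta>. x \<in> X \<Longrightarrow> \<eta> \<in> dual_space X \<Longrightarrow> F x \<eta> = \<eta> (T x)" by metis
  have eqI: "x = y" if "x \<in> X" "y \<in> X" "\<And>\<eta>. \<eta> \<in> dual_space X \<Longrightarrow> \<eta> x = \<eta> y" for x y
  proof -
    have "x - y = 0"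
    proof (rule dual_space_separates[OF B(1)], unfold B(2))
      show "x - y \<in> X" by (rule cvec.subspace_diff[OF X that(1,2)])
      show "\<eta> (x - y) = 0" if "\<eta> \<in> dual_space X" for \<eta>
        using linear_maps_diff[of \<eta> X UNIV x y] that \<open>x \<in> X\<close> \<open>y \<in> X\<close> X
          \<open>\<And>\<eta>. \<eta> \<in> dual_space X \<Longrightarrow> \<eta> x = \<eta> y\<close> by (simp add: dual_space_def)
    qed
    then show ?thesis by simp
  qed
  define T' where "T' x = (if x \<in> X then T x else 0)" for x
  have "T' \<in> endomorphisms (cspan B)"
    unfolding linear_maps_def B(2)
  proof (intro CollectI conjI ballI allI impI)
    show "T' (x + y) = T' x + T' y" if "x \<in> X" "y \<in> X" for x y
    proof (rule eqI)
      fix \<eta> assume "\<eta> \<in> dual_space X"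
      then show "\<eta> (T' (x + y)) = \<eta> (T' x + T' y)"
        using that by (simp add: T'_def cvec.subspace_add[OF X] T(1) dual_space_add T(2)[symmetric] add1)
    qed (use that in \<open>simp_all add: T'_def cvec.subspace_add[OF X] T(1)\<close>)
    show "T' (c *\<^sub>C x) = c *\<^sub>C T' x" if "x \<in> X" for c x
    proof (rule eqI)
      fix \<eta> assume "\<eta> \<in> dual_space X"
      then show "\<eta> (T' (c *\<^sub>C x)) = \<eta> (c *\<^sub>C T' x)"
        using that by (simp add: T'_def cvec.subspace_scale[OF X] T(1) dual_space_scale T(2)[symmetric] scale1)
    qed (use that in \<open>simp_all add: T'_def cvec.subspace_scale[OF X] T(1)\<close>)
  qed (simp_all add: T'_def T(1))
  moreover have "cspan B \<noteq> {0}" using irr B(2) by (simp add: irreducible_rep_def)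
  ultimately obtain c x where x: "x \<in> X" "x \<noteq> 0" "T' x = c *\<^sub>C x"
    using eigenvector_exists[OF B(1)] B(2) by metis
  let ?S = "{y \<in> X. \<forall>\<eta>\<in>dual_space X. F y \<eta> = c * \<eta> y}"
  have "csubspace ?S"
  proof (rule cvec.subspaceI)
    show "0 \<in> ?S"
      using zero_in_csubspace[OF X] scale1[of 0 _ 0] linear_form_on_0[OF linear_form_on_dual X] by auto
  qed (auto simp: cvec.subspace_add[OF X] cvec.subspace_scale[OF X] add1 scale1 dual_space_add
      dual_space_scale algebra_simps)
  moreover have "\<forall>g\<in>carrier G. \<rho> g ` ?S \<subseteq> ?S"
    using linear_maps_in[OF \<rho>] dual_space_comp[OF _ \<rho> X] by (auto simp: inv)
  moreover have "x \<in> ?S" using x by (auto simp: T(2) T'_def dual_space_scale)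
  ultimately have "?S = X" using irr x(2) unfolding irreducible_rep_def by blast
  then show thesis using that by blast
qed

text \<open>The span of the finite orbit of a nonzero vector is a nonzero subrepresentation.\<close>

lemma irreducible_finite_group_finite_dimensional:
  assumes fin: "finite (carrier G)" and grp: "group G" and irr: "irreducible_rep G X \<rho>"
  obtains B where "finite B" "cspan B = X"
proof -
  interpret group G by (rule grp)
  have X: "csubspace X" and \<rho>: "\<And>g. g \<in> carrier G \<Longrightarrow> \<rho> g \<in> endomorphisms X"
    and \<rho>1: "\<And>x. x \<in> X \<Longrightarrow> \<rho> \<one>\<^bsub>G\<^esub> x = x" and nz: "X \<noteq> {0}"
    and hom: "\<And>g h. g \<in> carrier G \<Longrightarrow> h \<in> carrier G \<Longrightarrow> \<rho> (g \<otimes>\<^bsub>G\<^esub> h) = \<rho> g \<circ> \<rho> h"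
    using irr by (auto simp: irreducible_rep_def group_rep_def)
  obtain v where v: "v \<in> X" "v \<noteq> 0" using nz zero_in_csubspace[OF X] by blast
  let ?B = "(\<lambda>g. \<rho> g v) ` carrier G"
  have sub: "cspan ?B \<subseteq> X"
  proof (rule cvec.span_minimal[OF _ X])
    show "?B \<subseteq> X" using linear_maps_in[OF \<rho> v(1)] by (intro image_subsetI)
  qed
  have inv: "\<rho> g x \<in> cspan ?B" if g: "g \<in> carrier G" and x: "x \<in> cspan ?B" for g x
    using x
  proof (induction rule: cspan_induct)
    case base
    have "\<rho> g 0 \<in> cspan ?B" unfolding linear_maps_0[OF \<rho>[OF g] X] by (rule cvec.span_zero)
    then show ?case .
  next
    case (step c b y)
    obtain h where h: "b = \<rho> h v" "h \<in> carrier G" using step(1) by (rule imageE)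
    have "b \<in> X" "y \<in> X" using sub step(2) cvec.span_base[OF step(1)] by blast+
    then have "\<rho> g (c *\<^sub>C b + y) = c *\<^sub>C \<rho> g b + \<rho> g y"
      by (simp add: linear_maps_add[OF \<rho>[OF g]] linear_maps_scale[OF \<rho>[OF g]] cvec.subspace_scale[OF X])
    moreover have "\<rho> g b = \<rho> (g \<otimes>\<^bsub>G\<^esub> h) v" using hom[OF g h(2)] h(1) by simp
    then have "\<rho> g b \<in> cspan ?B" using g h(2) by (intro cvec.span_base) simp
    ultimately have "\<rho> g (c *\<^sub>C b + y) \<in> cspan ?B"
      using step(3) by (simp add: cvec.span_add cvec.span_scale)
    then show ?case .
  qed
  have "v \<in> cspan ?B" using \<rho>1[OF v(1)] by (intro cvec.span_base image_eqI[of _ _ "\<one>\<^bsub>G\<^esub>"]) simp_all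
  then have "cspan ?B \<noteq> {0}" using v(2) by blast
  moreover have "\<forall>g\<in>carrier G. \<rho> g ` cspan ?B \<subseteq> cspan ?B" using inv by (intro ballI image_subsetI)
  ultimately have "cspan ?B = X"
    using irr sub unfolding irreducible_rep_def by (meson cvec.subspace_span)
  then show thesis using that fin by blast
qed

section \<open>Tensor powers\<close>

lemma pure_tensor_cong:
  "(\<And>i. i < e \<Longrightarrow> x i = y i) \<Longrightarrow> pure_tensor e X x = pure_tensor e X y"
proof -
  assume eq: "\<And>i. i < e \<Longrightarrow> x i = y i"
  have "(\<Prod>i<e. \<xi> i (x i)) = (\<Prod>i<e. \<xi> i (y i) :: complex)" for \<xi> :: "nat \<Rightarrow> 'a \<Rightarrow> complex"
    by (rule prod.cong) (simp_all add: eq)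
  then show ?thesis unfolding pure_tensor_def by (simp only:)
qed

lemma prod_upd_form:
  assumes "i < (e::nat)"
  shows "(\<Prod>k<e. (\<xi>(i := \<alpha>)) k (x k)) = \<alpha> (x i) * (\<Prod>k\<in>{..<e} - {i}. \<xi> k (x k) :: complex)"
  using assms by (subst prod.remove[of _ i]) (auto intro!: prod.cong)

lemma prod_upd_vector:
  assumes "i < (e::nat)"
  shows "(\<Prod>k<e. \<xi> k ((x(i := y)) k)) = \<xi> i y * (\<Prod>k\<in>{..<e} - {i}. \<xi> k (x k) :: complex)"
  using assms by (subst prod.remove[of _ i]) (auto intro!: prod.cong)

lemma pure_tensor_in: "(\<And>i. i < e \<Longrightarrow> x i \<in> X) \<Longrightarrow> pure_tensor e X x \<in> tensor_power e X"
  unfolding tensor_power_def by (rule cvec.span_base) blast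

lemma csubspace_tensor_power: "csubspace (tensor_power e X)"
  unfolding tensor_power_def by simp

lemma tensor_power_induct [consumes 1, case_names zero pure_add]:
  assumes "t \<in> tensor_power e X" and "P 0"
    and "\<And>c x t. (\<And>i. i < e \<Longrightarrow> x i \<in> X) \<Longrightarrow> t \<in> tensor_power e X \<Longrightarrow> P t
      \<Longrightarrow> P (c *\<^sub>C pure_tensor e X x + t)"
  shows "P t"
  using assms unfolding tensor_power_def by (induction rule: cspan_induct) blast+

lemma pure_tensor_add:
  assumes "i < e" "y \<in> X" "z \<in> X"
  shows "pure_tensor e X (x(i := y + z)) = pure_tensor e X (x(i := y)) + pure_tensor e X (x(i := z))"
proof
  fix \<xi>
  show "pure_tensor e X (x(i := y + z)) \<xi> = (pure_tensor e X (x(i := y)) + pure_tensor e X (x(i := z))) \<xi>"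
    unfolding pure_tensor_def plus_fun_apply prod_upd_vector[OF assms(1)]
    using assms dual_space_add[of "\<xi> i" X y z]
    by (auto simp: algebra_simps)
qed

lemma pure_tensor_scale:
  assumes "i < e" "y \<in> X"
  shows "pure_tensor e X (x(i := c *\<^sub>C y)) = c *\<^sub>C pure_tensor e X (x(i := y))"
proof
  fix \<xi>
  show "pure_tensor e X (x(i := c *\<^sub>C y)) \<xi> = (c *\<^sub>C pure_tensor e X (x(i := y))) \<xi>"
    unfolding pure_tensor_def scaleC_fun_apply prod_upd_vector[OF assms(1)]
    using assms dual_space_scale[of "\<xi> i" X y c]
    by auto
qed

text \<open>Multilinearity replaces the factors of a pure tensor by generators, one slot at a time.\<close>

lemma tensor_power_finite_dimensional:
  assumes "finite B"
  obtains C where "finite C" "cspan C = tensor_power e (cspan B)"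
proof -
  let ?X = "cspan B"
  let ?C = "pure_tensor e ?X ` PiE {..<e} (\<lambda>_. B)"
  have base: "pure_tensor e ?X x \<in> ?C" if "\<And>i. i < e \<Longrightarrow> x i \<in> B" for x
  proof (rule image_eqI)
    show "pure_tensor e ?X x = pure_tensor e ?X (restrict x {..<e})" by (rule pure_tensor_cong) simp
  qed (use that in auto)
  have step: "pure_tensor e ?X x \<in> cspan ?C"
    if "m \<le> e" "\<And>i. i < e \<Longrightarrow> x i \<in> (if i < m then ?X else B)" for m x
    using that
  proof (induction m arbitrary: x)
    case 0
    then show ?case using base[of x] by (auto intro: cvec.span_base)
  next
    case (Suc m)
    have "x m \<in> ?X" using Suc.prems(1) Suc.prems(2)[of m] by simp
    define p where "p z = pure_tensor e ?X (x(m := z))" for z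
    have p_add: "p (y + z) = p y + p z" if "y \<in> ?X" "z \<in> ?X" for y z
      unfolding p_def using Suc.prems(1) that by (intro pure_tensor_add) auto
    have p_scale: "p (c *\<^sub>C y) = c *\<^sub>C p y" if "y \<in> ?X" for c y
      unfolding p_def using Suc.prems(1) that by (intro pure_tensor_scale) auto
    from \<open>x m \<in> ?X\<close> have "p (x m) \<in> cspan ?C"
    proof (induction rule: cspan_induct)
      case base
      have "p 0 = 0" using p_scale[of 0 0] by (simp add: cvec.span_zero)
      then have "p 0 \<in> cspan ?C" using cvec.span_zero by metis
      then show ?case .
    next
      case (step c b y)
      have b: "b \<in> ?X" using step(1) by (rule cvec.span_base)
      have "p b \<in> cspan ?C"
        unfolding p_def
      proof (rule Suc.IH)
        show "(x(m := b)) i \<in> (if i < m then ?X else B)" if "i < e" for i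
          using Suc.prems(2)[OF that] step(1) by (cases i m rule: linorder_cases) auto
      qed (use Suc.prems(1) in simp)
      then have "p (c *\<^sub>C b + y) \<in> cspan ?C"
        using step b by (simp add: p_add p_scale cvec.span_add cvec.span_scale)
      then show ?case .
    qed
    then show ?case by (simp add: p_def)
  qed
  have "tensor_power e ?X \<subseteq> cspan ?C"
    unfolding tensor_power_def
    by (rule cvec.span_minimal) (use step[of e] in auto)
  moreover have "cspan ?C \<subseteq> tensor_power e ?X"
    by (rule cvec.span_minimal[OF _ csubspace_tensor_power])
      (auto intro!: pure_tensor_in cvec.span_base dest: PiE_mem)
  ultimately show thesis using that[of ?C] assms by (simp add: finite_PiE subset_antisym)
qed

lemma tensor_outside:
  assumes "t \<in> tensor_power e X" "\<not> (\<forall>i<e. \<xi> i \<in> dual_space X)"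
  shows "t \<xi> = 0"
  using assms(1)
  by (induction rule: tensor_power_induct) (use assms(2) in \<open>auto simp: pure_tensor_def\<close>)

lemma tensor_relation:
  assumes "t \<in> tensor_power e X"
    and "\<And>x. pure_tensor e X x \<xi> = a * pure_tensor e X x \<xi>' + b * pure_tensor e X x \<xi>''"
  shows "t \<xi> = a * t \<xi>' + b * t \<xi>''"
  using assms(1)
  by (induction rule: tensor_power_induct) (simp_all add: assms(2) algebra_simps)

lemma tensor_cong:
  assumes "t \<in> tensor_power e X" "\<And>i. i < e \<Longrightarrow> \<xi> i = \<xi>' i"
  shows "t \<xi> = t \<xi>'"
proof -
  have "pure_tensor e X x \<xi> = pure_tensor e X x \<xi>'" for x
  proof -
    have "(\<Prod>i<e. \<xi> i (x i)) = (\<Prod>i<e. \<xi>' i (x i))" by (rule prod.cong) (simp_all add: assms(2))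
    moreover have "(\<forall>i<e. \<xi> i \<in> dual_space X) = (\<forall>i<e. \<xi>' i \<in> dual_space X)" using assms(2) by simp
    ultimately show ?thesis unfolding pure_tensor_def by (simp only:)
  qed
  then show ?thesis using tensor_relation[OF assms(1), of \<xi> 1 \<xi>' 0 \<xi>'] by simp
qed

lemma tensor_form_add:
  assumes "t \<in> tensor_power e X" "i < e" "\<alpha> \<in> dual_space X" "\<beta> \<in> dual_space X"
  shows "t (\<xi>(i := \<alpha> + \<beta>)) = t (\<xi>(i := \<alpha>)) + t (\<xi>(i := \<beta>))"
proof -
  have "pure_tensor e X x (\<xi>(i := \<alpha> + \<beta>)) = pure_tensor e X x (\<xi>(i := \<alpha>)) + pure_tensor e X x (\<xi>(i := \<beta>))" for x
    unfolding pure_tensor_def prod_upd_form[OF assms(2)]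
    using assms cvec.subspace_add[OF csubspace_dual_space assms(3,4)] by (auto simp: algebra_simps)
  then show ?thesis
    using tensor_relation[OF assms(1), of "\<xi>(i := \<alpha> + \<beta>)" 1 "\<xi>(i := \<alpha>)" 1 "\<xi>(i := \<beta>)"]
    by (simp only: mult_1)
qed

lemma tensor_form_scale:
  assumes "t \<in> tensor_power e X" "i < e" "\<alpha> \<in> dual_space X"
  shows "t (\<xi>(i := c *\<^sub>C \<alpha>)) = c * t (\<xi>(i := \<alpha>))"
proof -
  have "pure_tensor e X x (\<xi>(i := c *\<^sub>C \<alpha>)) = c * pure_tensor e X x (\<xi>(i := \<alpha>))" for x
    unfolding pure_tensor_def prod_upd_form[OF assms(2)]
    using assms cvec.subspace_scale[OF csubspace_dual_space assms(3)] by auto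
  then show ?thesis
    using tensor_relation[OF assms(1), of "\<xi>(i := c *\<^sub>C \<alpha>)" c "\<xi>(i := \<alpha>)" 0 "\<xi>(i := \<alpha>)"]
    by (simp only: mult_zero_left add_0_right)
qed

lemma tensor_map_cong:
  assumes "\<And>i. i < e \<Longrightarrow> T i = T' i"
  shows "tensor_map e X T = tensor_map e X T'"
proof
  fix t
  have eq: "t (\<lambda>i. \<xi> i \<circ> T i) = t (\<lambda>i. \<xi> i \<circ> T' i)" if "t \<in> tensor_power e X" for \<xi>
    by (rule tensor_cong[OF that]) (simp add: assms)
  show "tensor_map e X T t = tensor_map e X T' t"
  proof (cases "t \<in> tensor_power e X")
    case True
    then show ?thesis unfolding tensor_map_def by (simp only: eq[OF True])
  qed (simp add: tensor_map_def)
qed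

lemma tensor_map_pure:
  assumes X: "csubspace X" and T: "\<And>i. i < e \<Longrightarrow> T i \<in> endomorphisms X"
    and x: "\<And>i. i < e \<Longrightarrow> x i \<in> X"
  shows "tensor_map e X T (pure_tensor e X x) = pure_tensor e X (\<lambda>i. T i (x i))"
proof
  fix \<xi>
  show "tensor_map e X T (pure_tensor e X x) \<xi> = pure_tensor e X (\<lambda>i. T i (x i)) \<xi>"
  proof (cases "\<forall>i<e. \<xi> i \<in> dual_space X")
    case True
    then have "\<forall>i<e. \<xi> i \<circ> T i \<in> dual_space X" using dual_space_comp[OF _ T X] by blast
    moreover have "tensor_map e X T (pure_tensor e X x) \<xi> = pure_tensor e X x (\<lambda>i. \<xi> i \<circ> T i)"
      using True pure_tensor_in[OF x, of e] unfolding tensor_map_def by simp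
    ultimately show ?thesis using True unfolding pure_tensor_def by simp
  next
    case False
    have "tensor_map e X T t \<xi> = 0" for t using False unfolding tensor_map_def by auto
    then show ?thesis using False by (auto simp: pure_tensor_def)
  qed
qed

lemma tensor_map_linear:
  assumes "s \<in> tensor_power e X" "t \<in> tensor_power e X"
  shows "tensor_map e X T (c *\<^sub>C s + t) = c *\<^sub>C tensor_map e X T s + tensor_map e X T t"
proof
  fix \<xi>
  have "c *\<^sub>C s + t \<in> tensor_power e X"
    by (rule cvec.subspace_add[OF csubspace_tensor_power cvec.subspace_scale[OF csubspace_tensor_power]])
      (fact assms)+
  then show "tensor_map e X T (c *\<^sub>C s + t) \<xi> = (c *\<^sub>C tensor_map e X T s + tensor_map e X T t) \<xi>"
    using assms unfolding tensor_map_def by (cases "\<forall>i<e. \<xi> i \<in> dual_space X") auto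
qed

lemma tensor_map_endomorphism:
  assumes X: "csubspace X" and T: "\<And>i. i < e \<Longrightarrow> T i \<in> endomorphisms X"
  shows "tensor_map e X T \<in> endomorphisms (tensor_power e X)"
  unfolding linear_maps_def
proof (intro CollectI conjI ballI allI impI)
  have zero: "tensor_map e X T 0 = 0"
  proof
    fix \<xi> show "tensor_map e X T 0 \<xi> = 0 \<xi>" by (simp add: tensor_map_def)
  qed
  have zero_in: "tensor_map e X T 0 \<in> tensor_power e X"
    unfolding zero by (rule zero_in_csubspace[OF csubspace_tensor_power])
  show "tensor_map e X T t \<in> tensor_power e X" if "t \<in> tensor_power e X" for t
    using that
  proof (induction rule: tensor_power_induct)
    case zero
    show ?case by (rule zero_in)
  next
    case (pure_add c x t)
    have "pure_tensor e X (\<lambda>i. T i (x i)) \<in> tensor_power e X"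
      by (rule pure_tensor_in) (rule linear_maps_in[OF T pure_add(1)])
    then have "tensor_map e X T (c *\<^sub>C pure_tensor e X x + t) \<in> tensor_power e X"
      using pure_add by (simp add: tensor_map_linear pure_tensor_in tensor_map_pure[OF X T]
          cvec.subspace_add[OF csubspace_tensor_power] cvec.subspace_scale[OF csubspace_tensor_power])
    then show ?case .
  qed
  show "tensor_map e X T (s + t) = tensor_map e X T s + tensor_map e X T t"
    if "s \<in> tensor_power e X" "t \<in> tensor_power e X" for s t
    using tensor_map_linear[OF that, of T 1] by (simp add: scaleC_one)
  show "tensor_map e X T (c *\<^sub>C s) = c *\<^sub>C tensor_map e X T s" if "s \<in> tensor_power e X" for c s
    using tensor_map_linear[OF that zero_in_csubspace[OF csubspace_tensor_power], of T c] zero by simp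
qed (simp add: tensor_map_def)

lemma tensor_map_eqI:
  assumes X: "csubspace X" and S: "S \<in> endomorphisms (tensor_power e X)"
    and T: "T \<in> endomorphisms (tensor_power e X)"
    and eq: "\<And>x. (\<And>i. i < e \<Longrightarrow> x i \<in> X) \<Longrightarrow> S (pure_tensor e X x) = T (pure_tensor e X x)"
  shows "S = T"
proof (rule linear_maps_eqI[OF S T])
  fix t assume "t \<in> tensor_power e X"
  then show "S t = T t"
  proof (induction rule: tensor_power_induct)
    case zero
    have "S 0 = T 0"
      by (simp add: linear_maps_0[OF S csubspace_tensor_power] linear_maps_0[OF T csubspace_tensor_power])
    then show ?case .
  next
    case (pure_add c x t)
    have "pure_tensor e X x \<in> tensor_power e X" by (rule pure_tensor_in) (rule pure_add(1))
    then have "S (c *\<^sub>C pure_tensor e X x + t) = T (c *\<^sub>C pure_tensor e X x + t)"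
      using pure_add eq[OF pure_add(1)]
      by (simp add: linear_maps_add[OF S] linear_maps_add[OF T] linear_maps_scale[OF S]
          linear_maps_scale[OF T] cvec.subspace_scale[OF csubspace_tensor_power])
    then show ?case .
  qed
qed

lemma tensor_map_comp:
  assumes X: "csubspace X" and S: "\<And>i. i < e \<Longrightarrow> S i \<in> endomorphisms X"
    and T: "\<And>i. i < e \<Longrightarrow> T i \<in> endomorphisms X"
  shows "tensor_map e X S \<circ> tensor_map e X T = tensor_map e X (\<lambda>i. S i \<circ> T i)"
proof (rule tensor_map_eqI[OF X])
  have ST: "S i \<circ> T i \<in> endomorphisms X" if "i < e" for i
    by (rule linear_maps_comp[OF S[OF that] T[OF that] X])
  show "tensor_map e X (\<lambda>i. S i \<circ> T i) \<in> endomorphisms (tensor_power e X)"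
    by (rule tensor_map_endomorphism[OF X ST])
  show "tensor_map e X S \<circ> tensor_map e X T \<in> endomorphisms (tensor_power e X)"
    by (rule linear_maps_comp[OF tensor_map_endomorphism[OF X S] tensor_map_endomorphism[OF X T]
          csubspace_tensor_power])
  show "(tensor_map e X S \<circ> tensor_map e X T) (pure_tensor e X x)
      = tensor_map e X (\<lambda>i. S i \<circ> T i) (pure_tensor e X x)" if x: "\<And>i. i < e \<Longrightarrow> x i \<in> X" for x
  proof -
    have "tensor_map e X S (pure_tensor e X (\<lambda>i. T i (x i))) = pure_tensor e X (\<lambda>i. S i (T i (x i)))"
      by (rule tensor_map_pure[OF X S]) (use linear_maps_in[OF T x] in auto)
    then show ?thesis by (simp add: tensor_map_pure[OF X T x] tensor_map_pure[OF X ST x])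
  qed
qed

lemma tensor_map_identity:
  assumes X: "csubspace X" and id: "\<And>i x. i < e \<Longrightarrow> x \<in> X \<Longrightarrow> T i x = x" and T: "\<And>i. i < e \<Longrightarrow> T i \<in> endomorphisms X"
    and t: "t \<in> tensor_power e X"
  shows "tensor_map e X T t = t"
proof
  fix \<xi>
  show "tensor_map e X T t \<xi> = t \<xi>"
  proof (cases "\<forall>i<e. \<xi> i \<in> dual_space X")
    case True
    have "\<xi> i \<circ> T i = \<xi> i" if "i < e" for i
    proof -
      have \<xi>: "\<xi> i \<in> dual_space X" using True that by simp
      have "\<xi> i (T i x) = \<xi> i x" for x
        using id[OF that, of x] linear_maps_outside[OF T[OF that], of x]
          linear_form_on_0[OF linear_form_on_dual[OF \<xi>] X] dual_space_outside[OF \<xi>, of x]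
        by (cases "x \<in> X") simp_all
      then show ?thesis by auto
    qed
    then have "t (\<lambda>i. \<xi> i \<circ> T i) = t \<xi>" by (intro tensor_cong[OF t]) simp
    moreover have "tensor_map e X T t \<xi> = t (\<lambda>i. \<xi> i \<circ> T i)"
      using True t unfolding tensor_map_def by simp
    ultimately show ?thesis by simp
  qed (use t tensor_outside[OF t] in \<open>auto simp: tensor_map_def\<close>)
qed

definition evaluation :: "nat \<Rightarrow> 'a::complex_vector set \<Rightarrow> (nat \<Rightarrow> 'a \<Rightarrow> complex) \<Rightarrow> 'a tensor \<Rightarrow> complex"
  where "evaluation e X \<xi> = (\<lambda>t. if t \<in> tensor_power e X then t \<xi> else 0)"

lemma evaluation_in_dual: "evaluation e X \<xi> \<in> dual_space (tensor_power e X)"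
  by (rule dual_spaceI)
    (auto simp: evaluation_def cvec.subspace_add[OF csubspace_tensor_power]
      cvec.subspace_scale[OF csubspace_tensor_power])

lemma evaluation_add:
  assumes "i < e" "\<alpha> \<in> dual_space X" "\<beta> \<in> dual_space X"
  shows "evaluation e X (\<xi>(i := \<alpha> + \<beta>)) = evaluation e X (\<xi>(i := \<alpha>)) + evaluation e X (\<xi>(i := \<beta>))"
proof
  fix t
  show "evaluation e X (\<xi>(i := \<alpha> + \<beta>)) t = (evaluation e X (\<xi>(i := \<alpha>)) + evaluation e X (\<xi>(i := \<beta>))) t"
  proof (cases "t \<in> tensor_power e X")
    case True
    then have ev: "evaluation e X \<zeta> t = t \<zeta>" for \<zeta> by (simp add: evaluation_def)
    show ?thesis
      unfolding plus_fun_apply[of "evaluation e X (\<xi>(i := \<alpha>))" "evaluation e X (\<xi>(i := \<beta>))" t] ev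
      by (rule tensor_form_add[OF True assms])
  qed (simp add: evaluation_def)
qed

lemma evaluation_scale:
  assumes "i < e" "\<alpha> \<in> dual_space X"
  shows "evaluation e X (\<xi>(i := c *\<^sub>C \<alpha>)) = c *\<^sub>C evaluation e X (\<xi>(i := \<alpha>))"
proof
  fix t
  show "evaluation e X (\<xi>(i := c *\<^sub>C \<alpha>)) t = (c *\<^sub>C evaluation e X (\<xi>(i := \<alpha>))) t"
  proof (cases "t \<in> tensor_power e X")
    case True
    then have ev: "evaluation e X \<zeta> t = t \<zeta>" for \<zeta> by (simp add: evaluation_def)
    show ?thesis
      unfolding scaleC_fun_apply[of c "evaluation e X (\<xi>(i := \<alpha>))" t] ev scaleC_complex_eq
      by (rule tensor_form_scale[OF True assms])
  qed (simp add: evaluation_def)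
qed

lemma evaluation_pure:
  assumes "\<And>i. i < e \<Longrightarrow> x i \<in> X" "\<And>i. i < e \<Longrightarrow> \<xi> i \<in> dual_space X"
  shows "evaluation e X \<xi> (pure_tensor e X x) = (\<Prod>i<e. \<xi> i (x i))"
  using assms(2) pure_tensor_in[OF assms(1)] by (simp add: evaluation_def pure_tensor_def)

lemma evaluation_comp_tensor_map:
  assumes X: "csubspace X" and T: "\<And>i. i < e \<Longrightarrow> T i \<in> endomorphisms X"
    and \<xi>: "\<And>i. i < e \<Longrightarrow> \<xi> i \<in> dual_space X"
  shows "evaluation e X \<xi> \<circ> tensor_map e X T = evaluation e X (\<lambda>i. \<xi> i \<circ> T i)"
proof
  fix t
  show "(evaluation e X \<xi> \<circ> tensor_map e X T) t = evaluation e X (\<lambda>i. \<xi> i \<circ> T i) t"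
  proof (cases "t \<in> tensor_power e X")
    case True
    have "tensor_map e X T t \<in> tensor_power e X"
      by (rule linear_maps_in[OF tensor_map_endomorphism[OF X T] True])
    moreover have "tensor_map e X T t \<xi> = t (\<lambda>i. \<xi> i \<circ> T i)"
      using True \<xi> unfolding tensor_map_def by simp
    ultimately show ?thesis using True unfolding evaluation_def comp_apply by (simp only: if_True)
  next
    case False
    then have "tensor_map e X T t = 0" by (simp add: tensor_map_def)
    then show ?thesis using False by (simp add: evaluation_def)
  qed
qed

lemma evaluation_cong:
  assumes "\<And>i. i < e \<Longrightarrow> \<xi> i = \<xi>' i"
  shows "evaluation e X \<xi> = evaluation e X \<xi>'"
proof
  fix t
  show "evaluation e X \<xi> t = evaluation e X \<xi>' t"
    using tensor_cong[of t e X \<xi> \<xi>'] assms unfolding evaluation_def by simp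
qed

text \<open>For \<open>F(x, \<xi>) = (T ev\<^sub>\<xi>)(x\<^sub>0 \<otimes> \<dots> \<otimes> x\<^bsub>e-1\<^esub>)\<close>, the bilinear Schur lemma in the single slot \<open>i\<close>
  shows that \<open>F\<close> depends on \<open>(x\<^sub>i, \<xi>\<^sub>i)\<close> only through the factor \<open>\<xi>\<^sub>i(x\<^sub>i)\<close>. Replacing the slots
  one after the other makes \<open>F\<close> proportional to \<open>\<Prod>\<^sub>i \<xi>\<^sub>i(x\<^sub>i)\<close>, so \<open>T\<close> is a scalar on the forms
  \<open>ev\<^sub>\<xi>\<close>, which exhaust the dual because they separate the tensors.\<close>

lemma Schur_tensor_power:
  fixes \<rho> :: "'g \<Rightarrow> 'a::complex_vector \<Rightarrow> 'a" and T :: "('a tensor \<Rightarrow> complex) \<Rightarrow> 'a tensor \<Rightarrow> complex"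
  assumes grp: "group G" and B: "finite B" "cspan B = X" and irr: "irreducible_rep G X \<rho>"
    and T: "T \<in> endomorphisms (dual_space (tensor_power e X))"
    and comm: "\<And>g \<zeta>. (\<And>i. i < e \<Longrightarrow> g i \<in> carrier G) \<Longrightarrow> \<zeta> \<in> dual_space (tensor_power e X) \<Longrightarrow>
      T (\<zeta> \<circ> tensor_map e X (\<lambda>i. \<rho> (g i))) = T \<zeta> \<circ> tensor_map e X (\<lambda>i. \<rho> (g i))"
  obtains c where "\<And>\<zeta>. \<zeta> \<in> dual_space (tensor_power e X) \<Longrightarrow> T \<zeta> = c *\<^sub>C \<zeta>"
proof -
  let ?W = "tensor_power e X" and ?ev = "evaluation e X" and ?pure = "pure_tensor e X"
  interpret group G by (rule grp)
  have X: "csubspace X" and \<rho>: "\<And>g. g \<in> carrier G \<Longrightarrow> \<rho> g \<in> endomorphisms X"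
    and \<rho>1: "\<And>x. x \<in> X \<Longrightarrow> \<rho> \<one>\<^bsub>G\<^esub> x = x" and nz: "X \<noteq> {0}"
    using irr by (auto simp: irreducible_rep_def group_rep_def)
  have Tev: "T (?ev \<xi>) \<in> dual_space ?W" for \<xi>
    by (rule linear_maps_in[OF T evaluation_in_dual])
  define F where "F x \<xi> = T (?ev \<xi>) (?pure x)" for x \<xi>
  have slot: "\<exists>c. \<forall>y\<in>X. \<forall>\<eta>\<in>dual_space X. F (x(i := y)) (\<xi>(i := \<eta>)) = c * \<eta> y"
    if i: "i < e" and x: "\<And>k. k < e \<Longrightarrow> x k \<in> X" and \<xi>: "\<And>k. k < e \<Longrightarrow> \<xi> k \<in> dual_space X" for i x \<xi>
  proof -
    have pin: "?pure (x(i := y)) \<in> ?W" if "y \<in> X" for y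
      by (rule pure_tensor_in) (use x that in auto)
    obtain c where "\<And>y \<eta>. y \<in> X \<Longrightarrow> \<eta> \<in> dual_space X \<Longrightarrow> F (x(i := y)) (\<xi>(i := \<eta>)) = c * \<eta> y"
    proof (rule Schur_bilinear[OF B irr, of "\<lambda>y \<eta>. F (x(i := y)) (\<xi>(i := \<eta>))"])
      show "F (x(i := y + z)) (\<xi>(i := \<eta>)) = F (x(i := y)) (\<xi>(i := \<eta>)) + F (x(i := z)) (\<xi>(i := \<eta>))"
        if "y \<in> X" "z \<in> X" for y z \<eta>
        unfolding F_def pure_tensor_add[OF i that] by (rule dual_space_add[OF Tev pin[OF that(1)] pin[OF that(2)]])
      show "F (x(i := c *\<^sub>C y)) (\<xi>(i := \<eta>)) = c * F (x(i := y)) (\<xi>(i := \<eta>))" if "y \<in> X" for c y \<eta>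
        unfolding F_def pure_tensor_scale[OF i that] by (rule dual_space_scale[OF Tev pin[OF that]])
      show "linear_form_on (dual_space X) (\<lambda>\<eta>. F (x(i := y)) (\<xi>(i := \<eta>)))" for y
        unfolding linear_form_on_def F_def
        by (simp add: evaluation_add[OF i] evaluation_scale[OF i] linear_maps_add[OF T]
            linear_maps_scale[OF T] evaluation_in_dual)
      show "F (x(i := \<rho> g y)) (\<xi>(i := \<eta>)) = F (x(i := y)) (\<xi>(i := \<eta> \<circ> \<rho> g))"
        if g: "g \<in> carrier G" and y: "y \<in> X" and \<eta>: "\<eta> \<in> dual_space X" for g y \<eta>
      proof -
        let ?g = "\<lambda>k. if k = i then g else \<one>\<^bsub>G\<^esub>"
        let ?M = "tensor_map e X (\<lambda>k. \<rho> (?g k))"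
        have g_in: "?g k \<in> carrier G" for k using g by simp
        have \<xi>': "(\<xi>(i := \<eta>)) k \<in> dual_space X" if "k < e" for k using \<xi>[OF that] \<eta> by simp
        have p1: "?pure (\<lambda>k. \<rho> (?g k) ((x(i := y)) k)) = ?pure (x(i := \<rho> g y))"
          by (rule pure_tensor_cong) (use x \<rho>1 in auto)
        have p2: "?M (?pure (x(i := y))) = ?pure (\<lambda>k. \<rho> (?g k) ((x(i := y)) k))"
          by (rule tensor_map_pure[OF X \<rho>[OF g_in]]) (use x y in auto)
        have e2: "?ev (\<lambda>k. (\<xi>(i := \<eta>)) k \<circ> \<rho> (?g k)) = ?ev (\<xi>(i := \<eta> \<circ> \<rho> g))"
        proof (rule evaluation_cong)
          fix k assume k: "k < e"
          show "(\<xi>(i := \<eta>)) k \<circ> \<rho> (?g k) = (\<xi>(i := \<eta> \<circ> \<rho> g)) k"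
          proof (cases "k = i")
            case False
            have "\<xi> k (\<rho> \<one>\<^bsub>G\<^esub> z) = \<xi> k z" for z
              using \<rho>1[of z] linear_maps_outside[OF \<rho>[OF one_closed], of z]
                linear_form_on_0[OF linear_form_on_dual[OF \<xi>[OF k]] X] dual_space_outside[OF \<xi>[OF k], of z]
              by (cases "z \<in> X") simp_all
            then have "\<xi> k \<circ> \<rho> \<one>\<^bsub>G\<^esub> = \<xi> k" by (rule_tac ext) simp
            then show ?thesis using False by simp
          qed simp
        qed
        have e1: "?ev (\<xi>(i := \<eta>)) \<circ> ?M = ?ev (\<lambda>k. (\<xi>(i := \<eta>)) k \<circ> \<rho> (?g k))"
          by (rule evaluation_comp_tensor_map[OF X \<rho>[OF g_in] \<xi>'])
        have c: "T (?ev (\<xi>(i := \<eta>)) \<circ> ?M) = T (?ev (\<xi>(i := \<eta>))) \<circ> ?M"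
          by (rule comm[OF g_in evaluation_in_dual])
        have "F (x(i := \<rho> g y)) (\<xi>(i := \<eta>)) = (T (?ev (\<xi>(i := \<eta>))) \<circ> ?M) (?pure (x(i := y)))"
          unfolding F_def comp_apply p1[symmetric] p2 by (rule refl)
        also have "\<dots> = F (x(i := y)) (\<xi>(i := \<eta> \<circ> \<rho> g))"
          unfolding F_def c[symmetric] e1 e2 by (rule refl)
        finally show ?thesis .
      qed
    qed blast
    then show ?thesis by blast
  qed
  have swap: "F x \<xi> * (\<Prod>i<m. \<eta> i (y i))
      = F (\<lambda>k. if k < m then y k else x k) (\<lambda>k. if k < m then \<eta> k else \<xi> k) * (\<Prod>i<m. \<xi> i (x i))"
    if "m \<le> e" and x: "\<And>k. k < e \<Longrightarrow> x k \<in> X" and \<xi>: "\<And>k. k < e \<Longrightarrow> \<xi> k \<in> dual_space X"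
      and y: "\<And>k. k < e \<Longrightarrow> y k \<in> X" and \<eta>: "\<And>k. k < e \<Longrightarrow> \<eta> k \<in> dual_space X" for m x \<xi> y \<eta>
    using that(1)
  proof (induction m)
    case (Suc m)
    let ?x = "\<lambda>m k. if k < m then y k else x k" and ?\<xi> = "\<lambda>m k. if k < m then \<eta> k else \<xi> k"
    have "\<exists>c. \<forall>z\<in>X. \<forall>\<zeta>\<in>dual_space X. F ((?x m)(m := z)) ((?\<xi> m)(m := \<zeta>)) = c * \<zeta> z"
      by (rule slot) (use Suc.prems x y \<xi> \<eta> in auto)
    then obtain c where c: "\<And>z \<zeta>. z \<in> X \<Longrightarrow> \<zeta> \<in> dual_space X \<Longrightarrow> F ((?x m)(m := z)) ((?\<xi> m)(m := \<zeta>)) = c * \<zeta> z"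
      by blast
    have "(?x m)(m := x m) = ?x m" "(?\<xi> m)(m := \<xi> m) = ?\<xi> m"
      "(?x m)(m := y m) = ?x (Suc m)" "(?\<xi> m)(m := \<eta> m) = ?\<xi> (Suc m)" by auto
    then have "F (?x m) (?\<xi> m) = c * \<xi> m (x m)" "F (?x (Suc m)) (?\<xi> (Suc m)) = c * \<eta> m (y m)"
      using c[of "x m" "\<xi> m"] c[of "y m" "\<eta> m"] Suc.prems x \<xi> y \<eta> by simp_all
    moreover have "F x \<xi> * (\<Prod>i<m. \<eta> i (y i)) = F (?x m) (?\<xi> m) * (\<Prod>i<m. \<xi> i (x i))"
      using Suc by simp
    ultimately have "F x \<xi> * (\<Prod>i<m. \<eta> i (y i)) * \<eta> m (y m)
        = F (?x (Suc m)) (?\<xi> (Suc m)) * (\<Prod>i<m. \<xi> i (x i)) * \<xi> m (x m)"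
      by (simp only: mult_ac)
    then show ?case by (simp only: prod.lessThan_Suc mult.assoc)
  qed simp
  obtain y where y: "y \<in> X" "y \<noteq> 0" using nz zero_in_csubspace[OF X] by blast
  then obtain \<eta>' where \<eta>': "\<eta>' \<in> dual_space X" "\<eta>' y \<noteq> 0"
    using dual_space_separates[OF B(1)] B(2) by blast
  define \<eta> where "\<eta> = (1 / \<eta>' y) *\<^sub>C \<eta>'"
  have \<eta>: "\<eta> \<in> dual_space X" "\<eta> y = 1"
    using \<eta>' cvec.subspace_scale[OF csubspace_dual_space] by (simp_all add: \<eta>_def)
  define c where "c = F (\<lambda>_. y) (\<lambda>_. \<eta>)"
  have scalar: "T (?ev \<xi>) = c *\<^sub>C ?ev \<xi>" if \<xi>: "\<And>k. k < e \<Longrightarrow> \<xi> k \<in> dual_space X" for \<xi>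
  proof (rule linear_maps_eqI)
    show "T (?ev \<xi>) \<in> linear_maps ?W UNIV" using Tev by (simp add: dual_space_def)
    show "c *\<^sub>C ?ev \<xi> \<in> linear_maps ?W UNIV"
      using cvec.subspace_scale[OF csubspace_dual_space evaluation_in_dual] by (simp add: dual_space_def)
    have pure: "T (?ev \<xi>) (?pure x) = c * ?ev \<xi> (?pure x)" if x: "\<And>k. k < e \<Longrightarrow> x k \<in> X" for x
    proof -
      have ev: "?ev \<xi> (?pure x) = (\<Prod>i<e. \<xi> i (x i))" by (rule evaluation_pure[OF x \<xi>])
      have hyb: "?pure (\<lambda>k. if k < e then y else x k) = ?pure (\<lambda>_. y)"
        by (rule pure_tensor_cong) simp
      have hyb': "?ev (\<lambda>k. if k < e then \<eta> else \<xi> k) = ?ev (\<lambda>_. \<eta>)"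
        by (rule evaluation_cong) simp
      show ?thesis
        using swap[of e x \<xi> "\<lambda>_. y" "\<lambda>_. \<eta>"] x \<xi> y \<eta> ev
        unfolding F_def c_def hyb hyb' by simp
    qed
    show "T (?ev \<xi>) t = (c *\<^sub>C ?ev \<xi>) t" if "t \<in> ?W" for t
      using that
    proof (induction rule: tensor_power_induct)
      case zero
      have "T (?ev \<xi>) 0 = (c *\<^sub>C ?ev \<xi>) 0"
        by (simp add: linear_form_on_0[OF linear_form_on_dual[OF Tev] csubspace_tensor_power]
            linear_form_on_0[OF linear_form_on_dual[OF evaluation_in_dual] csubspace_tensor_power])
      then show ?case .
    next
      case (pure_add d x t)
      have "?pure x \<in> ?W" by (rule pure_tensor_in) (rule pure_add(1))
      then have "T (?ev \<xi>) (d *\<^sub>C ?pure x + t) = (c *\<^sub>C ?ev \<xi>) (d *\<^sub>C ?pure x + t)"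
        using pure_add pure[OF pure_add(1)]
        by (simp add: dual_space_add[OF Tev] dual_space_scale[OF Tev] dual_space_add[OF evaluation_in_dual]
            dual_space_scale[OF evaluation_in_dual] cvec.subspace_scale[OF csubspace_tensor_power] distrib_left
            mult.left_commute)
      then show ?case .
    qed
  qed
  obtain C where C: "finite C" "cspan C = ?W"
    using tensor_power_finite_dimensional[OF B(1)] B(2) by metis
  let ?D = "{\<zeta> \<in> dual_space ?W. T \<zeta> = c *\<^sub>C \<zeta>}"
  have D: "csubspace ?D"
  proof (rule cvec.subspaceI)
    show "0 \<in> ?D" using zero_in_csubspace[OF csubspace_dual_space] linear_maps_0[OF T csubspace_dual_space] by simp
  qed (auto simp: cvec.subspace_add[OF csubspace_dual_space] cvec.subspace_scale[OF csubspace_dual_space]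
      linear_maps_add[OF T] linear_maps_scale[OF T] scaleC_add_right scaleC_scaleC mult.commute)
  have sep: "t = 0" if t: "t \<in> ?W" and van: "\<And>\<zeta>. \<zeta> \<in> ?D \<Longrightarrow> \<zeta> t = 0" for t
  proof
    fix \<xi> show "t \<xi> = 0 \<xi>"
    proof (cases "\<forall>i<e. \<xi> i \<in> dual_space X")
      case True
      then have "?ev \<xi> \<in> ?D" using scalar evaluation_in_dual by blast
      then have "?ev \<xi> t = 0" by (rule van)
      then show ?thesis using t by (simp add: evaluation_def)
    qed (simp add: tensor_outside[OF t])
  qed
  have "T \<zeta> = c *\<^sub>C \<zeta>" if \<zeta>: "\<zeta> \<in> dual_space ?W" for \<zeta>
  proof -
    have "\<exists>\<delta>\<in>?D. \<forall>t\<in>cspan C. \<delta> t = \<zeta> t"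
    proof (rule separating_forms_exhaust[OF C(1) D], unfold C(2))
      show "linear_form_on ?W \<delta>" if "\<delta> \<in> ?D" for \<delta> using that linear_form_on_dual by blast
      show "linear_form_on ?W \<zeta>" using \<zeta> by (rule linear_form_on_dual)
    qed (rule sep)
    then obtain \<delta> where \<delta>: "\<delta> \<in> ?D" "\<And>t. t \<in> ?W \<Longrightarrow> \<delta> t = \<zeta> t" unfolding C(2) by blast
    have "\<delta> = \<zeta>"
    proof (rule linear_maps_eqI)
      show "\<delta> \<in> linear_maps ?W UNIV" using \<delta>(1) by (simp add: dual_space_def)
      show "\<zeta> \<in> linear_maps ?W UNIV" using \<zeta> by (simp add: dual_space_def)
    qed (rule \<delta>(2))
    then show ?thesis using \<delta>(1) by simp
  qed
  then show thesis using that by blast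
qed

section \<open>The topology of the local field and of its matrices\<close>

context nonarch_local_field
begin

lemma abs_0 [simp]: "absF 0 = 0"
  by (simp add: abs_eq_0)

lemma abs_1 [simp]: "absF 1 = 1"
  using abs_mult[of 1 1] abs_eq_0[of 1] by simp

lemma abs_minus [simp]: "absF (- x) = absF x"
proof -
  have "absF (- 1) * absF (- 1) = 1" using abs_mult[of "- 1" "- 1"] by simp
  then have "absF (- 1) = 1 \<or> absF (- 1) = - 1" by (simp only: square_eq_1_iff)
  then have "absF (- 1) = 1" using abs_nonneg[of "- 1"] by linarith
  then show ?thesis using abs_mult[of "- 1" x] by simp
qed

lemma abs_diff_commute: "absF (x - y) = absF (y - x)"
  using abs_minus[of "x - y"] by simp

lemma abs_diff_ultrametric: "absF (x - y) \<le> max (absF x) (absF y)"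
  using abs_ultrametric[of x "- y"] by simp

lemma abs_sum_le:
  assumes "0 \<le> s" "\<And>i. i \<in> I \<Longrightarrow> absF (x i) \<le> s"
  shows "absF (\<Sum>i\<in>I. x i) \<le> s"
  using assms(2)
proof (induction I rule: infinite_finite_induct)
  case (insert i I)
  then have "max (absF (x i)) (absF (\<Sum>i\<in>I. x i)) \<le> s" by simp
  with abs_ultrametric[of "x i" "\<Sum>i\<in>I. x i"] have "absF (x i + (\<Sum>i\<in>I. x i)) \<le> s"
    by (rule order_trans)
  then show ?case using insert(1,2) by simp
qed (use assms(1) in simp_all)

lemma abs_sum_less:
  assumes "0 < s" "\<And>i. i \<in> I \<Longrightarrow> absF (x i) < s"
  shows "absF (\<Sum>i\<in>I. x i) < s"
  using assms(2)
proof (induction I rule: infinite_finite_induct)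
  case (insert i I)
  then have "max (absF (x i)) (absF (\<Sum>i\<in>I. x i)) < s" by simp
  with abs_ultrametric[of "x i" "\<Sum>i\<in>I. x i"] have "absF (x i + (\<Sum>i\<in>I. x i)) < s"
    by (rule order_le_less_trans)
  then show ?case using insert(1,2) by simp
qed (use assms(1) in simp_all)

lemma metric: "Metric_space UNIV (\<lambda>x y. absF (x - y))"
proof
  show "0 \<le> absF (x - y)" for x y by (rule abs_nonneg)
  show "absF (x - y) = absF (y - x)" for x y by (rule abs_diff_commute)
  show "(absF (x - y) = 0) = (x = y)" for x y unfolding abs_eq_0 by (rule right_minus_eq)
  show "absF (x - z) \<le> absF (x - y) + absF (y - z)" for x y z
    using abs_ultrametric[of "x - y" "y - z"] abs_nonneg[of "x - y"] abs_nonneg[of "y - z"]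
    by (simp add: max_def split: if_splits)
qed

sublocale field_metric: Metric_space UNIV "\<lambda>x y. absF (x - y)"
  rewrites "Metric_space.mtopology UNIV (\<lambda>x y. absF (x - y)) = field_topology absF"
  by (rule metric) (simp add: field_topology_def)

lemma mem_ball [simp]: "y \<in> field_metric.mball x \<epsilon> \<longleftrightarrow> absF (x - y) < \<epsilon>"
  by (simp add: field_metric.mball_def)

lemma topspace_field [simp]: "topspace (field_topology absF) = UNIV"
  using field_metric.topspace_mtopology by simp

lemma continuous_into_field_iff:
  "continuous_map X (field_topology absF) f \<longleftrightarrow>
    (\<forall>x\<in>topspace X. \<forall>\<epsilon>>0. \<exists>U. openin X U \<and> x \<in> U \<and> (\<forall>y\<in>U. absF (f x - f y) < \<epsilon>))"
  unfolding field_metric.continuous_map_to_metric mem_ball by (rule refl)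

lemma continuous_add:
  assumes "continuous_map X (field_topology absF) f" "continuous_map X (field_topology absF) g"
  shows "continuous_map X (field_topology absF) (\<lambda>x. f x + g x)"
  unfolding continuous_into_field_iff
proof (intro ballI allI impI)
  fix x \<epsilon> assume x: "x \<in> topspace X" and \<epsilon>: "(0::real) < \<epsilon>"
  obtain U where U: "openin X U" "x \<in> U" "\<And>y. y \<in> U \<Longrightarrow> absF (f x - f y) < \<epsilon>"
    using assms(1)[unfolded continuous_into_field_iff, rule_format, OF x \<epsilon>] by blast
  obtain V where V: "openin X V" "x \<in> V" "\<And>y. y \<in> V \<Longrightarrow> absF (g x - g y) < \<epsilon>"
    using assms(2)[unfolded continuous_into_field_iff, rule_format, OF x \<epsilon>] by blast
  have "absF ((f x + g x) - (f y + g y)) < \<epsilon>" if "y \<in> U \<inter> V" for y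
  proof -
    have "max (absF (f x - f y)) (absF (g x - g y)) < \<epsilon>" using U(3) V(3) that by simp
    with abs_ultrametric have "absF ((f x - f y) + (g x - g y)) < \<epsilon>" by (rule order_le_less_trans)
    then show ?thesis by (simp only: add_diff_add)
  qed
  then show "\<exists>U. openin X U \<and> x \<in> U \<and> (\<forall>y\<in>U. absF (f x + g x - (f y + g y)) < \<epsilon>)"
    by (intro exI[of _ "U \<inter> V"] conjI ballI openin_Int IntI U(1,2) V(1,2))
qed

lemma continuous_scale:
  assumes "continuous_map X (field_topology absF) f"
  shows "continuous_map X (field_topology absF) (\<lambda>x. c * f x)"
proof (cases "c = 0")
  case False
  then have c: "0 < absF c" using abs_nonneg[of c] abs_eq_0[of c] by simp
  show ?thesis
    unfolding continuous_into_field_iff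
  proof (intro ballI allI impI)
    fix x \<epsilon> assume x: "x \<in> topspace X" and "(0::real) < \<epsilon>"
    then have pos: "0 < \<epsilon> / absF c" using c by simp
    obtain U where U: "openin X U" "x \<in> U" "\<And>y. y \<in> U \<Longrightarrow> absF (f x - f y) < \<epsilon> / absF c"
      using assms[unfolded continuous_into_field_iff, rule_format, OF x pos] by blast
    have "absF (c * f x - c * f y) < \<epsilon>" if "y \<in> U" for y
    proof -
      have "absF (c * f x - c * f y) = absF c * absF (f x - f y)"
        by (simp only: right_diff_distrib[symmetric] abs_mult)
      then show ?thesis using U(3)[OF that] c by (simp add: pos_less_divide_eq mult.commute)
    qed
    then show "\<exists>U. openin X U \<and> x \<in> U \<and> (\<forall>y\<in>U. absF (c * f x - c * f y) < \<epsilon>)"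
      by (intro exI[of _ U] conjI ballI U(1,2))
  qed
next
  case True
  then show ?thesis by (simp only: mult_zero_left continuous_map_const) simp
qed

lemma continuous_sum:
  assumes "\<And>i. i \<in> I \<Longrightarrow> continuous_map X (field_topology absF) (f i)"
  shows "continuous_map X (field_topology absF) (\<lambda>x. \<Sum>i\<in>I. f i x)"
  using assms
proof (induction I rule: infinite_finite_induct)
  case (insert i I)
  then have "continuous_map X (field_topology absF) (\<lambda>x. f i x + (\<Sum>i\<in>I. f i x))"
    by (intro continuous_add) simp_all
  then show ?case by (simp only: sum.insert[OF insert(1,2)])
qed simp_all


lemma exists_small:
  assumes "0 < (\<epsilon>::real)"
  obtains a where "a \<noteq> 0" "absF a < \<epsilon>"
proof -
  obtain x where x: "x \<noteq> 0" "absF x \<noteq> 1" using nondiscrete by blast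
  define b where "b = (if absF x < 1 then x else inverse x)"
  have b0: "b \<noteq> 0" using x by (simp add: b_def)
  have "absF x * absF (inverse x) = 1" using x abs_mult[of x "inverse x"] by simp
  have "absF b < 1"
  proof (cases "absF x < 1")
    case False
    then have "1 < absF x" using x(2) by simp
    moreover have "absF (inverse x) = 1 / absF x"
      using \<open>absF x * absF (inverse x) = 1\<close> \<open>1 < absF x\<close>
      by (simp add: eq_divide_eq mult.commute)
    ultimately show ?thesis using False by (simp add: b_def)
  qed (simp add: b_def)
  then obtain k where "absF b ^ k < \<epsilon>" using real_arch_pow_inv[OF assms] by blast
  moreover have "absF (b ^ k) = absF b ^ k" by (induction k) (simp_all add: abs_mult)
  ultimately show thesis using that[of "b ^ k"] b0 by simp
qed

text \<open>Local compactness gives a compact neighbourhood of \<open>0\<close>, hence a compact closed ball; the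
  ring of integers is a rescaling of it.\<close>

lemma compactin_integer_ring: "compactin (field_topology absF) (integer_ring absF)"
proof -
  obtain U K where UK: "openin (field_topology absF) U" "compactin (field_topology absF) K" "0 \<in> U" "U \<subseteq> K"
    using locally_compact[unfolded locally_compact_space_def topspace_field, rule_format, OF UNIV_I[of 0]]
    by blast
  obtain \<epsilon> where \<epsilon>: "0 < \<epsilon>" "field_metric.mball 0 \<epsilon> \<subseteq> U"
    using UK(1)[unfolded field_metric.openin_mtopology] UK(3) by blast
  obtain a where a: "a \<noteq> 0" "absF a < \<epsilon>" using exists_small[OF \<epsilon>(1)] .
  let ?S = "field_metric.mcball 0 (absF a)"
  have "?S \<subseteq> K"
  proof
    fix x assume "x \<in> ?S"
    then have "x \<in> field_metric.mball 0 \<epsilon>" using a(2) by (simp add: field_metric.mcball_def)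
    then show "x \<in> K" using \<epsilon>(2) UK(4) by blast
  qed
  then have "compactin (field_topology absF) ?S"
    by (rule closed_compactin[OF UK(2)]) (rule field_metric.closedin_mcball)
  moreover have "continuous_map (field_topology absF) (field_topology absF) (\<lambda>x. inverse a * x)"
    by (rule continuous_scale) (simp add: continuous_map_id[unfolded id_def])
  ultimately have "compactin (field_topology absF) ((\<lambda>x. inverse a * x) ` ?S)"
    by (rule image_compactin)
  moreover have "(\<lambda>x. inverse a * x) ` ?S = integer_ring absF"
  proof (intro equalityI subsetI)
    have a_pos: "0 < absF a" using a(1) abs_nonneg[of a] abs_eq_0[of a] by simp
    have inv: "absF (inverse a) * absF a = 1" using a(1) abs_mult[of "inverse a" a] by simp
    show "y \<in> integer_ring absF" if y: "y \<in> (\<lambda>x. inverse a * x) ` ?S" for y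
    proof -
      obtain x where "x \<in> ?S" and y_eq: "y = inverse a * x" using y by (rule imageE)
      then have x: "absF x \<le> absF a" by (simp add: field_metric.mcball_def)
      have "absF y \<le> absF (inverse a) * absF a"
        unfolding y_eq abs_mult by (rule mult_left_mono[OF x abs_nonneg])
      then show ?thesis unfolding inv by (simp add: integer_ring_def)
    qed
    show "y \<in> (\<lambda>x. inverse a * x) ` ?S" if "y \<in> integer_ring absF" for y
    proof (rule image_eqI)
      show "y = inverse a * (a * y)" using a(1) by simp
      show "a * y \<in> ?S"
        using that a_pos mult_left_mono[of "absF y" 1 "absF a"]
        by (simp add: field_metric.mcball_def integer_ring_def abs_mult)
    qed
  qed
  ultimately show ?thesis by simp
qed

lemma integer_add: "x \<in> integer_ring absF \<Longrightarrow> y \<in> integer_ring absF \<Longrightarrow> x + y \<in> integer_ring absF"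
  using abs_ultrametric[of x y] by (simp add: integer_ring_def)

lemma integer_diff: "x \<in> integer_ring absF \<Longrightarrow> y \<in> integer_ring absF \<Longrightarrow> x - y \<in> integer_ring absF"
  using abs_diff_ultrametric[of x y] by (simp add: integer_ring_def)

lemma integer_mult: "x \<in> integer_ring absF \<Longrightarrow> y \<in> integer_ring absF \<Longrightarrow> x * y \<in> integer_ring absF"
  by (simp add: integer_ring_def abs_mult mult_le_one abs_nonneg)

lemma integer_0 [simp]: "0 \<in> integer_ring absF" and integer_1 [simp]: "1 \<in> integer_ring absF"
  by (simp_all add: integer_ring_def)

lemma integer_sum: "(\<And>i. i \<in> I \<Longrightarrow> x i \<in> integer_ring absF) \<Longrightarrow> (\<Sum>i\<in>I. x i) \<in> integer_ring absF"
  unfolding integer_ring_def using abs_sum_le[of 1 I x] by simp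

lemma maximal_mult_left: "x \<in> integer_ring absF \<Longrightarrow> y \<in> maximal_ideal absF \<Longrightarrow> x * y \<in> maximal_ideal absF"
  unfolding integer_ring_def maximal_ideal_def
  using mult_left_le_one_le[of "absF y" "absF x"] abs_nonneg[of x] abs_nonneg[of y]
  by (simp add: abs_mult)

lemma maximal_mult_right: "x \<in> maximal_ideal absF \<Longrightarrow> y \<in> integer_ring absF \<Longrightarrow> x * y \<in> maximal_ideal absF"
  using maximal_mult_left[of y x] by (simp add: mult.commute)

lemma maximal_sum: "(\<And>i. i \<in> I \<Longrightarrow> x i \<in> maximal_ideal absF) \<Longrightarrow> (\<Sum>i\<in>I. x i) \<in> maximal_ideal absF"
  unfolding maximal_ideal_def using abs_sum_less[of 1 I x] by simp

lemma maximal_integer: "x \<in> maximal_ideal absF \<Longrightarrow> x \<in> integer_ring absF"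
  by (simp add: maximal_ideal_def integer_ring_def)

lemma red_0 [simp]: "red 0 = 0"
proof -
  have "red 0 = red 0 + red 0" using red_add[of 0 0] by (simp only: integer_0 add_0)
  then show ?thesis by (simp only: add_cancel_right_right)
qed

lemma red_sum:
  "(\<And>i. i \<in> I \<Longrightarrow> x i \<in> integer_ring absF) \<Longrightarrow> red (\<Sum>i\<in>I. x i) = (\<Sum>i\<in>I. red (x i))"
  by (induction I rule: infinite_finite_induct) (simp_all add: red_add integer_sum)

lemma red_eq_iff:
  assumes "x \<in> integer_ring absF" "y \<in> integer_ring absF"
  shows "red x = red y \<longleftrightarrow> absF (x - y) < 1"
proof -
  have "red x = red (x - y) + red y"
    using red_add[OF integer_diff[OF assms] assms(2)] by simp
  then show ?thesis
    using red_kernel[OF integer_diff[OF assms]] by (simp add: maximal_ideal_def)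
qed

text \<open>Residue classes are the open balls of radius \<open>1\<close>, and finitely many of them cover the
  compact ring of integers.\<close>

lemma finite_residue_field: "finite (UNIV :: 'k set)"
proof -
  have "field_metric.mtotally_bounded (integer_ring absF)"
    by (rule field_metric.compactin_imp_mtotally_bounded[OF compactin_integer_ring])
  then have "\<exists>K. finite K \<and> K \<subseteq> integer_ring absF \<and> integer_ring absF \<subseteq> (\<Union>x\<in>K. field_metric.mball x 1)"
    unfolding field_metric.mtotally_bounded_def by (rule allE[of _ 1]) (simp only: less_numeral_extra simp_thms)
  then obtain K where K: "finite K" "K \<subseteq> integer_ring absF"
    "integer_ring absF \<subseteq> (\<Union>x\<in>K. field_metric.mball x 1)" by (elim exE conjE)
  have "y \<in> red ` K" for y
  proof -
    have "y \<in> red ` integer_ring absF" unfolding red_surj by (rule UNIV_I)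
    then obtain x where x: "x \<in> integer_ring absF" "red x = y" by (elim imageE) simp
    from x(1) K(3) have "x \<in> (\<Union>z\<in>K. field_metric.mball z 1)" by (rule subsetD[rotated])
    then obtain z where z: "z \<in> K" "absF (z - x) < 1" unfolding UN_iff mem_ball by (elim bexE)
    have "red z = y" unfolding x(2)[symmetric] red_eq_iff[OF subsetD[OF K(2) z(1)] x(1)] by (rule z(2))
    then show ?thesis using imageI[OF z(1), of red] by simp
  qed
  then have "UNIV \<subseteq> red ` K" by (intro subsetI)
  then show ?thesis by (rule finite_surj[OF K(1)])
qed

subsection \<open>Matrices\<close>

lemma topspace_mat [simp]: "topspace (mat_topology absF n) = carrier_mat n n"
  by (auto simp: mat_topology_def topspace_pullback_topology)

lemma continuous_entry:
  assumes "i < n" "j < n"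
  shows "continuous_map (mat_topology absF n) (field_topology absF) (\<lambda>A. A $$ (i, j))"
proof -
  have "continuous_map (product_topology (\<lambda>_. field_topology absF) ({..<n} \<times> {..<n})) (field_topology absF) (\<lambda>x. x (i, j))"
    by (rule continuous_map_product_projection) (use assms in simp)
  from continuous_map_pullback[OF this]
  have "continuous_map (mat_topology absF n) (field_topology absF)
      ((\<lambda>x. x (i, j)) \<circ> (\<lambda>A. \<lambda>ij\<in>{..<n} \<times> {..<n}. A $$ ij))"
    unfolding mat_topology_def .
  then show ?thesis by (rule continuous_map_eq) (use assms in simp)
qed

lemma continuous_map_into_mat:
  assumes "\<And>x. x \<in> topspace X \<Longrightarrow> h x \<in> carrier_mat n n"
    and "\<And>i j. i < n \<Longrightarrow> j < n \<Longrightarrow> continuous_map X (field_topology absF) (\<lambda>x. h x $$ (i, j))"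
  shows "continuous_map X (mat_topology absF n) h"
  unfolding mat_topology_def
proof (rule continuous_map_pullback')
  show "continuous_map X (product_topology (\<lambda>_. field_topology absF) ({..<n} \<times> {..<n}))
     ((\<lambda>A. \<lambda>ij\<in>{..<n} \<times> {..<n}. A $$ ij) \<circ> h)"
    unfolding continuous_map_componentwise
  proof (intro conjI ballI)
    fix k assume "k \<in> {..<n} \<times> {..<n}"
    then obtain i j where k: "k = (i, j)" "i < n" "j < n" by auto
    show "continuous_map X (field_topology absF) (\<lambda>x. ((\<lambda>A. \<lambda>ij\<in>{..<n} \<times> {..<n}. A $$ ij) \<circ> h) x k)"
      by (rule continuous_map_eq[OF assms(2)[OF k(2,3)]]) (use k in simp)
  qed auto
  show "topspace X \<subseteq> h -` carrier_mat n n" using assms(1) by auto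
qed

lemma continuous_translation:
  assumes g: "g \<in> carrier_mat n n" and h: "h \<in> carrier_mat n n"
  shows "continuous_map (mat_topology absF n) (mat_topology absF n) (\<lambda>A. g * A * h)"
proof (rule continuous_map_into_mat)
  show "g * A * h \<in> carrier_mat n n" if "A \<in> topspace (mat_topology absF n)" for A
    using that g h by simp
  fix i j assume ij: "i < n" "j < n"
  have eq: "(\<Sum>k = 0..<n. g $$ (i, k) * (\<Sum>l = 0..<n. h $$ (l, j) * A $$ (k, l))) = (g * A * h) $$ (i, j)"
    if "A \<in> topspace (mat_topology absF n)" for A
  proof -
    have "(g * A * h) $$ (i, j) = (\<Sum>k = 0..<n. g $$ (i, k) * (\<Sum>l = 0..<n. A $$ (k, l) * h $$ (l, j)))"
      using that g h ij by (simp add: scalar_prod_def)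
    then show ?thesis by (simp only: mult.commute[of "A $$ _"])
  qed
  have "continuous_map (mat_topology absF n) (field_topology absF)
    (\<lambda>A. \<Sum>k = 0..<n. g $$ (i, k) * (\<Sum>l = 0..<n. h $$ (l, j) * A $$ (k, l)))"
    by (intro continuous_sum continuous_scale continuous_entry) auto
  then show "continuous_map (mat_topology absF n) (field_topology absF) (\<lambda>A. (g * A * h) $$ (i, j))"
    by (rule continuous_map_eq) (rule eq)
qed

lemma compactin_integral_matrices: "compactin (mat_topology absF n) (integral_matrices absF n)"
proof -
  let ?I = "{..<n} \<times> {..<n}"
  let ?P = "product_topology (\<lambda>_. field_topology absF) ?I"
  have "continuous_map ?P (mat_topology absF n) (\<lambda>x. mat n n x)"
  proof (rule continuous_map_into_mat)
    fix i j assume ij: "i < n" "j < n"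
    have "continuous_map ?P (field_topology absF) (\<lambda>x. x (i, j))"
      by (rule continuous_map_product_projection) (use ij in simp)
    then show "continuous_map ?P (field_topology absF) (\<lambda>x. mat n n x $$ (i, j))" using ij by simp
  qed simp
  moreover have "compactin ?P (PiE ?I (\<lambda>_. integer_ring absF))"
    unfolding compactin_PiE by (intro disjI2 ballI compactin_integer_ring)
  ultimately have "compactin (mat_topology absF n) ((\<lambda>x. mat n n x) ` PiE ?I (\<lambda>_. integer_ring absF))"
    by (rule image_compactin[rotated])
  moreover have "(\<lambda>x. mat n n x) ` PiE ?I (\<lambda>_. integer_ring absF) = integral_matrices absF n"
  proof (intro equalityI subsetI)
    show "A \<in> (\<lambda>x. mat n n x) ` PiE ?I (\<lambda>_. integer_ring absF)" if "A \<in> integral_matrices absF n" for A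
    proof (rule image_eqI)
      show "A = mat n n (restrict (\<lambda>ij. A $$ ij) ?I)"
        using that by (intro eq_matI) (auto simp: integral_matrices_def)
    qed (use that in \<open>auto simp: integral_matrices_def\<close>)
  next
    fix A assume "A \<in> (\<lambda>x. mat n n x) ` PiE ?I (\<lambda>_. integer_ring absF)"
    then obtain x where x: "A = mat n n x" "x \<in> PiE ?I (\<lambda>_. integer_ring absF)" by (rule imageE)
    have "x (i, j) \<in> integer_ring absF" if "i < n" "j < n" for i j
      by (rule PiE_mem[OF x(2)]) (use that in simp)
    then show "A \<in> integral_matrices absF n" unfolding x(1) integral_matrices_def by simp
  qed
  ultimately show ?thesis by (simp only:)
qed

text \<open>Residue classes of matrices are finite intersections of conditions that place one entry in
  an open ball.\<close>

lemma openin_mat_if_congruence_stable: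
  assumes U: "U \<subseteq> carrier_mat n n"
    and stable: "\<And>A B. A \<in> U \<Longrightarrow> B \<in> carrier_mat n n \<Longrightarrow>
      (\<And>i j. i < n \<Longrightarrow> j < n \<Longrightarrow> absF (A $$ (i, j) - B $$ (i, j)) < 1) \<Longrightarrow> B \<in> U"
  shows "openin (mat_topology absF n) U"
proof (subst openin_subopen, intro ballI)
  fix A assume A: "A \<in> U"
  let ?N = "\<lambda>p. {B \<in> topspace (mat_topology absF n). B $$ p \<in> field_metric.mball (A $$ p) 1}"
  let ?V = "topspace (mat_topology absF n) \<inter> \<Inter> (?N ` ({..<n} \<times> {..<n}))"
  have op: "openin (mat_topology absF n) (?N p)" if mem: "p \<in> {..<n} \<times> {..<n}" for p
  proof -
    obtain i j where p: "p = (i, j)" "i < n" "j < n" using mem by auto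
    show ?thesis
      unfolding p(1)
      by (rule openin_continuous_map_preimage[OF continuous_entry[OF p(2,3)] field_metric.openin_mball])
  qed
  have "openin (mat_topology absF n) ?V"
  proof (rule openin_Int_Inter[OF _ openin_topspace])
    show "finite (?N ` ({..<n} \<times> {..<n}))" by (intro finite_imageI finite_cartesian_product finite_lessThan)
    fix X assume "X \<in> ?N ` ({..<n} \<times> {..<n})"
    then obtain p where p: "X = ?N p" "p \<in> {..<n} \<times> {..<n}" by (rule imageE)
    show "openin (mat_topology absF n) X" unfolding p(1) by (rule op[OF p(2)])
  qed
  moreover have "A \<in> ?V" using A U by auto
  moreover have "?V \<subseteq> U"
  proof
    fix B assume B: "B \<in> ?V"
    show "B \<in> U" by (rule stable[OF A]) (use B in auto)
  qed
  ultimately show "\<exists>T. openin (mat_topology absF n) T \<and> A \<in> T \<and> T \<subseteq> U" by blast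
qed

end

section \<open>The block upper triangular group\<close>

lemma GL_carrier:
  "A \<in> carrier (GL n) \<longleftrightarrow> A \<in> carrier_mat n n \<and> (\<exists>B\<in>carrier_mat n n. B * A = 1\<^sub>m n \<and> A * B = 1\<^sub>m n)"
  by (simp add: GL_def units_of_def Units_def ring_mat_simps)

lemma GL_carrier_mat: "A \<in> carrier (GL n) \<Longrightarrow> A \<in> carrier_mat n n"
  by (simp add: GL_carrier)

lemma GL_mult [simp]: "A \<otimes>\<^bsub>GL n\<^esub> B = A * B"
  by (simp add: GL_def units_of_def ring_mat_simps)

lemma GL_one [simp]: "\<one>\<^bsub>GL n\<^esub> = 1\<^sub>m n"
  by (simp add: GL_def units_of_def ring_mat_simps)

lemma group_GL: "group (GL n :: 'a::field mat monoid)"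
proof -
  interpret ring "ring_mat TYPE('a) n ()" by (rule ring_mat)
  show ?thesis unfolding GL_def by (rule units_group)
qed

lemma order_units_iff:
  "A \<in> order_units n R \<longleftrightarrow> A \<in> R \<and> (\<exists>B\<in>R. B * A = 1\<^sub>m n \<and> A * B = 1\<^sub>m n)"
  by (simp add: order_units_def Units_def ring_mat_simps)

lemma mat_right_inverse_imp_left:
  "A \<in> carrier_mat n n \<Longrightarrow> B \<in> carrier_mat n n \<Longrightarrow> A * B = 1\<^sub>m n \<Longrightarrow> B * A = (1\<^sub>m n :: 'a::field mat)"
  by (rule mat_mult_left_right_inverse)

lemma order_units_subset_GL:
  "R \<subseteq> carrier_mat n n \<Longrightarrow> order_units n R \<subseteq> carrier (GL n)"
  unfolding subset_iff order_units_iff GL_carrier by blast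

lemma subgroup_order_units:
  fixes R :: "'a::field mat set"
  assumes R: "R \<subseteq> carrier_mat n n" "1\<^sub>m n \<in> R" and mult: "\<And>A B. A \<in> R \<Longrightarrow> B \<in> R \<Longrightarrow> A * B \<in> R"
  shows "subgroup (order_units n R) (GL n)"
proof -
  interpret G: group "GL n :: 'a mat monoid" by (rule group_GL)
  let ?J = "order_units n R"
  have sub: "?J \<subseteq> carrier (GL n)" by (rule order_units_subset_GL[OF R(1)])
  show ?thesis
  proof (rule G.subgroupI[OF sub])
    have "1\<^sub>m n \<in> ?J"
      unfolding order_units_iff using R(2) by (intro conjI bexI[of _ "1\<^sub>m n"]) simp_all
    then show "?J \<noteq> {}" by blast
    show "inv\<^bsub>GL n\<^esub> A \<in> ?J" if A: "A \<in> ?J" for A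
    proof -
      obtain B where B: "B \<in> R" "B * A = 1\<^sub>m n" "A * B = 1\<^sub>m n"
        using A unfolding order_units_iff by (elim conjE bexE)
      have "B \<in> ?J" unfolding order_units_iff
        using A B by (intro conjI bexI[of _ A]) (simp_all add: order_units_iff)
      moreover have "inv\<^bsub>GL n\<^esub> A = B"
        by (rule G.inv_equality) (use B(2) A \<open>B \<in> ?J\<close> sub in auto)
      ultimately show ?thesis by simp
    qed
    show "A \<otimes>\<^bsub>GL n\<^esub> B \<in> ?J" if AB: "A \<in> ?J" "B \<in> ?J" for A B
    proof -
      obtain A' where A': "A' \<in> R" "A' * A = 1\<^sub>m n" "A * A' = 1\<^sub>m n" "A \<in> R"
        using AB(1) unfolding order_units_iff by (elim conjE bexE)
      obtain B' where B': "B' \<in> R" "B' * B = 1\<^sub>m n" "B * B' = 1\<^sub>m n" "B \<in> R"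
        using AB(2) unfolding order_units_iff by (elim conjE bexE)
      have c: "A \<in> carrier_mat n n" "A' \<in> carrier_mat n n" "B \<in> carrier_mat n n" "B' \<in> carrier_mat n n"
        using A' B' R(1) by blast+
      have "(A * B) * (B' * A') = A * (B * B') * A'"
        using c by (simp add: assoc_mult_mat[of _ n n _ n _ n])
      then have r: "(A * B) * (B' * A') = 1\<^sub>m n" using A'(3) B'(3) c by simp
      then have "(B' * A') * (A * B) = 1\<^sub>m n"
        using c by (intro mat_right_inverse_imp_left[OF _ _ r]) simp_all
      then show ?thesis
        unfolding GL_mult order_units_iff using r mult A' B' by (intro conjI bexI[of _ "B' * A'"]) simp_all
    qed
  qed
qed

lemma block_sum:
  fixes F :: "nat \<Rightarrow> 'a::comm_monoid_add"
  assumes f: "0 < f" and i: "i < e" and zero: "\<And>m. m < e * f \<Longrightarrow> m div f \<noteq> i \<Longrightarrow> F m = 0"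
  shows "(\<Sum>m = 0..<e * f. F m) = (\<Sum>c = 0..<f. F (i * f + c))"
proof -
  have "i * f + f \<le> e * f"
    using i by (metis Suc_leI add.commute mult_Suc mult_le_mono1)
  then have sub: "{i * f..<i * f + f} \<subseteq> {0..<e * f}" by auto
  have "(\<Sum>m = 0..<e * f. F m) = (\<Sum>m = i * f..<i * f + f. F m)"
  proof (rule sum.mono_neutral_right[OF _ sub])
    show "\<forall>m\<in>{0..<e * f} - {i * f..<i * f + f}. F m = 0"
    proof
      fix m assume m: "m \<in> {0..<e * f} - {i * f..<i * f + f}"
      have "m div f \<noteq> i"
      proof
        assume "m div f = i"
        then have "m = i * f + m mod f" using div_mult_mod_eq[of m f] by simp
        then show False using m mod_less_divisor[OF f, of m] by simp
      qed
      then show "F m = 0" using m by (intro zero) simp_all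
    qed
  qed simp
  also have "\<dots> = (\<Sum>c = 0..<f. F (i * f + c))"
    using sum.shift_bounds_nat_ivl[of F 0 "i * f" f] by (simp add: add.commute)
  finally show ?thesis .
qed

lemma block_index:
  assumes "0 < (f::nat)" "i < e" "a < f"
  shows "i * f + a < e * f" "(i * f + a) div f = i" "(i * f + a) mod f = a"
proof -
  have "i * f + a < i * f + f" using assms(3) by simp
  also have "\<dots> \<le> e * f" using assms(2) by (metis Suc_leI add.commute mult_Suc mult_le_mono1)
  finally show "i * f + a < e * f" .
qed (use assms in simp_all)

lemma block_coordinates:
  assumes "0 < (f::nat)" "r < e * f"
  shows "r div f < e" "r mod f < f" "r = (r div f) * f + r mod f"
  using assms by (simp_all add: less_mult_imp_div_less)

lemma mult_mat_index:
  "A \<in> carrier_mat n n \<Longrightarrow> B \<in> carrier_mat n n \<Longrightarrow> i < n \<Longrightarrow> j < n \<Longrightarrow>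
    (A * B) $$ (i, j) = (\<Sum>m = 0..<n. A $$ (i, m) * B $$ (m, j))"
  by (simp add: scalar_prod_def)

context nonarch_local_field
begin

definition congr_mod_max :: "nat \<Rightarrow> 'F mat \<Rightarrow> 'F mat \<Rightarrow> bool"
  where "congr_mod_max n A B \<longleftrightarrow> (\<forall>i<n. \<forall>j<n. A $$ (i, j) - B $$ (i, j) \<in> maximal_ideal absF)"

text \<open>Look at an entry of \<open>v\<close> of maximal size \<open>M\<close>. It differs from the corresponding entry of \<open>B
  v\<close> by a sum of terms of size less than \<open>M\<close>, so \<open>M > s\<close> would contradict the ultrametric
  inequality.\<close>

lemma congr_one_expands:
  assumes B: "B \<in> carrier_mat n n" and congr_mod_max: "congr_mod_max n B (1\<^sub>m n)" and s: "0 \<le> s"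
    and v: "\<And>i. i < n \<Longrightarrow> absF (\<Sum>m = 0..<n. B $$ (i, m) * v m) \<le> s" and j: "j < n"
  shows "absF (v j) \<le> s"
proof -
  have fin: "finite ((\<lambda>i. absF (v i)) ` {0..<n})" and ne: "(\<lambda>i. absF (v i)) ` {0..<n} \<noteq> {}"
    using j by auto
  define M where "M = Max ((\<lambda>i. absF (v i)) ` {0..<n})"
  have "M \<in> (\<lambda>i. absF (v i)) ` {0..<n}" unfolding M_def by (rule Max_in[OF fin ne])
  then obtain i where i: "i < n" "absF (v i) = M" by auto
  have le: "absF (v m) \<le> M" if "m < n" for m
    unfolding M_def by (rule Max_ge[OF fin]) (use that in simp)
  have "M \<le> s"
  proof (rule ccontr)
    assume "\<not> M \<le> s"
    then have M: "s < M" "0 < M" using s by simp_all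
    let ?d = "\<lambda>m. (B $$ (i, m) - (1\<^sub>m n) $$ (i, m)) * v m"
    have "absF (\<Sum>m = 0..<n. ?d m) < M"
    proof (rule abs_sum_less[OF M(2)])
      fix m assume m: "m \<in> {0..<n}"
      have d1: "absF (B $$ (i, m) - (1\<^sub>m n) $$ (i, m)) < 1"
        using congr_mod_max m i(1) unfolding congr_mod_max_def maximal_ideal_def by simp
      have "absF (?d m) \<le> absF (B $$ (i, m) - (1\<^sub>m n) $$ (i, m)) * M"
        unfolding abs_mult by (rule mult_left_mono) (use le m abs_nonneg in simp_all)
      also have "\<dots> < 1 * M" using d1 M(2) by (rule mult_strict_right_mono)
      finally show "absF (?d m) < M" by simp
    qed
    moreover have "v i = (\<Sum>m = 0..<n. B $$ (i, m) * v m) - (\<Sum>m = 0..<n. ?d m)"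
    proof -
      have "(\<Sum>m = 0..<n. (1\<^sub>m n) $$ (i, m) * v m) = (\<Sum>m = 0..<n. if m = i then v m else 0)"
        by (rule sum.cong) (use i(1) in simp_all)
      also have "\<dots> = v i" using i(1) by simp
      finally show ?thesis by (simp add: left_diff_distrib sum_subtractf)
    qed
    moreover have "absF (\<Sum>m = 0..<n. B $$ (i, m) * v m) < M" using v[OF i(1)] M(1) by linarith
    ultimately have mx: "max (absF (\<Sum>m = 0..<n. B $$ (i, m) * v m)) (absF (\<Sum>m = 0..<n. ?d m)) < M"
      and eq: "v i = (\<Sum>m = 0..<n. B $$ (i, m) * v m) - (\<Sum>m = 0..<n. ?d m)"
      by (simp_all only: max_less_iff_conj)
    have "absF (v i) < M" unfolding eq by (rule order_le_less_trans[OF abs_diff_ultrametric mx])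
    then show False using i(2) by simp
  qed
  then show ?thesis using le[OF j] by linarith
qed

text \<open>The previous estimate with \<open>s = 0\<close> shows that \<open>B\<close> is injective; with \<open>s = 1\<close>, applied to the
  columns of the inverse, it shows that the inverse is integral.\<close>

lemma congr_one_invertible:
  assumes B: "B \<in> carrier_mat n n" and congr_mod_max: "congr_mod_max n B (1\<^sub>m n)"
  obtains Q where "Q \<in> carrier_mat n n" "Q * B = 1\<^sub>m n" "B * Q = 1\<^sub>m n"
    "Q \<in> integral_matrices absF n" "congr_mod_max n Q (1\<^sub>m n)"
proof -
  have "det B \<noteq> 0"
  proof
    assume "det B = 0"
    then have "\<exists>v. v \<in> carrier_vec n \<and> v \<noteq> 0\<^sub>v n \<and> B *\<^sub>v v = 0\<^sub>v n"
      by (simp only: det_0_iff_vec_prod_zero_field[OF B])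
    then obtain v where v: "v \<in> carrier_vec n" "v \<noteq> 0\<^sub>v n" "B *\<^sub>v v = 0\<^sub>v n"
      by (elim exE conjE)
    have z: "(\<Sum>m = 0..<n. B $$ (i, m) * v $ m) = 0" if "i < n" for i
    proof -
      have "(B *\<^sub>v v) $ i = (\<Sum>m = 0..<n. B $$ (i, m) * v $ m)"
        using B v(1) that by (simp add: scalar_prod_def)
      then show ?thesis using v(3) that by simp
    qed
    have "v $ j = 0" if j: "j < n" for j
    proof -
      have "absF (v $ j) \<le> 0"
        by (rule congr_one_expands[OF B congr_mod_max order_refl _ j]) (simp add: z)
      then show ?thesis using abs_nonneg[of "v $ j"] abs_eq_0[of "v $ j"] by simp
    qed
    then have "v = 0\<^sub>v n" using v(1) by (intro eq_vecI) simp_all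
    then show False using v(2) by simp
  qed
  then have "B \<in> Units (ring_mat TYPE('F) n ())" by (rule det_non_zero_imp_unit[OF B])
  then obtain Q where Q: "Q \<in> carrier_mat n n" "Q * B = 1\<^sub>m n" "B * Q = 1\<^sub>m n"
    unfolding Units_def ring_mat_simps by blast
  have BQ: "(\<Sum>m = 0..<n. B $$ (i, m) * Q $$ (m, j)) = (1\<^sub>m n) $$ (i, j)" if "i < n" "j < n" for i j
    using mult_mat_index[OF B Q(1) that] Q(3) by simp
  have int: "Q $$ (i, j) \<in> integer_ring absF" if "i < n" "j < n" for i j
  proof -
    have "absF (Q $$ (i, j)) \<le> 1"
      by (rule congr_one_expands[OF B congr_mod_max zero_le_one _ that(1), of "\<lambda>m. Q $$ (m, j)"])
        (use that in \<open>simp add: BQ\<close>)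
    then show ?thesis by (simp add: integer_ring_def)
  qed
  have "Q $$ (i, j) - (1\<^sub>m n) $$ (i, j) \<in> maximal_ideal absF" if ij: "i < n" "j < n" for i j
  proof -
    have "(\<Sum>m = 0..<n. (B $$ (i, m) - (1\<^sub>m n) $$ (i, m)) * Q $$ (m, j)) \<in> maximal_ideal absF"
    proof (rule maximal_sum, rule maximal_mult_right)
      fix m assume "m \<in> {0..<n}"
      then show "B $$ (i, m) - (1\<^sub>m n) $$ (i, m) \<in> maximal_ideal absF" "Q $$ (m, j) \<in> integer_ring absF"
        using congr_mod_max int ij unfolding congr_mod_max_def by simp_all
    qed
    moreover have "(\<Sum>m = 0..<n. (1\<^sub>m n) $$ (i, m) * Q $$ (m, j)) = Q $$ (i, j)"
    proof -
      have "(\<Sum>m = 0..<n. (1\<^sub>m n) $$ (i, m) * Q $$ (m, j)) = (\<Sum>m = 0..<n. if m = i then Q $$ (m, j) else 0)"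
        by (rule sum.cong) (use ij in simp_all)
      then show ?thesis using ij by simp
    qed
    ultimately have "(1\<^sub>m n) $$ (i, j) - Q $$ (i, j) \<in> maximal_ideal absF"
      by (simp add: left_diff_distrib sum_subtractf BQ[OF ij])
    then show ?thesis unfolding maximal_ideal_def by (simp only: mem_Collect_eq abs_diff_commute[of "Q $$ (i, j)"])
  qed
  then show thesis
    using that[OF Q] Q(1) int by (simp add: congr_mod_max_def integral_matrices_def)
qed

end

locale block_group = nonarch_local_field absF red
  for absF :: "'F::field \<Rightarrow> real" and red :: "'F \<Rightarrow> 'k::field" +
  fixes e f :: nat
  assumes f_pos: "0 < f"
begin

abbreviation "n \<equiv> e * f"
abbreviation "\<AA> \<equiv> hereditary_order absF e f"
abbreviation "J \<equiv> type_group absF e f"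

lemma hereditary_iff:
  "A \<in> \<AA> \<longleftrightarrow> A \<in> carrier_mat n n \<and>
    (\<forall>r<n. \<forall>c<n. A $$ (r, c) \<in> (if r div f \<le> c div f then integer_ring absF else maximal_ideal absF))"
proof (intro iffI conjI allI impI)
  assume A: "A \<in> \<AA>"
  then show "A \<in> carrier_mat n n" by (simp add: hereditary_order_def)
  fix r c assume rc: "r < n" "c < n"
  note R = block_coordinates[OF f_pos rc(1)] and C = block_coordinates[OF f_pos rc(2)]
  have "block f (r div f) (c div f) A $$ (r mod f, c mod f) \<in>
      (if r div f \<le> c div f then integer_ring absF else maximal_ideal absF)"
    using A R(1,2) C(1,2) unfolding hereditary_order_def by blast
  moreover have "block f (r div f) (c div f) A $$ (r mod f, c mod f) = A $$ (r, c)"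
    using R(2) C(2) by (simp add: block_def)
  ultimately show "A $$ (r, c) \<in> (if r div f \<le> c div f then integer_ring absF else maximal_ideal absF)"
    by simp
next
  assume A: "A \<in> carrier_mat n n \<and>
    (\<forall>r<n. \<forall>c<n. A $$ (r, c) \<in> (if r div f \<le> c div f then integer_ring absF else maximal_ideal absF))"
  show "A \<in> \<AA>"
    unfolding hereditary_order_def
  proof (intro CollectI conjI allI impI)
    show "A \<in> carrier_mat n n" using A by blast
    fix i j a b assume *: "i < e" "j < e" "a < f" "b < f"
    note I = block_index[OF f_pos *(1,3)] and K = block_index[OF f_pos *(2,4)]
    have "A $$ (i * f + a, j * f + b) \<in>
        (if (i * f + a) div f \<le> (j * f + b) div f then integer_ring absF else maximal_ideal absF)"
      using A I(1) K(1) by blast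
    then have "A $$ (i * f + a, j * f + b) \<in> (if i \<le> j then integer_ring absF else maximal_ideal absF)"
      by (simp only: I(2) K(2))
    then show "block f i j A $$ (a, b) \<in> (if i \<le> j then integer_ring absF else maximal_ideal absF)"
      using * by (simp add: block_def)
  qed
qed

lemma hereditary_carrier: "A \<in> \<AA> \<Longrightarrow> A \<in> carrier_mat n n"
  by (simp add: hereditary_iff)

lemma hereditary_entry:
  "A \<in> \<AA> \<Longrightarrow> r < n \<Longrightarrow> c < n \<Longrightarrow>
    A $$ (r, c) \<in> (if r div f \<le> c div f then integer_ring absF else maximal_ideal absF)"
  unfolding hereditary_iff by (elim conjE allE impE)

lemma hereditary_integer: "A \<in> \<AA> \<Longrightarrow> r < n \<Longrightarrow> c < n \<Longrightarrow> A $$ (r, c) \<in> integer_ring absF"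
  using hereditary_entry[of A r c] maximal_integer[of "A $$ (r, c)"]
  by (cases "r div f \<le> c div f") simp_all

lemma hereditary_maximal: "A \<in> \<AA> \<Longrightarrow> r < n \<Longrightarrow> c < n \<Longrightarrow> c div f < r div f \<Longrightarrow> A $$ (r, c) \<in> maximal_ideal absF"
  using hereditary_entry[of A r c] by simp

lemma hereditaryI:
  assumes "A \<in> carrier_mat n n" "\<And>r c. r < n \<Longrightarrow> c < n \<Longrightarrow> A $$ (r, c) \<in> integer_ring absF"
    and "\<And>r c. r < n \<Longrightarrow> c < n \<Longrightarrow> c div f < r div f \<Longrightarrow> A $$ (r, c) \<in> maximal_ideal absF"
  shows "A \<in> \<AA>"
  unfolding hereditary_iff by (intro conjI allI impI assms(1)) (simp add: assms(2,3))

lemma one_hereditary: "1\<^sub>m n \<in> \<AA>"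
  by (rule hereditaryI) (auto simp: maximal_ideal_def)

lemma mult_hereditary:
  assumes A: "A \<in> \<AA>" and B: "B \<in> \<AA>"
  shows "A * B \<in> \<AA>"
proof (rule hereditaryI)
  note c = hereditary_carrier[OF A] hereditary_carrier[OF B]
  show "A * B \<in> carrier_mat n n" by (rule mult_carrier_mat[OF c])
  fix r s assume rs: "r < n" "s < n"
  show "(A * B) $$ (r, s) \<in> integer_ring absF"
    unfolding mult_mat_index[OF c rs]
    by (intro integer_sum integer_mult hereditary_integer[OF A] hereditary_integer[OF B]) (use rs in simp_all)
  assume lt: "s div f < r div f"
  show "(A * B) $$ (r, s) \<in> maximal_ideal absF"
    unfolding mult_mat_index[OF c rs]
  proof (rule maximal_sum)
    fix m assume "m \<in> {0..<n}"
    then have m: "m < n" by simp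
    show "A $$ (r, m) * B $$ (m, s) \<in> maximal_ideal absF"
    proof (cases "m div f < r div f")
      case True
      then show ?thesis
        by (intro maximal_mult_right hereditary_maximal[OF A] hereditary_integer[OF B] rs m)
    next
      case False
      then have "s div f < m div f" using lt by simp
      then show ?thesis
        by (intro maximal_mult_left hereditary_integer[OF A] hereditary_maximal[OF B] rs m)
    qed
  qed
qed

lemma hereditary_congr:
  assumes A: "A \<in> \<AA>" and B: "B \<in> carrier_mat n n" and congr_mod_max: "congr_mod_max n B A"
  shows "B \<in> \<AA>"
proof (rule hereditaryI[OF B])
  fix r c assume rc: "r < n" "c < n"
  have d: "B $$ (r, c) - A $$ (r, c) \<in> maximal_ideal absF" using congr_mod_max rc unfolding congr_mod_max_def by blast
  have eq: "B $$ (r, c) = (B $$ (r, c) - A $$ (r, c)) + A $$ (r, c)" by simp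
  show "B $$ (r, c) \<in> integer_ring absF"
    by (subst eq) (rule integer_add[OF maximal_integer[OF d] hereditary_integer[OF A rc]])
  assume "c div f < r div f"
  then have "A $$ (r, c) \<in> maximal_ideal absF" by (rule hereditary_maximal[OF A rc])
  with d abs_ultrametric[of "B $$ (r, c) - A $$ (r, c)" "A $$ (r, c)"]
  show "B $$ (r, c) \<in> maximal_ideal absF" by (simp add: maximal_ideal_def)
qed

lemma type_group_iff: "A \<in> J \<longleftrightarrow> A \<in> \<AA> \<and> (\<exists>B\<in>\<AA>. B * A = 1\<^sub>m n \<and> A * B = 1\<^sub>m n)"
  unfolding type_group_def by (rule order_units_iff)

lemma hereditary_subset: "\<AA> \<subseteq> carrier_mat n n"
  by (rule subsetI) (rule hereditary_carrier)

lemma type_group_carrier: "A \<in> J \<Longrightarrow> A \<in> carrier_mat n n"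
  unfolding type_group_iff by (elim conjE) (rule hereditary_carrier)

lemma type_group_subset: "J \<subseteq> carrier (GL n)"
  unfolding type_group_def by (rule order_units_subset_GL[OF hereditary_subset])

lemma type_group_subgroup: "subgroup J (GL n)"
  unfolding type_group_def
  by (rule subgroup_order_units[OF hereditary_subset one_hereditary mult_hereditary])

text \<open>A matrix congruent to \<open>1\<close> is invertible in the order, so \<open>A\<close> has a right inverse in the
  order.\<close>

lemma type_groupI:
  assumes A: "A \<in> \<AA>" and B: "B \<in> \<AA>" and congr_mod_max: "congr_mod_max n (A * B) (1\<^sub>m n)"
  shows "A \<in> J"
proof -
  note cA = hereditary_carrier[OF A] and cB = hereditary_carrier[OF B]
  obtain Q where Q: "Q \<in> carrier_mat n n" "Q * (A * B) = 1\<^sub>m n" "(A * B) * Q = 1\<^sub>m n" "congr_mod_max n Q (1\<^sub>m n)"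
    using congr_one_invertible[OF mult_carrier_mat[OF cA cB] congr_mod_max] by metis
  have QA: "Q \<in> \<AA>" by (rule hereditary_congr[OF one_hereditary Q(1,4)])
  have BQ: "B * Q \<in> \<AA>" by (rule mult_hereditary[OF B QA])
  have r: "A * (B * Q) = 1\<^sub>m n" using Q(3) assoc_mult_mat[OF cA cB Q(1)] by simp
  have "(B * Q) * A = 1\<^sub>m n" by (rule mat_right_inverse_imp_left[OF cA hereditary_carrier[OF BQ] r])
  then show ?thesis unfolding type_group_iff using A BQ r by (intro conjI bexI[of _ "B * Q"])
qed

text \<open>If \<open>A'\<close> is the inverse of \<open>A\<close>, then \<open>B A'\<close> is congruent to \<open>A A' = 1\<close>.\<close>

lemma type_group_congr:
  assumes A: "A \<in> J" and B: "B \<in> carrier_mat n n" and congr_mod_max: "congr_mod_max n B A"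
  shows "B \<in> J"
proof -
  obtain A' where A': "A \<in> \<AA>" "A' \<in> \<AA>" "A * A' = 1\<^sub>m n"
    using A unfolding type_group_iff by (elim conjE bexE)
  have BA: "B \<in> \<AA>" by (rule hereditary_congr[OF A'(1) B congr_mod_max])
  note c = hereditary_carrier[OF A'(1)] hereditary_carrier[OF A'(2)]
  have "congr_mod_max n (B * A') (1\<^sub>m n)"
    unfolding congr_mod_max_def
  proof (intro allI impI)
    fix i j assume ij: "i < n" "j < n"
    have "(B * A') $$ (i, j) - (A * A') $$ (i, j)
        = (\<Sum>m = 0..<n. (B $$ (i, m) - A $$ (i, m)) * A' $$ (m, j))"
      unfolding mult_mat_index[OF B c(2) ij] mult_mat_index[OF c ij]
      by (simp add: left_diff_distrib sum_subtractf)
    also have "\<dots> \<in> maximal_ideal absF"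
      by (intro maximal_sum maximal_mult_right hereditary_integer[OF A'(2)])
        (use congr_mod_max ij in \<open>simp_all add: congr_mod_max_def\<close>)
    finally show "(B * A') $$ (i, j) - (1\<^sub>m n) $$ (i, j) \<in> maximal_ideal absF" unfolding A'(3) .
  qed
  then show ?thesis by (rule type_groupI[OF BA A'(2)])
qed

lemma congr_mod_max_commute: "congr_mod_max m A B \<longleftrightarrow> congr_mod_max m B A"
  unfolding congr_mod_max_def maximal_ideal_def by (simp only: mem_Collect_eq abs_diff_commute[of "A $$ _"])

lemma openin_type_group: "openin (GL_topology absF n) J"
proof -
  have "openin (mat_topology absF n) J"
  proof (rule openin_mat_if_congruence_stable)
    show "J \<subseteq> carrier_mat n n" by (rule subsetI) (rule type_group_carrier)
    fix A B assume AB: "A \<in> J" "B \<in> carrier_mat n n"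
      and "\<And>i j. i < n \<Longrightarrow> j < n \<Longrightarrow> absF (A $$ (i, j) - B $$ (i, j)) < 1"
    then have "congr_mod_max n A B" by (simp add: congr_mod_max_def maximal_ideal_def)
    then have "congr_mod_max n B A" by (rule congr_mod_max_commute[THEN iffD1])
    then show "B \<in> J" by (rule type_group_congr[OF AB])
  qed
  then have "openin (GL_topology absF n) (carrier (GL n) \<inter> J)"
    unfolding GL_topology_def by (rule openin_subtopology_Int2)
  then show ?thesis using type_group_subset by (simp add: Int_absorb1)
qed

text \<open>The group and its complement are unions of residue classes, so the group is closed in the
  compact set of integral matrices.\<close>

lemma compactin_type_group: "compactin (GL_topology absF n) J"
  unfolding GL_topology_def compactin_subtopology
proof (intro conjI type_group_subset)
  show "compactin (mat_topology absF n) J"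
  proof (rule closed_compactin[OF compactin_integral_matrices])
    show "J \<subseteq> integral_matrices absF n"
    proof
      fix A assume "A \<in> J"
      then have "A \<in> \<AA>" by (simp add: type_group_iff)
      then show "A \<in> integral_matrices absF n"
        unfolding integral_matrices_def using hereditary_carrier[of A] hereditary_integer[of A] by simp
    qed
    show "closedin (mat_topology absF n) J"
      unfolding closedin_def topspace_mat
    proof
      show J: "J \<subseteq> carrier_mat n n" by (rule subsetI) (rule type_group_carrier)
      show "openin (mat_topology absF n) (carrier_mat n n - J)"
      proof (rule openin_mat_if_congruence_stable)
        fix A B assume A: "A \<in> carrier_mat n n - J" and B: "B \<in> carrier_mat n n"
          and "\<And>i j. i < n \<Longrightarrow> j < n \<Longrightarrow> absF (A $$ (i, j) - B $$ (i, j)) < 1"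
        then have "congr_mod_max n A B" by (simp add: congr_mod_max_def maximal_ideal_def)
        then have "A \<in> J" if "B \<in> J" using type_group_congr[OF that, of A] A by simp
        then show "B \<in> carrier_mat n n - J" using A B by (intro DiffI notI) (simp_all only: Diff_iff simp_thms)
      qed simp
    qed
  qed
qed

end

section \<open>The representation of the block upper triangular group\<close>

lemma finite_carrier_mat:
  assumes "finite (UNIV :: 'k set)"
  shows "finite (carrier_mat n m :: 'k mat set)"
proof (rule finite_subset)
  show "carrier_mat n m \<subseteq> (\<lambda>x. mat n m x) ` (PiE ({..<n} \<times> {..<m}) (\<lambda>_. UNIV) :: (nat \<times> nat \<Rightarrow> 'k) set)"
  proof
    fix A :: "'k mat" assume A: "A \<in> carrier_mat n m"
    have "A = mat n m (restrict (\<lambda>ij. A $$ ij) ({..<n} \<times> {..<m}))"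
      by (rule eq_matI) (use A in simp_all)
    moreover have "restrict (\<lambda>ij. A $$ ij) ({..<n} \<times> {..<m}) \<in> PiE ({..<n} \<times> {..<m}) (\<lambda>_. UNIV)"
      by simp
    ultimately show "A \<in> (\<lambda>x. mat n m x) ` PiE ({..<n} \<times> {..<m}) (\<lambda>_. UNIV)"
      by (rule image_eqI)
  qed
  show "finite ((\<lambda>x. mat n m x) ` (PiE ({..<n} \<times> {..<m}) (\<lambda>_. UNIV) :: (nat \<times> nat \<Rightarrow> 'k) set))"
    by (intro finite_imageI finite_PiE finite_cartesian_product finite_lessThan assms)
qed

context block_group
begin

abbreviation diag_red :: "nat \<Rightarrow> 'F mat \<Rightarrow> 'k mat"
  where "diag_red i A \<equiv> map_mat red (block f i i A)"

lemma diag_red_carrier [simp]: "diag_red i A \<in> carrier_mat f f"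
  by (simp add: block_def)

lemma diag_red_index: "a < f \<Longrightarrow> b < f \<Longrightarrow> diag_red i A $$ (a, b) = red (A $$ (i * f + a, i * f + b))"
  by (simp add: block_def)

lemma red_maximal: "x \<in> maximal_ideal absF \<Longrightarrow> red x = 0"
  using red_kernel[of x] maximal_integer[of x] by simp

text \<open>Modulo the maximal ideal the order consists of block upper triangular matrices, so only one
  block contributes to each diagonal block of a product.\<close>

lemma diag_red_mult:
  assumes A: "A \<in> \<AA>" and B: "B \<in> \<AA>" and i: "i < e"
  shows "diag_red i (A * B) = diag_red i A * diag_red i B"
proof (rule eq_matI)
  fix a b assume "a < dim_row (diag_red i A * diag_red i B)" "b < dim_col (diag_red i A * diag_red i B)"
  then have ab: "a < f" "b < f" by (simp_all add: block_def)
  note r = block_index[OF f_pos i ab(1)] and c = block_index[OF f_pos i ab(2)]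
  note cA = hereditary_carrier[OF A] and cB = hereditary_carrier[OF B]
  have "diag_red i (A * B) $$ (a, b) = red (\<Sum>m = 0..<n. A $$ (i * f + a, m) * B $$ (m, i * f + b))"
    unfolding diag_red_index[OF ab] mult_mat_index[OF cA cB r(1) c(1)] ..
  also have "\<dots> = (\<Sum>m = 0..<n. red (A $$ (i * f + a, m) * B $$ (m, i * f + b)))"
    by (rule red_sum, rule integer_mult)
      (simp_all add: hereditary_integer[OF A r(1)] hereditary_integer[OF B _ c(1)])
  also have "\<dots> = (\<Sum>k = 0..<f. red (A $$ (i * f + a, i * f + k) * B $$ (i * f + k, i * f + b)))"
  proof (rule block_sum[OF f_pos i])
    fix m assume m: "m < n" "m div f \<noteq> i"
    have "A $$ (i * f + a, m) * B $$ (m, i * f + b) \<in> maximal_ideal absF"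
    proof (cases "m div f < i")
      case True
      then show ?thesis
        by (intro maximal_mult_right hereditary_maximal[OF A r(1) m(1)] hereditary_integer[OF B m(1) c(1)])
          (simp only: r(2))
    next
      case False
      then have "i < m div f" using m(2) by simp
      then show ?thesis
        by (intro maximal_mult_left hereditary_integer[OF A r(1) m(1)] hereditary_maximal[OF B m(1) c(1)])
          (simp only: c(2))
    qed
    then show "red (A $$ (i * f + a, m) * B $$ (m, i * f + b)) = 0" by (rule red_maximal)
  qed
  also have "\<dots> = (\<Sum>k = 0..<f. diag_red i A $$ (a, k) * diag_red i B $$ (k, b))"
  proof (rule sum.cong[OF refl])
    fix k assume "k \<in> {0..<f}"
    then have k: "k < f" by simp
    note k' = block_index(1)[OF f_pos i k]
    show "red (A $$ (i * f + a, i * f + k) * B $$ (i * f + k, i * f + b))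
        = diag_red i A $$ (a, k) * diag_red i B $$ (k, b)"
      unfolding diag_red_index[OF ab(1) k] diag_red_index[OF k ab(2)]
      by (rule red_mult[OF hereditary_integer[OF A r(1) k'] hereditary_integer[OF B k' c(1)]])
  qed
  also have "\<dots> = (diag_red i A * diag_red i B) $$ (a, b)"
    by (rule mult_mat_index[OF diag_red_carrier diag_red_carrier ab, symmetric])
  finally show "diag_red i (A * B) $$ (a, b) = (diag_red i A * diag_red i B) $$ (a, b)" .
qed (simp_all add: block_def)

lemma diag_red_one:
  assumes i: "i < e"
  shows "diag_red i (1\<^sub>m n) = 1\<^sub>m f"
proof (rule eq_matI)
  fix a b assume "a < dim_row (1\<^sub>m f :: 'k mat)" "b < dim_col (1\<^sub>m f :: 'k mat)"
  then have ab: "a < f" "b < f" by simp_all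
  show "diag_red i (1\<^sub>m n) $$ (a, b) = (1\<^sub>m f :: 'k mat) $$ (a, b)"
    unfolding diag_red_index[OF ab]
    using block_index(1)[OF f_pos i ab(1)] block_index(1)[OF f_pos i ab(2)] ab red_one by simp
qed (simp_all add: block_def)

lemma diag_red_GL:
  assumes A: "A \<in> J" and i: "i < e"
  shows "diag_red i A \<in> carrier (GL f)"
proof -
  obtain B where B: "A \<in> \<AA>" "B \<in> \<AA>" "B * A = 1\<^sub>m n" "A * B = 1\<^sub>m n"
    using A unfolding type_group_iff by (elim conjE bexE)
  have "diag_red i B * diag_red i A = 1\<^sub>m f" "diag_red i A * diag_red i B = 1\<^sub>m f"
    using diag_red_mult[OF B(2,1) i] diag_red_mult[OF B(1,2) i] diag_red_one[OF i] B(3,4) by simp_all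
  then show ?thesis
    unfolding GL_carrier by (intro conjI bexI[of _ "diag_red i B"] diag_red_carrier)
qed

definition lift :: "'k \<Rightarrow> 'F"
  where "lift y = (SOME x. x \<in> integer_ring absF \<and> red x = y)"

lemma lift: "lift y \<in> integer_ring absF" "red (lift y) = y"
proof -
  have "y \<in> red ` integer_ring absF" unfolding red_surj by (rule UNIV_I)
  then have "\<exists>x. x \<in> integer_ring absF \<and> red x = y"
    by (elim imageE) (intro exI conjI, assumption, rule sym)
  then have "lift y \<in> integer_ring absF \<and> red (lift y) = y" unfolding lift_def by (rule someI_ex)
  then show "lift y \<in> integer_ring absF" "red (lift y) = y" by simp_all
qed

definition lift_diag :: "(nat \<Rightarrow> 'k mat) \<Rightarrow> 'F mat"
  where "lift_diag g = mat n n (\<lambda>(r, c). if r div f = c div f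
    then lift (g (r div f) $$ (r mod f, c mod f)) else 0)"

lemma lift_diag_entry:
  assumes "r < n" "c < n"
  shows "lift_diag g $$ (r, c) \<in> integer_ring absF"
    and "red (lift_diag g $$ (r, c)) = (if r div f = c div f then g (r div f) $$ (r mod f, c mod f) else 0)"
    and "r div f \<noteq> c div f \<Longrightarrow> lift_diag g $$ (r, c) = 0"
  using assms by (simp_all add: lift_diag_def lift)

lemma lift_diag_hereditary: "lift_diag g \<in> \<AA>"
proof (rule hereditaryI)
  show "lift_diag g \<in> carrier_mat n n" by (simp add: lift_diag_def)
  fix r c assume rc: "r < n" "c < n"
  show "lift_diag g $$ (r, c) \<in> integer_ring absF" by (rule lift_diag_entry(1)[OF rc])
  assume "c div f < r div f"
  then show "lift_diag g $$ (r, c) \<in> maximal_ideal absF"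
    using lift_diag_entry(3)[OF rc] by (simp add: maximal_ideal_def)
qed

lemma diag_red_lift:
  assumes i: "i < e" and g: "g i \<in> carrier_mat f f"
  shows "diag_red i (lift_diag g) = g i"
proof (rule eq_matI)
  fix a b assume "a < dim_row (g i)" "b < dim_col (g i)"
  then have ab: "a < f" "b < f" using g by simp_all
  note r = block_index[OF f_pos i ab(1)] and c = block_index[OF f_pos i ab(2)]
  show "diag_red i (lift_diag g) $$ (a, b) = g i $$ (a, b)"
    unfolding diag_red_index[OF ab] lift_diag_entry(2)[OF r(1) c(1)] r(2,3) c(2,3) by simp
qed (use g in \<open>simp_all add: block_def\<close>)

text \<open>The product of entrywise lifts of the block diagonal matrices \<open>g\<close> and \<open>g\<^sup>-\<^sup>1\<close> is congruent
  to \<open>1\<close>.\<close>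

lemma exists_lift:
  assumes g: "\<And>i. i < e \<Longrightarrow> g i \<in> carrier (GL f)"
  obtains A where "A \<in> J" "\<And>i. i < e \<Longrightarrow> diag_red i A = g i"
proof -
  define h where "h i = inv\<^bsub>GL f\<^esub> (g i)" for i
  interpret G: group "GL f :: 'k mat monoid" by (rule group_GL)
  have h: "h i \<in> carrier (GL f)" "g i * h i = 1\<^sub>m f" if "i < e" for i
    using g[OF that] G.r_inv[OF g[OF that]] by (simp_all add: h_def)
  let ?A = "lift_diag g" and ?B = "lift_diag h"
  note A = lift_diag_hereditary[of g] and B = lift_diag_hereditary[of h]
  note cA = hereditary_carrier[OF A] and cB = hereditary_carrier[OF B]
  have gc: "g i \<in> carrier_mat f f" "h i \<in> carrier_mat f f" if "i < e" for i
    using GL_carrier_mat[OF g[OF that]] GL_carrier_mat[OF h(1)[OF that]] by simp_all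
  have "congr_mod_max n (?A * ?B) (1\<^sub>m n)"
    unfolding congr_mod_max_def
  proof (intro allI impI)
    fix r c assume rc: "r < n" "c < n"
    note R = block_coordinates[OF f_pos rc(1)] and C = block_coordinates[OF f_pos rc(2)]
    show "(?A * ?B) $$ (r, c) - (1\<^sub>m n) $$ (r, c) \<in> maximal_ideal absF"
    proof (cases "r div f = c div f")
      case True
      let ?i = "r div f"
      have "diag_red ?i (?A * ?B) = 1\<^sub>m f"
        using diag_red_mult[OF A B R(1)] diag_red_lift[of _ g, OF R(1) gc(1)[OF R(1)]]
          diag_red_lift[of _ h, OF R(1) gc(2)[OF R(1)]] h(2)[OF R(1)] by simp
      then have "red ((?A * ?B) $$ (?i * f + r mod f, ?i * f + c mod f)) = (1\<^sub>m f) $$ (r mod f, c mod f)"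
        using diag_red_index[OF R(2) C(2), of ?i "?A * ?B"] by simp
      moreover have "?i * f + c mod f = c" using C(3) True by simp
      moreover have "?i * f + r mod f = r" by simp
      ultimately have "red ((?A * ?B) $$ (r, c)) = (1\<^sub>m f) $$ (r mod f, c mod f)" by (simp only:)
      also have "\<dots> = red ((1\<^sub>m n) $$ (r, c))"
      proof -
        have "(r mod f = c mod f) = (r = c)" using True R(3) C(3) by metis
        then show ?thesis using R(2) C(2) rc red_one by simp
      qed
      finally show ?thesis
        using red_eq_iff[of "(?A * ?B) $$ (r, c)" "(1\<^sub>m n) $$ (r, c)"] rc
          hereditary_integer[OF mult_hereditary[OF A B] rc] hereditary_integer[OF one_hereditary rc]
        by (simp add: maximal_ideal_def)
    next
      case False
      have "(?A * ?B) $$ (r, c) = 0"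
        unfolding mult_mat_index[OF cA cB rc]
      proof (rule sum.neutral, rule ballI)
        fix m assume "m \<in> {0..<n}"
        then have m: "m < n" by simp
        show "?A $$ (r, m) * ?B $$ (m, c) = 0"
          using lift_diag_entry(3)[OF rc(1) m] lift_diag_entry(3)[OF m rc(2)] False
          by (cases "r div f = m div f") simp_all
      qed
      moreover have "r \<noteq> c" using False by blast
      ultimately show ?thesis using rc by (simp add: maximal_ideal_def)
    qed
  qed
  then have "?A \<in> J" by (rule type_groupI[OF A B])
  then show thesis by (rule that) (rule diag_red_lift[OF _ gc(1)])
qed

end

locale block_type = block_group absF red e f
  for absF :: "'F::field \<Rightarrow> real" and red :: "'F \<Rightarrow> 'k::field" and e f :: nat +
  fixes X0 :: "'x::complex_vector set" and lambar0 :: "'k mat \<Rightarrow> 'x \<Rightarrow> 'x"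
  assumes irr: "irreducible_rep (GL f) X0 lambar0"
begin

abbreviation "W \<equiv> tensor_power e X0"
abbreviation "lam \<equiv> type_rep red e f X0 lambar0"

lemma csubspace_X0: "csubspace X0"
  using irr by (simp add: irreducible_rep_def group_rep_def)

lemma lambar0_endo: "g \<in> carrier (GL f) \<Longrightarrow> lambar0 g \<in> endomorphisms X0"
  using irr by (simp add: irreducible_rep_def group_rep_def)

lemma lambar0_mult: "g \<in> carrier (GL f) \<Longrightarrow> h \<in> carrier (GL f) \<Longrightarrow> lambar0 (g * h) = lambar0 g \<circ> lambar0 h"
  using irr by (simp add: irreducible_rep_def group_rep_def)

lemma lambar0_one: "x \<in> X0 \<Longrightarrow> lambar0 (1\<^sub>m f) x = x"
  using irr by (simp add: irreducible_rep_def group_rep_def)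

lemma finite_GL_residue: "finite (carrier (GL f :: 'k mat monoid))"
  by (rule finite_subset[OF _ finite_carrier_mat[OF finite_residue_field, of f f]])
    (rule subsetI, rule GL_carrier_mat)

lemma X0_finite_dimensional:
  obtains B where "finite B" "cspan B = X0"
  by (rule irreducible_finite_group_finite_dimensional[OF finite_GL_residue group_GL irr])

lemma W_finite_dimensional:
  obtains C where "finite C" "cspan C = W"
proof -
  obtain B where "finite B" "cspan B = X0" by (rule X0_finite_dimensional)
  then show thesis using tensor_power_finite_dimensional[of B e] that by metis
qed

lemma lam_endo: "j \<in> J \<Longrightarrow> lam j \<in> endomorphisms W"
  unfolding type_rep_def
  by (rule tensor_map_endomorphism[OF csubspace_X0]) (rule lambar0_endo, rule diag_red_GL)

lemma lam_mult:
  assumes "j \<in> J" "k \<in> J"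
  shows "lam (j * k) = lam j \<circ> lam k"
proof -
  have A: "j \<in> \<AA>" "k \<in> \<AA>" using assms by (simp_all add: type_group_iff)
  have "lam j \<circ> lam k = tensor_map e X0 (\<lambda>i. lambar0 (diag_red i j) \<circ> lambar0 (diag_red i k))"
    unfolding type_rep_def
    by (rule tensor_map_comp[OF csubspace_X0]) (rule lambar0_endo, rule diag_red_GL, use assms in simp_all)+
  also have "\<dots> = lam (j * k)"
    unfolding type_rep_def
    by (rule tensor_map_cong) (simp only: diag_red_mult[OF A] lambar0_mult[OF diag_red_GL[OF assms(1)] diag_red_GL[OF assms(2)]])
  finally show ?thesis by simp
qed

lemma lam_one: "t \<in> W \<Longrightarrow> lam (1\<^sub>m n) t = t"
  unfolding type_rep_def
proof (rule tensor_map_identity[OF csubspace_X0])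
  fix i assume i: "i < e"
  show "lambar0 (diag_red i (1\<^sub>m n)) x = x" if "x \<in> X0" for x
    unfolding diag_red_one[OF i] by (rule lambar0_one[OF that])
  show "lambar0 (diag_red i (1\<^sub>m n)) \<in> endomorphisms X0"
    unfolding diag_red_one[OF i]
    using lambar0_endo group.is_monoid[OF group_GL[of f]] monoid.one_closed[of "GL f"] by (metis GL_one)
qed

lemma finite_lam: "finite (lam ` J)"
proof (rule finite_subset)
  let ?P = "PiE {..<e} (\<lambda>_. carrier (GL f :: 'k mat monoid))"
  show "lam ` J \<subseteq> (\<lambda>g. tensor_map e X0 (\<lambda>i. lambar0 (g i))) ` ?P"
  proof (rule image_subsetI)
    fix j assume j: "j \<in> J"
    show "lam j \<in> (\<lambda>g. tensor_map e X0 (\<lambda>i. lambar0 (g i))) ` ?P"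
    proof (rule image_eqI)
      show "lam j = tensor_map e X0 (\<lambda>i. lambar0 (restrict (\<lambda>i. diag_red i j) {..<e} i))"
        unfolding type_rep_def by (rule tensor_map_cong) simp
      show "restrict (\<lambda>i. diag_red i j) {..<e} \<in> ?P"
        by (rule restrict_PiE_iff[THEN iffD2]) (use diag_red_GL[OF j] in simp)
    qed
  qed
  show "finite ((\<lambda>g. tensor_map e X0 (\<lambda>i. lambar0 (g i))) ` ?P)"
    by (intro finite_imageI finite_PiE finite_lessThan finite_GL_residue)
qed

text \<open>The group realizes all tuples in \<open>GL\<^sub>f(k)\<close> on the diagonal, so this is Schur's lemma for the
  external tensor power.\<close>

lemma lam_dual_commutant:
  assumes T: "T \<in> endomorphisms (dual_space W)"
    and comm: "\<And>j \<zeta>. j \<in> J \<Longrightarrow> \<zeta> \<in> dual_space W \<Longrightarrow> T (\<zeta> \<circ> lam j) = T \<zeta> \<circ> lam j"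
  shows "\<exists>c. \<forall>\<zeta>\<in>dual_space W. T \<zeta> = c *\<^sub>C \<zeta>"
proof -
  obtain B where B: "finite B" "cspan B = X0" by (rule X0_finite_dimensional)
  show ?thesis
  proof (rule Schur_tensor_power[OF group_GL B irr T])
    show ?thesis if "\<And>\<zeta>. \<zeta> \<in> dual_space W \<Longrightarrow> T \<zeta> = c *\<^sub>C \<zeta>" for c
      using that by (intro exI ballI)
    fix g :: "nat \<Rightarrow> 'k mat" and \<zeta>
    assume g: "\<And>i. i < e \<Longrightarrow> g i \<in> carrier (GL f)" and \<zeta>: "\<zeta> \<in> dual_space W"
    have "\<exists>j\<in>J. \<forall>i<e. diag_red i j = g i"
    proof (rule exists_lift[of g])
      show "g i \<in> carrier (GL f)" if "i < e" for i by (rule g[OF that])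
      fix A assume "A \<in> J" "\<And>i. i < e \<Longrightarrow> diag_red i A = g i"
      then show ?thesis by (intro bexI[of _ A] allI impI)
    qed
    then obtain j where j: "j \<in> J" "\<And>i. i < e \<Longrightarrow> diag_red i j = g i" by blast
    have "lam j = tensor_map e X0 (\<lambda>i. lambar0 (g i))"
      unfolding type_rep_def by (rule tensor_map_cong) (simp only: j(2))
    then show "T (\<zeta> \<circ> tensor_map e X0 (\<lambda>i. lambar0 (g i))) = T \<zeta> \<circ> tensor_map e X0 (\<lambda>i. lambar0 (g i))"
      using comm[OF j(1) \<zeta>] by simp
  qed
qed

end

section \<open>Cosets of a compact open subgroup\<close>

lemma comp_add_left:
  assumes T: "T \<in> linear_maps V V'" and A: "A \<in> linear_maps U V" and B: "B \<in> linear_maps U V" and V: "csubspace V"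
  shows "T \<circ> (A + B) = (T \<circ> A) + (T \<circ> B)"
proof
  fix x show "(T \<circ> (A + B)) x = ((T \<circ> A) + (T \<circ> B)) x"
  proof (cases "x \<in> U")
    case True
    then show ?thesis by (simp add: linear_maps_add[OF T linear_maps_in[OF A True] linear_maps_in[OF B True]])
  next
    case False
    then show ?thesis by (simp add: linear_maps_outside[OF A] linear_maps_outside[OF B] linear_maps_0[OF T V])
  qed
qed

lemma comp_scale_left:
  assumes T: "T \<in> linear_maps V V'" and A: "A \<in> linear_maps U V" and V: "csubspace V"
  shows "T \<circ> (c *\<^sub>C A) = c *\<^sub>C (T \<circ> A)"
proof
  fix x show "(T \<circ> (c *\<^sub>C A)) x = (c *\<^sub>C (T \<circ> A)) x"
  proof (cases "x \<in> U")
    case True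
    then show ?thesis by (simp add: linear_maps_scale[OF T linear_maps_in[OF A True]])
  next
    case False
    then show ?thesis by (simp add: linear_maps_outside[OF A] linear_maps_0[OF T V])
  qed
qed

text \<open>The part of the argument that does not depend on the shape of the type. The finite image of
  \<open>J\<close> is what provides an invariant inner product.\<close>

locale hecke_pair = nonarch_local_field absF red
  for absF :: "'F::field \<Rightarrow> real" and red :: "'F \<Rightarrow> 'k::field" +
  fixes n :: nat and J :: "'F mat set" and W :: "'w::complex_vector set" and lam :: "'F mat \<Rightarrow> 'w \<Rightarrow> 'w"
    and BW :: "'w set"
  assumes J_subgroup: "subgroup J (GL n)"
    and J_open: "openin (GL_topology absF n) J"
    and J_compact: "compactin (GL_topology absF n) J"
    and BW: "finite BW" "cspan BW = W"
    and lam_endo: "j \<in> J \<Longrightarrow> lam j \<in> endomorphisms W"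
    and lam_mult: "j \<in> J \<Longrightarrow> k \<in> J \<Longrightarrow> lam (j * k) = lam j \<circ> lam k"
    and lam_one: "w \<in> W \<Longrightarrow> lam (1\<^sub>m n) w = w"
    and finite_lam: "finite (lam ` J)"
begin

sublocale G: group "GL n :: 'F mat monoid"
  by (rule group_GL)

abbreviation "GLn \<equiv> carrier (GL n :: 'F mat monoid)"

lemma J_sub: "j \<in> J \<Longrightarrow> j \<in> GLn"
  using subgroup.subset[OF J_subgroup] by (rule subsetD)

lemma J_one: "1\<^sub>m n \<in> J"
  using subgroup.one_closed[OF J_subgroup] by simp

lemma J_mult: "j \<in> J \<Longrightarrow> k \<in> J \<Longrightarrow> j * k \<in> J"
  using subgroup.m_closed[OF J_subgroup, of j k] by simp

lemma J_inv: "j \<in> J \<Longrightarrow> inv\<^bsub>GL n\<^esub> j \<in> J"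
  by (rule subgroup.m_inv_closed[OF J_subgroup])

lemma GLn_mult: "g \<in> GLn \<Longrightarrow> h \<in> GLn \<Longrightarrow> g * h \<in> GLn"
  using G.m_closed[of g h] by simp

lemma GLn_assoc: "g \<in> GLn \<Longrightarrow> h \<in> GLn \<Longrightarrow> k \<in> GLn \<Longrightarrow> g * h * k = g * (h * k)"
  using G.m_assoc[of g h k] by simp

lemma GLn_one: "g \<in> GLn \<Longrightarrow> 1\<^sub>m n * g = g" "g \<in> GLn \<Longrightarrow> g * 1\<^sub>m n = g"
  using G.l_one[of g] G.r_one[of g] by simp_all

lemma GLn_inv: "g \<in> GLn \<Longrightarrow> inv\<^bsub>GL n\<^esub> g * g = 1\<^sub>m n" "g \<in> GLn \<Longrightarrow> g * inv\<^bsub>GL n\<^esub> g = 1\<^sub>m n"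
  using G.l_inv[of g] G.r_inv[of g] by simp_all

lemma GLn_inv_mult: "g \<in> GLn \<Longrightarrow> h \<in> GLn \<Longrightarrow> inv\<^bsub>GL n\<^esub> (g * h) = inv\<^bsub>GL n\<^esub> h * inv\<^bsub>GL n\<^esub> g"
  using G.inv_mult_group[of g h] by simp

lemma one_GLn: "1\<^sub>m n \<in> GLn"
  using G.one_closed by simp

lemma topspace_GL: "topspace (GL_topology absF n) = GLn"
proof -
  have "GLn \<subseteq> carrier_mat n n" by (rule subsetI) (rule GL_carrier_mat)
  then show ?thesis unfolding GL_topology_def by (simp add: Int_absorb1)
qed

lemma continuous_GL_translation:
  assumes "g \<in> GLn" "h \<in> GLn"
  shows "continuous_map (GL_topology absF n) (GL_topology absF n) (\<lambda>A. g * A * h)"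
  unfolding GL_topology_def continuous_map_in_subtopology
proof
  show "continuous_map (subtopology (mat_topology absF n) GLn) (mat_topology absF n) (\<lambda>A. g * A * h)"
    by (rule continuous_map_from_subtopology)
      (rule continuous_translation[OF GL_carrier_mat[OF assms(1)] GL_carrier_mat[OF assms(2)]])
  show "(\<lambda>A. g * A * h) \<in> topspace (subtopology (mat_topology absF n) GLn) \<rightarrow> GLn"
  proof
    fix A assume "A \<in> topspace (subtopology (mat_topology absF n) GLn)"
    then have "A \<in> GLn" by simp
    then show "g * A * h \<in> GLn" by (intro GLn_mult assms)
  qed
qed

lemma openin_translate:
  assumes U: "openin (GL_topology absF n) U" and g: "g \<in> GLn" and h: "h \<in> GLn"
  shows "openin (GL_topology absF n) ((\<lambda>A. g * A * h) ` U)"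
proof -
  let ?g = "inv\<^bsub>GL n\<^esub> g" and ?h = "inv\<^bsub>GL n\<^esub> h"
  have gh: "?g \<in> GLn" "?h \<in> GLn" using g h by simp_all
  have U_sub: "U \<subseteq> GLn" using openin_subset[OF U] unfolding topspace_GL .
  have cancel: "?g * (g * A * h) * ?h = A" "g * (?g * A * ?h) * h = A" if A: "A \<in> GLn" for A
  proof -
    have "?g * (g * A * h) * ?h = (?g * g) * A * (h * ?h)"
      using g h gh A by (simp add: GLn_assoc GLn_mult)
    then show "?g * (g * A * h) * ?h = A" using g h A by (simp add: GLn_inv GLn_one)
    have "g * (?g * A * ?h) * h = (g * ?g) * A * (?h * h)"
      using g h gh A by (simp add: GLn_assoc GLn_mult)
    then show "g * (?g * A * ?h) * h = A" using g h A by (simp add: GLn_inv GLn_one)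
  qed
  have "openin (GL_topology absF n) {A \<in> topspace (GL_topology absF n). ?g * A * ?h \<in> U}"
    by (rule openin_continuous_map_preimage[OF continuous_GL_translation[OF gh] U])
  moreover have "{A \<in> topspace (GL_topology absF n). ?g * A * ?h \<in> U} = (\<lambda>A. g * A * h) ` U"
  proof (intro equalityI subsetI)
    fix A assume "A \<in> {A \<in> topspace (GL_topology absF n). ?g * A * ?h \<in> U}"
    then have A: "A \<in> GLn" "?g * A * ?h \<in> U" unfolding topspace_GL by simp_all
    show "A \<in> (\<lambda>A. g * A * h) ` U"
      by (rule image_eqI[OF _ A(2)]) (rule cancel(2)[OF A(1), symmetric])
  next
    fix A assume "A \<in> (\<lambda>A. g * A * h) ` U"
    then obtain C where C: "A = g * C * h" "C \<in> U" by (rule imageE)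
    then have "C \<in> GLn" using U_sub by blast
    then show "A \<in> {A \<in> topspace (GL_topology absF n). ?g * A * ?h \<in> U}"
      unfolding topspace_GL C(1) using C(2) g h by (simp add: cancel GLn_mult)
  qed
  ultimately show ?thesis by simp
qed

lemma right_coset_eq: "J #>\<^bsub>GL n\<^esub> x = (\<lambda>j. j * x) ` J"
  unfolding r_coset_def GL_mult by (rule UNION_singleton_eq_range)

lemma left_coset_eq: "x <#\<^bsub>GL n\<^esub> J = (\<lambda>j. x * j) ` J"
  unfolding l_coset_def GL_mult by (rule UNION_singleton_eq_range)

lemma openin_right_coset: "x \<in> GLn \<Longrightarrow> openin (GL_topology absF n) (J #>\<^bsub>GL n\<^esub> x)"
proof -
  assume x: "x \<in> GLn"
  have "(\<lambda>j. j * x) ` J = (\<lambda>j. 1\<^sub>m n * j * x) ` J"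
    by (rule image_cong) (simp_all add: GLn_one J_sub)
  then show ?thesis unfolding right_coset_eq using openin_translate[OF J_open one_GLn x] by simp
qed

lemma openin_left_coset: "x \<in> GLn \<Longrightarrow> openin (GL_topology absF n) (x <#\<^bsub>GL n\<^esub> J)"
proof -
  assume x: "x \<in> GLn"
  have "(\<lambda>j. x * j) ` J = (\<lambda>j. x * j * 1\<^sub>m n) ` J"
    by (rule image_cong) (simp_all add: GLn_one J_sub GLn_mult x)
  then show ?thesis unfolding left_coset_eq using openin_translate[OF J_open x one_GLn] by simp
qed

text \<open>Finitely many of the sets cover \<open>K\<close>, and each set is determined by any point of \<open>K\<close> in it.\<close>

lemma finite_open_partition:
  assumes K: "compactin (GL_topology absF n) K"
    and D: "\<And>x. x \<in> K \<Longrightarrow> openin (GL_topology absF n) (D x)" "\<And>x. x \<in> K \<Longrightarrow> x \<in> D x"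
    and eq: "\<And>x y. x \<in> K \<Longrightarrow> y \<in> K \<Longrightarrow> x \<in> D y \<Longrightarrow> D x = D y"
  shows "finite (D ` K)"
proof -
  have "\<exists>\<F>. finite \<F> \<and> \<F> \<subseteq> D ` K \<and> K \<subseteq> \<Union>\<F>"
  proof (rule compactinD[OF K])
    show "openin (GL_topology absF n) U" if "U \<in> D ` K" for U using that D(1) by (elim imageE) simp
    show "K \<subseteq> \<Union>(D ` K)" using D(2) by (intro subsetI UN_I)
  qed
  then obtain \<F> where F: "finite \<F>" "\<F> \<subseteq> D ` K" "K \<subseteq> \<Union>\<F>" by blast
  have "D x \<in> \<F>" if x: "x \<in> K" for x
  proof -
    obtain U where U: "U \<in> \<F>" "x \<in> U" using F(3) x by blast
    obtain y where y: "U = D y" "y \<in> K" using F(2) U(1) by blast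
    have "D x = D y" using eq[OF x y(2)] U(2) y(1) by simp
    then show ?thesis using U(1) y(1) by simp
  qed
  then have "D ` K \<subseteq> \<F>" by (rule image_subsetI)
  then show ?thesis by (rule finite_subset[OF _ F(1)])
qed

lemma compactin_sub: "compactin (GL_topology absF n) K \<Longrightarrow> x \<in> K \<Longrightarrow> x \<in> GLn"
  unfolding topspace_GL[symmetric] by (rule subsetD[OF compactin_subset_topspace])

lemma finite_right_cosets:
  assumes K: "compactin (GL_topology absF n) K"
  shows "finite ((\<lambda>x. J #>\<^bsub>GL n\<^esub> x) ` K)"
proof (rule finite_open_partition[OF K])
  show "openin (GL_topology absF n) (J #>\<^bsub>GL n\<^esub> x)" if "x \<in> K" for x
    by (rule openin_right_coset[OF compactin_sub[OF K that]])
  show "x \<in> J #>\<^bsub>GL n\<^esub> x" if "x \<in> K" for x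
    by (rule G.rcos_self[OF compactin_sub[OF K that] J_subgroup])
  show "J #>\<^bsub>GL n\<^esub> x = J #>\<^bsub>GL n\<^esub> y" if "x \<in> K" "y \<in> K" "x \<in> J #>\<^bsub>GL n\<^esub> y" for x y
    by (rule G.repr_independence[OF that(3) compactin_sub[OF K that(2)] J_subgroup, symmetric])
qed

lemma finite_left_cosets:
  assumes K: "compactin (GL_topology absF n) K"
  shows "finite ((\<lambda>x. x <#\<^bsub>GL n\<^esub> J) ` K)"
proof (rule finite_open_partition[OF K])
  show "openin (GL_topology absF n) (x <#\<^bsub>GL n\<^esub> J)" if "x \<in> K" for x
    by (rule openin_left_coset[OF compactin_sub[OF K that]])
  show "x \<in> x <#\<^bsub>GL n\<^esub> J" if "x \<in> K" for x
    unfolding left_coset_eq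
    by (rule image_eqI[OF _ J_one]) (rule GLn_one(2)[OF compactin_sub[OF K that], symmetric])
  show "x <#\<^bsub>GL n\<^esub> J = y <#\<^bsub>GL n\<^esub> J" if "x \<in> K" "y \<in> K" "x \<in> y <#\<^bsub>GL n\<^esub> J" for x y
    by (rule G.l_repr_independence[OF that(3) compactin_sub[OF K that(2)] J_subgroup, symmetric])
qed

text \<open>The representative at which \<open>coset_sum\<close> evaluates.\<close>

definition rep :: "'F mat set \<Rightarrow> 'F mat"
  where "rep C = (SOME x. x \<in> C)"

lemma rep:
  assumes "C \<in> rcosets\<^bsub>GL n\<^esub> J"
  shows "rep C \<in> C" "rep C \<in> GLn" "C = J #>\<^bsub>GL n\<^esub> rep C"
proof -
  obtain x where x: "x \<in> GLn" "C = J #>\<^bsub>GL n\<^esub> x"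
    using assms unfolding RCOSETS_def UN_iff singleton_iff by (elim bexE)
  have "x \<in> C" unfolding x(2) by (rule G.rcos_self[OF x(1) J_subgroup])
  then show r: "rep C \<in> C" unfolding rep_def by (rule someI)
  then obtain j where "j \<in> J" "rep C = j * x" unfolding x(2) right_coset_eq by blast
  then show "rep C \<in> GLn" using x(1) by (simp add: GLn_mult J_sub)
  show "C = J #>\<^bsub>GL n\<^esub> rep C"
    using G.repr_independence[OF r[unfolded x(2)] x(1) J_subgroup] x(2) by simp
qed

text \<open>The left coset of \<open>g x\<^sup>-\<^sup>1\<close> determines the right coset \<open>J x\<close>, and the compact set that
  contains the support of \<open>\<phi>\<close> meets only finitely many left cosets.\<close>

lemma finite_convolution_support:
  assumes \<phi>: "compact_support absF n \<phi>" and g: "g \<in> GLn"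
  shows "finite {C \<in> rcosets\<^bsub>GL n\<^esub> J. \<phi> (g * inv\<^bsub>GL n\<^esub> (rep C)) \<noteq> 0}"
proof -
  obtain K where K: "compactin (GL_topology absF n) K"
    "{g \<in> GLn. \<phi> g \<noteq> 0} \<subseteq> {1\<^sub>m n} <#>\<^bsub>GL n\<^esub> K"
    using \<phi> unfolding compact_support_mod_def by blast
  let ?S = "{C \<in> rcosets\<^bsub>GL n\<^esub> J. \<phi> (g * inv\<^bsub>GL n\<^esub> (rep C)) \<noteq> 0}"
  let ?k = "\<lambda>C. g * inv\<^bsub>GL n\<^esub> (rep C)"
  have k: "?k C \<in> GLn" if "C \<in> ?S" for C using that g rep(2) by (simp add: GLn_mult)
  have kK: "?k C \<in> K" if C: "C \<in> ?S" for C
  proof -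
    have "?k C \<in> {g \<in> GLn. \<phi> g \<noteq> 0}" using C k[OF C] by simp
    then have "?k C \<in> {1\<^sub>m n} <#>\<^bsub>GL n\<^esub> K" by (rule subsetD[OF K(2)])
    then obtain x where x: "x \<in> K" "?k C = 1\<^sub>m n * x"
      unfolding set_mult_def GL_mult UN_iff singleton_iff by (elim bexE) simp
    then show ?thesis using GLn_one(1)[OF compactin_sub[OF K(1) x(1)]] by simp
  qed
  show ?thesis
  proof (rule inj_on_finite[OF _ _ finite_left_cosets[OF K(1)]])
    show "(\<lambda>C. ?k C <#\<^bsub>GL n\<^esub> J) ` ?S \<subseteq> (\<lambda>x. x <#\<^bsub>GL n\<^esub> J) ` K"
      by (rule image_subsetI) (rule imageI, rule kK)
    show "inj_on (\<lambda>C. ?k C <#\<^bsub>GL n\<^esub> J) ?S"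
    proof (rule inj_onI)
      fix C D assume C: "C \<in> ?S" and D: "D \<in> ?S" and eq: "?k C <#\<^bsub>GL n\<^esub> J = ?k D <#\<^bsub>GL n\<^esub> J"
      have "?k C \<in> ?k C <#\<^bsub>GL n\<^esub> J"
        unfolding left_coset_eq by (rule image_eqI[OF _ J_one]) (simp add: GLn_one(2)[OF k[OF C]])
      then have "?k C \<in> ?k D <#\<^bsub>GL n\<^esub> J" by (simp only: eq)
      then obtain j where j: "?k C = ?k D * j" "j \<in> J" unfolding left_coset_eq by (rule imageE)
      have c: "rep C \<in> GLn" "rep D \<in> GLn" using C D rep(2) by simp_all
      let ?c = "inv\<^bsub>GL n\<^esub> (rep C)" and ?d = "inv\<^bsub>GL n\<^esub> (rep D)"
      have cd: "?c \<in> GLn" "?d \<in> GLn" using c by simp_all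
      have "g * ?c = g * (?d * j)" using j(1) GLn_assoc[OF g cd(2) J_sub[OF j(2)]] by simp
      then have "?c = ?d * j"
        using G.Units_l_cancel[unfolded G.Units_eq, OF g cd(1) GLn_mult[OF cd(2) J_sub[OF j(2)]]] by simp
      then have "inv\<^bsub>GL n\<^esub> ?c = inv\<^bsub>GL n\<^esub> j * inv\<^bsub>GL n\<^esub> ?d"
        using GLn_inv_mult[OF cd(2) J_sub[OF j(2)]] by simp
      then have "rep C = inv\<^bsub>GL n\<^esub> j * rep D" using c by simp
      then have "rep C \<in> J #>\<^bsub>GL n\<^esub> rep D" unfolding right_coset_eq using J_inv[OF j(2)] by (rule image_eqI)
      from G.repr_independence[OF this c(2) J_subgroup]
      have "J #>\<^bsub>GL n\<^esub> rep D = J #>\<^bsub>GL n\<^esub> rep C" .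
      then show "C = D" using rep(3)[of C] rep(3)[of D] C D by simp
    qed
  qed
qed

text \<open>The union is finite, because \<open>g J\<close> is compact and meets only finitely many right cosets.\<close>

lemma compactin_double_coset:
  assumes g: "g \<in> GLn"
  shows "compactin (GL_topology absF n) (\<Union>k\<in>J. J #>\<^bsub>GL n\<^esub> (g * k))"
proof -
  have img: "(\<lambda>k. g * k) ` J = (\<lambda>A. g * A * 1\<^sub>m n) ` J"
    by (rule image_cong) (simp_all add: GLn_one GLn_mult g J_sub)
  have "compactin (GL_topology absF n) ((\<lambda>k. g * k) ` J)"
    unfolding img by (rule image_compactin[OF J_compact continuous_GL_translation[OF g one_GLn]])
  then have fin: "finite ((\<lambda>x. J #>\<^bsub>GL n\<^esub> x) ` (\<lambda>k. g * k) ` J)" by (rule finite_right_cosets)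
  have "compactin (GL_topology absF n) (\<Union>((\<lambda>x. J #>\<^bsub>GL n\<^esub> x) ` (\<lambda>k. g * k) ` J))"
  proof (rule compactin_Union[OF fin])
    fix S assume "S \<in> (\<lambda>x. J #>\<^bsub>GL n\<^esub> x) ` (\<lambda>k. g * k) ` J"
    then obtain k where k: "k \<in> J" "S = J #>\<^bsub>GL n\<^esub> (g * k)" by blast
    have gk: "g * k \<in> GLn" using g k by (simp add: GLn_mult J_sub)
    have "(\<lambda>j. j * (g * k)) ` J = (\<lambda>A. 1\<^sub>m n * A * (g * k)) ` J"
      by (rule image_cong) (simp_all add: GLn_one J_sub)
    then show "compactin (GL_topology absF n) S"
      unfolding k(2) right_coset_eq
      using image_compactin[OF J_compact continuous_GL_translation[OF one_GLn gk]] by simp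
  qed
  then show ?thesis unfolding image_image .
qed

end

section \<open>Adjoints on the dual of the type\<close>

context hecke_pair
begin

abbreviation "W' \<equiv> dual_space W"
abbreviation "lam_dual \<equiv> contragredient (GL n) W lam"

lemma W_csubspace: "csubspace W"
  using BW(2) cvec.subspace_span by blast

lemma W'_csubspace: "csubspace W'"
  by (rule csubspace_dual_space)

lemma lam_dual_eq:
  assumes j: "j \<in> J" and \<xi>: "\<xi> \<in> W'"
  shows "lam_dual j \<xi> = \<xi> \<circ> lam (inv\<^bsub>GL n\<^esub> j)"
proof
  fix w
  show "lam_dual j \<xi> w = (\<xi> \<circ> lam (inv\<^bsub>GL n\<^esub> j)) w"
  proof (cases "w \<in> W")
    case False
    have "lam (inv\<^bsub>GL n\<^esub> j) w = 0" by (rule linear_maps_outside[OF lam_endo[OF J_inv[OF j]] False])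
    moreover have "\<xi> 0 = 0" by (rule linear_form_on_0[OF linear_form_on_dual[OF \<xi>] W_csubspace])
    ultimately show ?thesis using False \<xi> by (simp add: contragredient_def)
  qed (use \<xi> in \<open>simp add: contragredient_def\<close>)
qed

lemma lam_dual_outside: "\<xi> \<notin> W' \<Longrightarrow> lam_dual j \<xi> = 0"
  by (simp add: contragredient_def)

lemma lam_dual_endo:
  assumes j: "j \<in> J"
  shows "lam_dual j \<in> endomorphisms W'"
  unfolding linear_maps_def
proof (intro CollectI conjI ballI allI impI)
  show "lam_dual j \<xi> \<in> W'" if "\<xi> \<in> W'" for \<xi>
    unfolding lam_dual_eq[OF j that] by (rule dual_space_comp[OF that lam_endo[OF J_inv[OF j]] W_csubspace])
  show "lam_dual j (\<xi> + \<eta>) = lam_dual j \<xi> + lam_dual j \<eta>" if "\<xi> \<in> W'" "\<eta> \<in> W'" for \<xi> \<eta>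
    unfolding lam_dual_eq[OF j that(1)] lam_dual_eq[OF j that(2)] lam_dual_eq[OF j cvec.subspace_add[OF W'_csubspace that]]
    by (rule ext) simp
  show "lam_dual j (c *\<^sub>C \<xi>) = c *\<^sub>C lam_dual j \<xi>" if "\<xi> \<in> W'" for c \<xi>
    unfolding lam_dual_eq[OF j that] lam_dual_eq[OF j cvec.subspace_scale[OF W'_csubspace that]]
    by (rule ext) simp
qed (rule lam_dual_outside)

lemma lam_dual_in: "j \<in> J \<Longrightarrow> \<xi> \<in> W' \<Longrightarrow> lam_dual j \<xi> \<in> W'"
  by (rule linear_maps_in[OF lam_dual_endo])

lemma lam_inv_cancel:
  assumes "j \<in> J" "w \<in> W"
  shows "lam j (lam (inv\<^bsub>GL n\<^esub> j) w) = w"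
  using lam_mult[OF assms(1) J_inv[OF assms(1)]] lam_one[OF assms(2)] GLn_inv(2)[OF J_sub[OF assms(1)]]
  by (metis comp_apply)

lemma lam_dual_inv_cancel:
  assumes j: "j \<in> J" and \<xi>: "\<xi> \<in> W'"
  shows "lam_dual (inv\<^bsub>GL n\<^esub> j) (lam_dual j \<xi>) = \<xi>"
proof (rule linear_maps_eqI)
  have j': "inv\<^bsub>GL n\<^esub> j \<in> J" by (rule J_inv[OF j])
  have in': "lam_dual (inv\<^bsub>GL n\<^esub> j) (lam_dual j \<xi>) \<in> W'" by (intro lam_dual_in j j' \<xi>)
  then show "lam_dual (inv\<^bsub>GL n\<^esub> j) (lam_dual j \<xi>) \<in> linear_maps W UNIV" by (simp add: dual_space_def)
  show "\<xi> \<in> linear_maps W UNIV" using \<xi> by (simp add: dual_space_def)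
  fix w assume w: "w \<in> W"
  have "lam_dual (inv\<^bsub>GL n\<^esub> j) (lam_dual j \<xi>) w = \<xi> (lam (inv\<^bsub>GL n\<^esub> j) (lam (inv\<^bsub>GL n\<^esub> (inv\<^bsub>GL n\<^esub> j)) w))"
    unfolding lam_dual_eq[OF j' lam_dual_in[OF j \<xi>]] unfolding lam_dual_eq[OF j \<xi>] by simp
  also have "\<dots> = \<xi> w" by (simp only: lam_inv_cancel[OF j' w])
  finally show "lam_dual (inv\<^bsub>GL n\<^esub> j) (lam_dual j \<xi>) w = \<xi> w" .
qed

text \<open>The sum over generators \<open>b\<close> of \<open>W\<close> makes the form definite on the dual of \<open>W\<close>; the sum over
  the finite group of operators \<open>s\<close> makes it invariant.\<close>

definition ip :: "('w \<Rightarrow> complex) \<Rightarrow> ('w \<Rightarrow> complex) \<Rightarrow> complex"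
  where "ip \<xi> \<eta> = (\<Sum>b\<in>BW. \<Sum>s\<in>lam ` J. \<xi> (s b) * cnj (\<eta> (s b)))"

lemma ip_add_left: "ip (\<xi> + \<xi>') \<eta> = ip \<xi> \<eta> + ip \<xi>' \<eta>"
  by (simp add: ip_def distrib_right sum.distrib)

lemma ip_scale_left: "ip (c *\<^sub>C \<xi>) \<eta> = c * ip \<xi> \<eta>"
  by (simp add: ip_def sum_distrib_left mult.assoc)

lemma ip_add_right: "ip \<xi> (\<eta> + \<eta>') = ip \<xi> \<eta> + ip \<xi> \<eta>'"
  by (simp add: ip_def distrib_left sum.distrib)

lemma ip_scale_right: "ip \<xi> (c *\<^sub>C \<eta>) = cnj c * ip \<xi> \<eta>"
  by (simp add: ip_def sum_distrib_left mult.left_commute)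

lemma ip_zero_left: "ip 0 \<eta> = 0"
  by (simp add: ip_def)

lemma ip_zero_right: "ip \<xi> 0 = 0"
  by (simp add: ip_def)

lemma ip_sum_left: "ip (\<Sum>i\<in>I. x i) \<eta> = (\<Sum>i\<in>I. ip (x i) \<eta>)"
proof (induction I rule: infinite_finite_induct)
  case (infinite I)
  show ?case unfolding sum.infinite[OF infinite] by (rule ip_zero_left)
next
  case empty
  show ?case unfolding sum.empty by (rule ip_zero_left)
next
  case (insert i I)
  show ?case unfolding sum.insert[OF insert(1,2)] ip_add_left insert(3) by (rule refl)
qed

lemma ip_cnj: "cnj (ip \<xi> \<eta>) = ip \<eta> \<xi>"
  by (simp add: ip_def mult.commute)

definition sqnorm :: "('w \<Rightarrow> complex) \<Rightarrow> real"
  where "sqnorm \<xi> = (\<Sum>b\<in>BW. \<Sum>s\<in>lam ` J. (cmod (\<xi> (s b)))\<^sup>2)"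

lemma ip_self: "ip \<xi> \<xi> = complex_of_real (sqnorm \<xi>)"
  by (simp add: ip_def sqnorm_def complex_norm_square[symmetric])

lemma sqnorm_nonneg: "0 \<le> sqnorm \<xi>"
  unfolding sqnorm_def by (intro sum_nonneg) simp

lemma sqnorm_zero:
  assumes \<xi>: "\<xi> \<in> W'" and z: "sqnorm \<xi> = 0"
  shows "\<xi> = 0"
proof (rule linear_maps_eqI)
  show "\<xi> \<in> linear_maps W UNIV" using \<xi> by (simp add: dual_space_def)
  have z0: "0 \<in> W'" by (rule zero_in_csubspace[OF W'_csubspace])
  then show "0 \<in> linear_maps W (UNIV :: complex set)" by (simp add: dual_space_def)
  have "\<xi> b = 0" if b: "b \<in> BW" for b
  proof -
    have "\<forall>b\<in>BW. (\<Sum>s\<in>lam ` J. (cmod (\<xi> (s b)))\<^sup>2) = 0"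
      using z unfolding sqnorm_def
      by (subst (asm) sum_nonneg_eq_0_iff[OF BW(1)]) (simp_all add: sum_nonneg)
    then have "(\<Sum>s\<in>lam ` J. (cmod (\<xi> (s b)))\<^sup>2) = 0" using b by blast
    then have "\<forall>s\<in>lam ` J. (cmod (\<xi> (s b)))\<^sup>2 = 0"
      by (subst (asm) sum_nonneg_eq_0_iff[OF finite_lam]) simp_all
    then have "\<xi> (lam (1\<^sub>m n) b) = 0" using J_one by simp
    moreover have "b \<in> W" using b BW(2) cvec.span_base by blast
    ultimately show ?thesis using lam_one by simp
  qed
  then show "\<xi> w = (0 :: 'w \<Rightarrow> complex) w" if "w \<in> W" for w
    using linear_form_on_eq_on_span[of BW \<xi> 0 w] linear_form_on_dual[OF \<xi>] linear_form_on_dual[OF z0] that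
    unfolding BW(2) by simp
qed

text \<open>Substitute \<open>s \<mapsto> \<lambda>(j) s\<close> in the sum over the group of operators.\<close>

lemma ip_lam_dual:
  assumes j: "j \<in> J" and \<xi>: "\<xi> \<in> W'" and \<eta>: "\<eta> \<in> W'"
  shows "ip (lam_dual j \<xi>) \<eta> = ip \<xi> (lam_dual (inv\<^bsub>GL n\<^esub> j) \<eta>)"
proof -
  let ?j = "inv\<^bsub>GL n\<^esub> j"
  have j': "?j \<in> J" by (rule J_inv[OF j])
  have jj: "inv\<^bsub>GL n\<^esub> ?j = j" using G.inv_inv[OF J_sub[OF j]] .
  have absorb: "lam k \<circ> s \<in> lam ` J" if k: "k \<in> J" and s: "s \<in> lam ` J" for k s
  proof -
    obtain l where l: "s = lam l" "l \<in> J" using s by (rule imageE)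
    show ?thesis unfolding l(1) lam_mult[OF k l(2), symmetric] by (rule imageI[OF J_mult[OF k l(2)]])
  qed
  have cancel: "lam k \<circ> (lam (inv\<^bsub>GL n\<^esub> k) \<circ> s) = s" if k: "k \<in> J" and s: "s \<in> lam ` J" for k s
  proof -
    obtain l where l: "s = lam l" "l \<in> J" using s by (rule imageE)
    note k' = J_inv[OF k]
    have "lam k \<circ> (lam (inv\<^bsub>GL n\<^esub> k) \<circ> lam l) = lam (k * (inv\<^bsub>GL n\<^esub> k * l))"
      by (simp only: lam_mult[OF k' l(2)] lam_mult[OF k J_mult[OF k' l(2)]])
    also have "k * (inv\<^bsub>GL n\<^esub> k * l) = l"
      using GLn_assoc[OF J_sub[OF k] J_sub[OF k'] J_sub[OF l(2)]] GLn_inv(2)[OF J_sub[OF k]]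
        GLn_one(1)[OF J_sub[OF l(2)]] by simp
    finally show ?thesis unfolding l(1) .
  qed
  have "(\<Sum>s\<in>lam ` J. (lam_dual j \<xi>) (s b) * cnj (\<eta> (s b)))
      = (\<Sum>s\<in>lam ` J. \<xi> (s b) * cnj ((lam_dual ?j \<eta>) (s b)))" for b
  proof (rule sum.reindex_bij_witness[where i = "\<lambda>s. lam j \<circ> s" and j = "\<lambda>s. lam ?j \<circ> s"])
    fix s assume s: "s \<in> lam ` J"
    show "lam j \<circ> (lam ?j \<circ> s) = s" by (rule cancel[OF j s])
    show "lam ?j \<circ> s \<in> lam ` J" by (rule absorb[OF j' s])
    show "lam ?j \<circ> (lam j \<circ> s) = s" using cancel[OF j' s] unfolding jj .
    show "lam j \<circ> s \<in> lam ` J" by (rule absorb[OF j s])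
    have "\<eta> (lam j (lam ?j (s b))) = \<eta> (s b)" using cancel[OF j s] by (metis comp_apply)
    then show "\<xi> ((lam ?j \<circ> s) b) * cnj ((lam_dual ?j \<eta>) ((lam ?j \<circ> s) b)) = (lam_dual j \<xi>) (s b) * cnj (\<eta> (s b))"
      unfolding lam_dual_eq[OF j \<xi>] lam_dual_eq[OF j' \<eta>] jj comp_apply by (simp only:)
  qed
  then show ?thesis unfolding ip_def by (simp only:)
qed

lemma ip_unique:
  assumes \<zeta>: "\<zeta> \<in> W'" and \<zeta>': "\<zeta>' \<in> W'" and eq: "\<And>\<xi>. \<xi> \<in> W' \<Longrightarrow> ip \<xi> \<zeta> = ip \<xi> \<zeta>'"
  shows "\<zeta> = \<zeta>'"
proof -
  have d: "\<zeta> - \<zeta>' \<in> W'" by (rule cvec.subspace_diff[OF W'_csubspace \<zeta> \<zeta>'])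
  have "\<zeta> = (\<zeta> - \<zeta>') + \<zeta>'" by simp
  then have "ip (\<zeta> - \<zeta>') \<zeta> = ip (\<zeta> - \<zeta>') (\<zeta> - \<zeta>') + ip (\<zeta> - \<zeta>') \<zeta>'" by (metis ip_add_right)
  then have "ip (\<zeta> - \<zeta>') (\<zeta> - \<zeta>') = 0" using eq[OF d] by simp
  then have "sqnorm (\<zeta> - \<zeta>') = 0" unfolding ip_self by simp
  then have "\<zeta> - \<zeta>' = 0" by (rule sqnorm_zero[OF d])
  then show ?thesis by simp
qed

text \<open>The forms \<open>\<xi> \<mapsto> ip \<xi> \<zeta>\<close> separate the points by definiteness, so they exhaust the linear
  forms.\<close>

lemma riesz:
  assumes \<phi>: "linear_form_on W' \<phi>"
  shows "\<exists>\<zeta>\<in>W'. \<forall>\<xi>\<in>W'. \<phi> \<xi> = ip \<xi> \<zeta>"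
proof -
  obtain C where C: "finite C" "cspan C = W'" using finite_dimensional_dual[OF BW(1)] unfolding BW(2) .
  let ?D = "{\<psi>. \<exists>\<zeta>\<in>W'. \<forall>\<xi>\<in>W'. \<psi> \<xi> = ip \<xi> \<zeta>}"
  have D: "csubspace ?D"
  proof (rule cvec.subspaceI)
    show "0 \<in> ?D" using zero_in_csubspace[OF W'_csubspace] by (intro CollectI bexI[of _ 0]) (simp_all add: ip_zero_right)
    fix \<psi> assume "\<psi> \<in> ?D"
    then obtain \<zeta> where \<zeta>: "\<zeta> \<in> W'" "\<And>\<xi>. \<xi> \<in> W' \<Longrightarrow> \<psi> \<xi> = ip \<xi> \<zeta>" by blast
    show "c *\<^sub>C \<psi> \<in> ?D" for c
      by (intro CollectI bexI[of _ "cnj c *\<^sub>C \<zeta>"] ballI cvec.subspace_scale[OF W'_csubspace \<zeta>(1)])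
        (simp add: ip_scale_right \<zeta>(2))
    fix \<psi>' assume "\<psi>' \<in> ?D"
    then obtain \<zeta>' where \<zeta>': "\<zeta>' \<in> W'" "\<And>\<xi>. \<xi> \<in> W' \<Longrightarrow> \<psi>' \<xi> = ip \<xi> \<zeta>'" by blast
    show "\<psi> + \<psi>' \<in> ?D"
      by (intro CollectI bexI[of _ "\<zeta> + \<zeta>'"] ballI cvec.subspace_add[OF W'_csubspace \<zeta>(1) \<zeta>'(1)])
        (simp add: ip_add_right \<zeta>(2) \<zeta>'(2))
  qed
  have "\<exists>\<psi>\<in>?D. \<forall>\<xi>\<in>cspan C. \<psi> \<xi> = \<phi> \<xi>"
  proof (rule separating_forms_exhaust[OF C(1) D], unfold C(2))
    show "linear_form_on W' \<psi>" if \<psi>: "\<psi> \<in> ?D" for \<psi>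
    proof -
      obtain \<zeta> where \<zeta>: "\<And>\<xi>. \<xi> \<in> W' \<Longrightarrow> \<psi> \<xi> = ip \<xi> \<zeta>" using \<psi> by blast
      show ?thesis
        unfolding linear_form_on_def
        by (simp add: \<zeta> cvec.subspace_add[OF W'_csubspace] cvec.subspace_scale[OF W'_csubspace]
            ip_add_left ip_scale_left)
    qed
    show "\<xi> = 0" if \<xi>: "\<xi> \<in> W'" and van: "\<And>\<psi>. \<psi> \<in> ?D \<Longrightarrow> \<psi> \<xi> = 0" for \<xi>
    proof -
      have "(\<lambda>\<eta>. ip \<eta> \<xi>) \<in> ?D" using \<xi> by (intro CollectI bexI[of _ \<xi>] ballI refl)
      then have "ip \<xi> \<xi> = 0" by (rule van)
      then have "sqnorm \<xi> = 0" unfolding ip_self by simp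
      then show ?thesis by (rule sqnorm_zero[OF \<xi>])
    qed
  qed (rule \<phi>)
  then show ?thesis unfolding C(2) by fastforce
qed

definition adjoint :: "(('w \<Rightarrow> complex) \<Rightarrow> 'w \<Rightarrow> complex) \<Rightarrow> ('w \<Rightarrow> complex) \<Rightarrow> 'w \<Rightarrow> complex"
  where "adjoint A \<eta> = (if \<eta> \<in> W' then (SOME \<zeta>. \<zeta> \<in> W' \<and> (\<forall>\<xi>\<in>W'. ip (A \<xi>) \<eta> = ip \<xi> \<zeta>)) else 0)"

lemma adjoint:
  assumes A: "A \<in> endomorphisms W'" and \<eta>: "\<eta> \<in> W'"
  shows "adjoint A \<eta> \<in> W'" "\<And>\<xi>. \<xi> \<in> W' \<Longrightarrow> ip \<xi> (adjoint A \<eta>) = ip (A \<xi>) \<eta>"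
proof -
  have "linear_form_on W' (\<lambda>\<xi>. ip (A \<xi>) \<eta>)"
    unfolding linear_form_on_def
    by (simp add: linear_maps_add[OF A] linear_maps_scale[OF A] ip_add_left ip_scale_left)
  from riesz[OF this] have "\<exists>\<zeta>. \<zeta> \<in> W' \<and> (\<forall>\<xi>\<in>W'. ip (A \<xi>) \<eta> = ip \<xi> \<zeta>)" by blast
  from someI_ex[OF this] have "adjoint A \<eta> \<in> W' \<and> (\<forall>\<xi>\<in>W'. ip (A \<xi>) \<eta> = ip \<xi> (adjoint A \<eta>))"
    unfolding adjoint_def if_P[OF \<eta>] .
  then show "adjoint A \<eta> \<in> W'" "\<And>\<xi>. \<xi> \<in> W' \<Longrightarrow> ip \<xi> (adjoint A \<eta>) = ip (A \<xi>) \<eta>" by simp_all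
qed

lemma adjoint_endo:
  assumes A: "A \<in> endomorphisms W'"
  shows "adjoint A \<in> endomorphisms W'"
  unfolding linear_maps_def
proof (intro CollectI conjI ballI allI impI)
  note add = cvec.subspace_add[OF W'_csubspace] and scale = cvec.subspace_scale[OF W'_csubspace]
  note adj = adjoint[OF A]
  show "adjoint A \<eta> \<in> W'" if "\<eta> \<in> W'" for \<eta> by (rule adj(1)[OF that])
  show "adjoint A (\<eta> + \<eta>') = adjoint A \<eta> + adjoint A \<eta>'" if "\<eta> \<in> W'" "\<eta>' \<in> W'" for \<eta> \<eta>'
    by (rule ip_unique) (simp_all add: that add adj ip_add_right)
  show "adjoint A (c *\<^sub>C \<eta>) = c *\<^sub>C adjoint A \<eta>" if "\<eta> \<in> W'" for c \<eta>
    by (rule ip_unique) (simp_all add: that scale adj ip_scale_right)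
qed (simp add: adjoint_def)

lemma adjoint_eqI:
  assumes A: "A \<in> endomorphisms W'" and C: "C \<in> endomorphisms W'"
    and eq: "\<And>\<xi> \<eta>. \<xi> \<in> W' \<Longrightarrow> \<eta> \<in> W' \<Longrightarrow> ip (A \<xi>) \<eta> = ip \<xi> (C \<eta>)"
  shows "adjoint A = C"
proof (rule linear_maps_eqI[OF adjoint_endo[OF A] C])
  fix \<eta> assume \<eta>: "\<eta> \<in> W'"
  show "adjoint A \<eta> = C \<eta>"
    by (rule ip_unique) (simp_all add: adjoint[OF A \<eta>] linear_maps_in[OF C \<eta>] eq[OF _ \<eta>])
qed

end

section \<open>Convolution\<close>

context hecke_pair
begin

abbreviation "Hbar \<equiv> Hecke_bar n J W lam"
abbreviation "HA \<equiv> Hecke_algebra absF n J W lam"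

lemma Hbar_endo: "\<Psi> \<in> Hbar \<Longrightarrow> g \<in> GLn \<Longrightarrow> \<Psi> g \<in> endomorphisms W'"
  by (simp add: Hecke_bar_def)

lemma Hbar_outside: "\<Psi> \<in> Hbar \<Longrightarrow> g \<notin> GLn \<Longrightarrow> \<Psi> g = 0"
  by (simp add: Hecke_bar_def)

lemma Hbar_equivariant:
  "\<Psi> \<in> Hbar \<Longrightarrow> j \<in> J \<Longrightarrow> k \<in> J \<Longrightarrow> g \<in> GLn \<Longrightarrow> \<Psi> (j * g * k) = lam_dual j \<circ> \<Psi> g \<circ> lam_dual k"
  by (simp add: Hecke_bar_def)

lemma HA_Hbar: "\<phi> \<in> HA \<Longrightarrow> \<phi> \<in> Hbar"
  by (simp add: Hecke_algebra_def)

lemma csubspace_Hbar: "csubspace Hbar"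
proof (rule cvec.subspaceI)
  note End = csubspace_linear_maps[OF W'_csubspace, of W']
  have cg0: "lam_dual j 0 = 0" if "j \<in> J" for j by (rule linear_maps_0[OF lam_dual_endo[OF that] W'_csubspace])
  show "0 \<in> Hbar"
    unfolding Hecke_bar_def
  proof (intro CollectI conjI ballI allI impI)
    show "(0 :: ('F, 'w) hecke_fun) g \<in> endomorphisms W'" for g
      using zero_in_csubspace[OF End] by (simp only: zero_fun_apply)
    fix j k and g :: "'F mat" assume "j \<in> J"
    then show "(0 :: ('F, 'w) hecke_fun) (j * g * k) = lam_dual j \<circ> 0 g \<circ> lam_dual k"
      by (intro ext) (simp only: zero_fun_apply comp_apply cg0)
  qed simp
  fix \<Psi> assume \<Psi>: "\<Psi> \<in> Hbar"
  show "c *\<^sub>C \<Psi> \<in> Hbar" for c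
    unfolding Hecke_bar_def
  proof (intro CollectI conjI ballI allI impI)
    show "(c *\<^sub>C \<Psi>) g \<in> endomorphisms W'" if "g \<in> GLn" for g
      unfolding scaleC_fun_apply[of c \<Psi>] by (rule cvec.subspace_scale[OF End Hbar_endo[OF \<Psi> that]])
    show "(c *\<^sub>C \<Psi>) g = 0" if "g \<notin> GLn" for g
      unfolding scaleC_fun_apply[of c \<Psi>] Hbar_outside[OF \<Psi> that] by (rule cvec.scale_zero_right)
    show "(c *\<^sub>C \<Psi>) (j * g * k) = lam_dual j \<circ> (c *\<^sub>C \<Psi>) g \<circ> lam_dual k" if "j \<in> J" "k \<in> J" "g \<in> GLn" for j k g
      unfolding scaleC_fun_apply[of c \<Psi>] Hbar_equivariant[OF \<Psi> that]
        comp_scale_left[OF lam_dual_endo[OF that(1)] Hbar_endo[OF \<Psi> that(3)] W'_csubspace]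
      by (intro ext) (simp only: comp_apply scaleC_fun_apply)
  qed
  fix \<Psi>' assume \<Psi>': "\<Psi>' \<in> Hbar"
  show "\<Psi> + \<Psi>' \<in> Hbar"
    unfolding Hecke_bar_def
  proof (intro CollectI conjI ballI allI impI)
    show "(\<Psi> + \<Psi>') g \<in> endomorphisms W'" if "g \<in> GLn" for g
      unfolding plus_fun_apply[of \<Psi> \<Psi>']
      by (rule cvec.subspace_add[OF End Hbar_endo[OF \<Psi> that] Hbar_endo[OF \<Psi>' that]])
    show "(\<Psi> + \<Psi>') g = 0" if "g \<notin> GLn" for g
      unfolding plus_fun_apply[of \<Psi> \<Psi>'] Hbar_outside[OF \<Psi> that] Hbar_outside[OF \<Psi>' that] by (rule add_0)
    show "(\<Psi> + \<Psi>') (j * g * k) = lam_dual j \<circ> (\<Psi> + \<Psi>') g \<circ> lam_dual k" if "j \<in> J" "k \<in> J" "g \<in> GLn" for j k g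
      unfolding plus_fun_apply[of \<Psi> \<Psi>'] Hbar_equivariant[OF \<Psi> that] Hbar_equivariant[OF \<Psi>' that]
        comp_add_left[OF lam_dual_endo[OF that(1)] Hbar_endo[OF \<Psi> that(3)] Hbar_endo[OF \<Psi>' that(3)] W'_csubspace]
      by (intro ext) (simp only: comp_apply plus_fun_apply)
  qed
qed

abbreviation conv_support :: "('F, 'w) hecke_fun \<Rightarrow> 'F mat \<Rightarrow> 'F mat set set"
  where "conv_support \<phi> g \<equiv> {C \<in> rcosets\<^bsub>GL n\<^esub> J. \<phi> (g * inv\<^bsub>GL n\<^esub> (rep C)) \<noteq> 0}"

text \<open>The index set on the right depends on \<open>\<phi>\<close> and \<open>g\<close> only, while \<open>coset_sum\<close> runs over the
  nonzero terms; this is what makes the convolution linear in \<open>\<Psi>\<close>.\<close>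

lemma Hecke_conv_eq:
  assumes \<phi>: "\<phi> \<in> HA" and g: "g \<in> GLn"
  shows "Hecke_conv n J \<phi> \<Psi> g = (\<Sum>C\<in>conv_support \<phi> g. \<phi> (g * inv\<^bsub>GL n\<^esub> (rep C)) \<circ> \<Psi> (rep C))"
proof -
  let ?h = "\<lambda>x. \<phi> (g * inv\<^bsub>GL n\<^esub> x) \<circ> \<Psi> x"
  have fin: "finite (conv_support \<phi> g)"
    by (rule finite_convolution_support[OF _ g]) (use \<phi> in \<open>simp add: Hecke_algebra_def\<close>)
  have "Hecke_conv n J \<phi> \<Psi> g = (\<Sum>C\<in>{C \<in> rcosets\<^bsub>GL n\<^esub> J. ?h (rep C) \<noteq> 0}. ?h (rep C))"
    unfolding Hecke_conv_def coset_sum_def if_P[OF g] rep_def by (rule refl)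
  also have "\<dots> = (\<Sum>C\<in>conv_support \<phi> g. ?h (rep C))"
  proof (rule sum.mono_neutral_left[OF fin])
    have z: "?h (rep C) = 0" if "\<phi> (g * inv\<^bsub>GL n\<^esub> (rep C)) = 0" for C
      unfolding that by (intro ext) (simp only: comp_apply zero_fun_apply)
    then show "{C \<in> rcosets\<^bsub>GL n\<^esub> J. ?h (rep C) \<noteq> 0} \<subseteq> conv_support \<phi> g" by blast
    show "\<forall>C\<in>conv_support \<phi> g - {C \<in> rcosets\<^bsub>GL n\<^esub> J. ?h (rep C) \<noteq> 0}. ?h (rep C) = 0" by blast
  qed
  finally show ?thesis .
qed

lemma conv_term_endo:
  assumes "\<phi> \<in> HA" "g \<in> GLn" "C \<in> rcosets\<^bsub>GL n\<^esub> J"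
  shows "\<phi> (g * inv\<^bsub>GL n\<^esub> (rep C)) \<in> endomorphisms W'"
  by (rule Hbar_endo[OF HA_Hbar[OF assms(1)] GLn_mult[OF assms(2)]]) (simp add: rep(2)[OF assms(3)])

lemma Hecke_conv_add:
  assumes \<phi>: "\<phi> \<in> HA" and \<Psi>: "\<Psi> \<in> Hbar" and \<Psi>': "\<Psi>' \<in> Hbar"
  shows "Hecke_conv n J \<phi> (\<Psi> + \<Psi>') = Hecke_conv n J \<phi> \<Psi> + Hecke_conv n J \<phi> \<Psi>'"
proof
  fix g
  show "Hecke_conv n J \<phi> (\<Psi> + \<Psi>') g = (Hecke_conv n J \<phi> \<Psi> + Hecke_conv n J \<phi> \<Psi>') g"
  proof (cases "g \<in> GLn")
    case True
    have summand: "\<phi> (g * inv\<^bsub>GL n\<^esub> (rep C)) \<circ> (\<Psi> + \<Psi>') (rep C)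
        = (\<phi> (g * inv\<^bsub>GL n\<^esub> (rep C)) \<circ> \<Psi> (rep C)) + (\<phi> (g * inv\<^bsub>GL n\<^esub> (rep C)) \<circ> \<Psi>' (rep C))"
      if C: "C \<in> conv_support \<phi> g" for C
    proof -
      have C': "C \<in> rcosets\<^bsub>GL n\<^esub> J" using C by simp
      show ?thesis
        unfolding plus_fun_apply[of \<Psi> \<Psi>']
        by (rule comp_add_left[OF conv_term_endo[OF \<phi> True C'] Hbar_endo[OF \<Psi> rep(2)[OF C']]
              Hbar_endo[OF \<Psi>' rep(2)[OF C']] W'_csubspace])
    qed
    show ?thesis
      unfolding plus_fun_apply[of "Hecke_conv n J \<phi> \<Psi>"] Hecke_conv_eq[OF \<phi> True] sum.distrib[symmetric]
      by (rule sum.cong[OF refl summand])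
  next
    case False
    then have z: "Hecke_conv n J \<phi> \<Xi> g = 0" for \<Xi> by (simp add: Hecke_conv_def)
    show ?thesis
      unfolding plus_fun_apply[of "Hecke_conv n J \<phi> \<Psi>" "Hecke_conv n J \<phi> \<Psi>'" g] z
      by (rule add_0[symmetric])
  qed
qed

lemma Hecke_conv_scale:
  assumes \<phi>: "\<phi> \<in> HA" and \<Psi>: "\<Psi> \<in> Hbar"
  shows "Hecke_conv n J \<phi> (c *\<^sub>C \<Psi>) = c *\<^sub>C Hecke_conv n J \<phi> \<Psi>"
proof
  fix g
  show "Hecke_conv n J \<phi> (c *\<^sub>C \<Psi>) g = (c *\<^sub>C Hecke_conv n J \<phi> \<Psi>) g"
  proof (cases "g \<in> GLn")
    case True
    have summand: "\<phi> (g * inv\<^bsub>GL n\<^esub> (rep C)) \<circ> (c *\<^sub>C \<Psi>) (rep C)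
        = c *\<^sub>C (\<phi> (g * inv\<^bsub>GL n\<^esub> (rep C)) \<circ> \<Psi> (rep C))"
      if C: "C \<in> conv_support \<phi> g" for C
    proof -
      have C': "C \<in> rcosets\<^bsub>GL n\<^esub> J" using C by simp
      show ?thesis
        unfolding scaleC_fun_apply[of c \<Psi>]
        by (rule comp_scale_left[OF conv_term_endo[OF \<phi> True C'] Hbar_endo[OF \<Psi> rep(2)[OF C']] W'_csubspace])
    qed
    show ?thesis
      unfolding scaleC_fun_apply[of c "Hecke_conv n J \<phi> \<Psi>"] Hecke_conv_eq[OF \<phi> True] cvec.scale_sum_right
      by (rule sum.cong[OF refl summand])
  next
    case False
    then have z: "Hecke_conv n J \<phi> \<Xi> g = 0" for \<Xi> by (simp add: Hecke_conv_def)
    show ?thesis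
      unfolding scaleC_fun_apply[of c "Hecke_conv n J \<phi> \<Psi>" g] z
      by (rule cvec.scale_zero_right[symmetric])
  qed
qed

lemma csubspace_eigenspace: "csubspace (Hecke_eigenspace absF n J W lam chi)"
proof (rule cvec.subspaceI)
  let ?E = "Hecke_eigenspace absF n J W lam chi"
  have conv0: "Hecke_conv n J \<phi> 0 = 0" if "\<phi> \<in> HA" for \<phi>
    using Hecke_conv_scale[OF that zero_in_csubspace[OF csubspace_Hbar], of 0]
    by (simp only: cvec.scale_zero_left)
  show "0 \<in> ?E"
    unfolding Hecke_eigenspace_def
    by (intro CollectI conjI ballI zero_in_csubspace[OF csubspace_Hbar])
      (simp only: conv0 cvec.scale_zero_right)
  show "\<Psi> + \<Psi>' \<in> ?E" if \<Psi>: "\<Psi> \<in> ?E" and \<Psi>': "\<Psi>' \<in> ?E" for \<Psi> \<Psi>'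
  proof -
    have h: "\<Psi> \<in> Hbar" "\<Psi>' \<in> Hbar" using \<Psi> \<Psi>' unfolding Hecke_eigenspace_def by blast+
    have eq: "Hecke_conv n J \<phi> \<Psi> = chi \<phi> *\<^sub>C \<Psi>" "Hecke_conv n J \<phi> \<Psi>' = chi \<phi> *\<^sub>C \<Psi>'" if "\<phi> \<in> HA" for \<phi>
      using \<Psi> \<Psi>' that unfolding Hecke_eigenspace_def by blast+
    show ?thesis
      unfolding Hecke_eigenspace_def
      by (intro CollectI conjI ballI cvec.subspace_add[OF csubspace_Hbar h])
        (simp only: Hecke_conv_add[OF _ h] eq cvec.scale_right_distrib)
  qed
  show "c *\<^sub>C \<Psi> \<in> ?E" if \<Psi>: "\<Psi> \<in> ?E" for c \<Psi>
  proof -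
    have h: "\<Psi> \<in> Hbar" using \<Psi> unfolding Hecke_eigenspace_def by blast
    have eq: "Hecke_conv n J \<phi> \<Psi> = chi \<phi> *\<^sub>C \<Psi>" if "\<phi> \<in> HA" for \<phi>
      using \<Psi> that unfolding Hecke_eigenspace_def by blast
    show ?thesis
      unfolding Hecke_eigenspace_def
      by (intro CollectI conjI ballI cvec.subspace_scale[OF csubspace_Hbar h])
        (simp only: Hecke_conv_scale[OF _ h] eq cvec.scale_left_commute)
  qed
qed

subsection \<open>Nondegeneracy\<close>

definition double_coset :: "'F mat \<Rightarrow> 'F mat set"
  where "double_coset g = {j * g * k | j k. j \<in> J \<and> k \<in> J}"

lemma double_cosetE:
  assumes "x \<in> double_coset g"
  obtains j k where "j \<in> J" "k \<in> J" "x = j * g * k"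
  using assms unfolding double_coset_def by blast

lemma double_coset_translate:
  assumes g: "g \<in> GLn" and x: "x \<in> double_coset g" and j: "j \<in> J" and k: "k \<in> J"
  shows "j * x * k \<in> double_coset g"
proof -
  obtain j' k' where x': "j' \<in> J" "k' \<in> J" "x = j' * g * k'" using x by (rule double_cosetE)
  have m: "j \<in> GLn" "k \<in> GLn" "j' \<in> GLn" "k' \<in> GLn" using J_sub j k x' by blast+
  have "j * x * k = (j * j') * g * (k' * k)"
    unfolding x'(3) using m g by (simp add: GLn_assoc GLn_mult)
  then show ?thesis unfolding double_coset_def using J_mult j k x' by blast
qed

text \<open>The function \<open>x\<^sup>-\<^sup>1 \<mapsto> \<Psi>(x)\<^sup>*\<close>, cut off to the double coset of \<open>g\<close> so that its support is
  compact.\<close>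

definition dual_kernel :: "('F, 'w) hecke_fun \<Rightarrow> 'F mat \<Rightarrow> ('F, 'w) hecke_fun"
  where "dual_kernel \<Psi> g = (\<lambda>h. if h \<in> GLn \<and> inv\<^bsub>GL n\<^esub> h \<in> double_coset g
    then adjoint (\<Psi> (inv\<^bsub>GL n\<^esub> h)) else 0)"

text \<open>Inversion in the group and the adjoint both reverse products, and the operators of \<open>J\<close> are
  unitary.\<close>

lemma dual_kernel_Hbar:
  assumes \<Psi>: "\<Psi> \<in> Hbar" and g: "g \<in> GLn"
  shows "dual_kernel \<Psi> g \<in> Hbar"
  unfolding Hecke_bar_def
proof (intro CollectI conjI ballI allI impI)
  let ?\<phi> = "dual_kernel \<Psi> g"
  show "?\<phi> h \<in> endomorphisms W'" if h: "h \<in> GLn" for h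
  proof (cases "inv\<^bsub>GL n\<^esub> h \<in> double_coset g")
    case True
    then have "?\<phi> h = adjoint (\<Psi> (inv\<^bsub>GL n\<^esub> h))" using h by (simp add: dual_kernel_def)
    moreover have "adjoint (\<Psi> (inv\<^bsub>GL n\<^esub> h)) \<in> endomorphisms W'"
      by (rule adjoint_endo[OF Hbar_endo[OF \<Psi>]]) (use h in simp)
    ultimately show ?thesis by simp
  next
    case False
    then have "?\<phi> h = 0" by (simp add: dual_kernel_def)
    then show ?thesis using zero_in_csubspace[OF csubspace_linear_maps[OF W'_csubspace, of W']] by (simp only:)
  qed
  show "?\<phi> h = 0" if "h \<notin> GLn" for h using that by (simp add: dual_kernel_def)
  show "?\<phi> (j * h * k) = lam_dual j \<circ> ?\<phi> h \<circ> lam_dual k" if j: "j \<in> J" and k: "k \<in> J" and h: "h \<in> GLn" for j k h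
  proof -
    let ?j = "inv\<^bsub>GL n\<^esub> j" and ?k = "inv\<^bsub>GL n\<^esub> k" and ?h = "inv\<^bsub>GL n\<^esub> h"
    have m: "j \<in> GLn" "k \<in> GLn" "?j \<in> GLn" "?k \<in> GLn" "?h \<in> GLn" using J_sub[OF j] J_sub[OF k] h by simp_all
    have m': "?j \<in> J" "?k \<in> J" using J_inv j k by blast+
    have jhk: "j * h * k \<in> GLn" by (intro GLn_mult m h)
    have inv: "inv\<^bsub>GL n\<^esub> (j * h * k) = ?k * ?h * ?j"
      using GLn_inv_mult[OF GLn_mult[OF m(1) h] m(2)] GLn_inv_mult[OF m(1) h] GLn_assoc[OF m(4,5,3)] by simp
    have untranslate: "k * (?k * ?h * ?j) * j = ?h"
    proof -
      have "k * (?k * ?h * ?j) * j = (k * ?k) * ?h * (?j * j)"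
        using m by (simp add: GLn_assoc GLn_mult)
      then show ?thesis using m by (simp add: GLn_inv GLn_one)
    qed
    show ?thesis
    proof (cases "?h \<in> double_coset g")
      case True
      then have "?k * ?h * ?j \<in> double_coset g" by (rule double_coset_translate[OF g _ m'(2,1)])
      then have "?\<phi> (j * h * k) = adjoint (\<Psi> (?k * ?h * ?j))"
        unfolding dual_kernel_def inv using jhk by simp
      also have "\<dots> = lam_dual j \<circ> adjoint (\<Psi> ?h) \<circ> lam_dual k"
      proof (rule adjoint_eqI)
        have A: "\<Psi> ?h \<in> endomorphisms W'" by (rule Hbar_endo[OF \<Psi> m(5)])
        show "\<Psi> (?k * ?h * ?j) \<in> endomorphisms W'" by (rule Hbar_endo[OF \<Psi>]) (intro GLn_mult m)
        show "lam_dual j \<circ> adjoint (\<Psi> ?h) \<circ> lam_dual k \<in> endomorphisms W'"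
          by (rule linear_maps_comp[OF linear_maps_comp[OF lam_dual_endo[OF j] adjoint_endo[OF A] W'_csubspace]
                lam_dual_endo[OF k] W'_csubspace])
        fix \<xi> \<eta> assume \<xi>: "\<xi> \<in> W'" and \<eta>: "\<eta> \<in> W'"
        have invs: "inv\<^bsub>GL n\<^esub> ?j = j" "inv\<^bsub>GL n\<^esub> ?k = k" using G.inv_inv m(1,2) by blast+
        note j\<xi> = lam_dual_in[OF m'(1) \<xi>] and k\<eta> = lam_dual_in[OF k \<eta>]
        have "ip (\<Psi> (?k * ?h * ?j) \<xi>) \<eta> = ip (lam_dual ?k (\<Psi> ?h (lam_dual ?j \<xi>))) \<eta>"
          unfolding Hbar_equivariant[OF \<Psi> m'(2,1) m(5)] comp_apply by (rule refl)
        also have "\<dots> = ip (\<Psi> ?h (lam_dual ?j \<xi>)) (lam_dual k \<eta>)"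
          using ip_lam_dual[OF m'(2) linear_maps_in[OF A j\<xi>] \<eta>] unfolding invs .
        also have "\<dots> = ip (lam_dual ?j \<xi>) (adjoint (\<Psi> ?h) (lam_dual k \<eta>))"
          by (rule adjoint(2)[OF A k\<eta> j\<xi>, symmetric])
        also have "\<dots> = ip \<xi> (lam_dual j (adjoint (\<Psi> ?h) (lam_dual k \<eta>)))"
          using ip_lam_dual[OF m'(1) \<xi> adjoint(1)[OF A k\<eta>]] unfolding invs .
        finally show "ip (\<Psi> (?k * ?h * ?j) \<xi>) \<eta> = ip \<xi> ((lam_dual j \<circ> adjoint (\<Psi> ?h) \<circ> lam_dual k) \<eta>)"
          unfolding comp_apply .
      qed
      also have "adjoint (\<Psi> ?h) = ?\<phi> h" using True h by (simp add: dual_kernel_def)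
      finally show ?thesis .
    next
      case False
      have "?k * ?h * ?j \<notin> double_coset g"
      proof
        assume "?k * ?h * ?j \<in> double_coset g"
        from double_coset_translate[OF g this k j] show False using False unfolding untranslate by blast
      qed
      then have "?\<phi> (j * h * k) = 0" unfolding dual_kernel_def inv by simp
      moreover have "?\<phi> h = 0" using False by (simp add: dual_kernel_def)
      moreover have "lam_dual j \<circ> 0 \<circ> lam_dual k = 0"
        by (intro ext) (simp only: comp_apply zero_fun_apply linear_maps_0[OF lam_dual_endo[OF j] W'_csubspace])
      ultimately show ?thesis by (simp only:)
    qed
  qed
qed

lemma dual_kernel_HA:
  assumes \<Psi>: "\<Psi> \<in> Hbar" and g: "g \<in> GLn"
  shows "dual_kernel \<Psi> g \<in> HA"
proof -
  let ?\<phi> = "dual_kernel \<Psi> g" and ?g = "inv\<^bsub>GL n\<^esub> g"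
  have g': "?g \<in> GLn" using g by simp
  let ?C = "\<Union>k\<in>J. J #>\<^bsub>GL n\<^esub> (?g * k)"
  have "{h \<in> GLn. ?\<phi> h \<noteq> 0} \<subseteq> {1\<^sub>m n} <#>\<^bsub>GL n\<^esub> ?C"
  proof
    fix h assume "h \<in> {h \<in> GLn. ?\<phi> h \<noteq> 0}"
    then have h: "h \<in> GLn" "inv\<^bsub>GL n\<^esub> h \<in> double_coset g"
      by (auto simp: dual_kernel_def split: if_splits)
    obtain j k where jk: "j \<in> J" "k \<in> J" "inv\<^bsub>GL n\<^esub> h = j * g * k" using h(2) by (rule double_cosetE)
    let ?j = "inv\<^bsub>GL n\<^esub> j" and ?k = "inv\<^bsub>GL n\<^esub> k"
    have m: "j \<in> GLn" "k \<in> GLn" using J_sub jk(1,2) by blast+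
    have "h = inv\<^bsub>GL n\<^esub> (j * g * k)" using jk(3) G.inv_inv[OF h(1)] by simp
    also have "\<dots> = ?k * (?g * ?j)"
      using GLn_inv_mult[OF GLn_mult[OF m(1) g] m(2)] GLn_inv_mult[OF m(1) g] by simp
    finally have h_eq: "h = ?k * (?g * ?j)" .
    have "h \<in> J #>\<^bsub>GL n\<^esub> (?g * ?j)"
      unfolding right_coset_eq using h_eq J_inv[OF jk(2)] by (rule image_eqI[where x = ?k])
    then have "h \<in> ?C" by (rule UN_I[OF J_inv[OF jk(1)]])
    moreover have "h = 1\<^sub>m n * h" by (rule GLn_one(1)[OF h(1), symmetric])
    ultimately show "h \<in> {1\<^sub>m n} <#>\<^bsub>GL n\<^esub> ?C" unfolding set_mult_def GL_mult by blast
  qed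
  then have "compact_support absF n ?\<phi>"
    unfolding compact_support_mod_def using compactin_double_coset[OF g'] by blast
  then show ?thesis using dual_kernel_Hbar[OF \<Psi> g] by (simp add: Hecke_algebra_def)
qed

text \<open>The convolution of \<open>dual_kernel \<Psi> g\<close> with \<open>\<Psi>\<close> has at \<open>1\<close> the value \<open>\<Sum>\<^sub>x \<Psi>(x)\<^sup>* \<Psi>(x)\<close>, where
  \<open>x\<close> represents the right cosets in the double coset of \<open>g\<close>. Pairing with \<open>\<xi>\<close> gives \<open>\<Sum>\<^sub>x \<parallel>\<Psi>(x)
  \<xi>\<parallel>\<^sup>2\<close>.\<close>

lemma Hecke_pairing_nondegenerate:
  assumes \<Psi>: "\<Psi> \<in> Hbar" and van: "\<And>\<phi>. \<phi> \<in> HA \<Longrightarrow> Hecke_conv n J \<phi> \<Psi> (1\<^sub>m n) = 0"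
  shows "\<Psi> = 0"
proof
  fix g
  show "\<Psi> g = 0 g"
  proof (cases "g \<in> GLn")
    case False
    then show ?thesis using Hbar_outside[OF \<Psi>] by simp
  next
    case g: True
    let ?\<phi> = "dual_kernel \<Psi> g"
    note \<phi> = dual_kernel_HA[OF \<Psi> g]
    have fin: "finite (conv_support ?\<phi> (1\<^sub>m n))"
      by (rule finite_convolution_support[OF _ one_GLn]) (use \<phi> in \<open>simp add: Hecke_algebra_def\<close>)
    have val: "?\<phi> (1\<^sub>m n * inv\<^bsub>GL n\<^esub> (rep C)) = adjoint (\<Psi> (rep C))"
      if "C \<in> rcosets\<^bsub>GL n\<^esub> J" "rep C \<in> double_coset g" for C
    proof -
      have r: "rep C \<in> GLn" by (rule rep(2)[OF that(1)])
      have "1\<^sub>m n * inv\<^bsub>GL n\<^esub> (rep C) = inv\<^bsub>GL n\<^esub> (rep C)" by (rule GLn_one(1)) (simp add: r)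
      then show ?thesis using that(2) r by (simp add: dual_kernel_def)
    qed
    have mem: "rep C \<in> double_coset g" if C: "C \<in> conv_support ?\<phi> (1\<^sub>m n)" for C
    proof -
      have C': "C \<in> rcosets\<^bsub>GL n\<^esub> J" "?\<phi> (1\<^sub>m n * inv\<^bsub>GL n\<^esub> (rep C)) \<noteq> 0" using C by simp_all
      note r = rep(2)[OF C'(1)]
      have "1\<^sub>m n * inv\<^bsub>GL n\<^esub> (rep C) = inv\<^bsub>GL n\<^esub> (rep C)" by (rule GLn_one(1)) (simp add: r)
      then show ?thesis using C'(2) r by (auto simp: dual_kernel_def split: if_splits)
    qed
    have summand: "ip ((adjoint (\<Psi> x) \<circ> \<Psi> x) \<xi>) \<xi> = complex_of_real (sqnorm (\<Psi> x \<xi>))"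
      if x: "x \<in> GLn" and \<xi>: "\<xi> \<in> W'" for x \<xi>
    proof -
      note A = Hbar_endo[OF \<Psi> x]
      note A\<xi> = linear_maps_in[OF A \<xi>]
      have "ip ((adjoint (\<Psi> x) \<circ> \<Psi> x) \<xi>) \<xi> = cnj (ip \<xi> (adjoint (\<Psi> x) (\<Psi> x \<xi>)))"
        by (simp only: ip_cnj comp_apply)
      also have "\<dots> = complex_of_real (sqnorm (\<Psi> x \<xi>))"
        by (simp only: adjoint(2)[OF A A\<xi> \<xi>] ip_self complex_cnj_complex_of_real)
      finally show ?thesis .
    qed
    have kill: "\<Psi> (rep C) \<xi> = 0" if C: "C \<in> conv_support ?\<phi> (1\<^sub>m n)" and \<xi>: "\<xi> \<in> W'" for C \<xi>
    proof -
      have r: "rep D \<in> GLn" if "D \<in> conv_support ?\<phi> (1\<^sub>m n)" for D using that rep(2) by simp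
      have "0 = Hecke_conv n J ?\<phi> \<Psi> (1\<^sub>m n) \<xi>" unfolding van[OF \<phi>] by (rule zero_fun_apply[symmetric])
      also have "\<dots> = (\<Sum>D\<in>conv_support ?\<phi> (1\<^sub>m n). (adjoint (\<Psi> (rep D)) \<circ> \<Psi> (rep D)) \<xi>)"
        unfolding Hecke_conv_eq[OF \<phi> one_GLn] sum_fun_apply[of _ _ \<xi>]
      proof (rule sum.cong[OF refl])
        fix D assume D: "D \<in> conv_support ?\<phi> (1\<^sub>m n)"
        then have D': "D \<in> rcosets\<^bsub>GL n\<^esub> J" by simp
        show "(?\<phi> (1\<^sub>m n * inv\<^bsub>GL n\<^esub> (rep D)) \<circ> \<Psi> (rep D)) \<xi> = (adjoint (\<Psi> (rep D)) \<circ> \<Psi> (rep D)) \<xi>"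
          unfolding val[OF D' mem[OF D]] by (rule refl)
      qed
      finally have z: "(\<Sum>D\<in>conv_support ?\<phi> (1\<^sub>m n). (adjoint (\<Psi> (rep D)) \<circ> \<Psi> (rep D)) \<xi>) = 0" by (rule sym)
      have "(\<Sum>D\<in>conv_support ?\<phi> (1\<^sub>m n). complex_of_real (sqnorm (\<Psi> (rep D) \<xi>)))
          = ip (\<Sum>D\<in>conv_support ?\<phi> (1\<^sub>m n). (adjoint (\<Psi> (rep D)) \<circ> \<Psi> (rep D)) \<xi>) \<xi>"
        unfolding ip_sum_left by (rule sum.cong[OF refl]) (rule summand[OF r \<xi>, symmetric])
      also have "\<dots> = 0" unfolding z by (rule ip_zero_left)
      finally have "complex_of_real (\<Sum>D\<in>conv_support ?\<phi> (1\<^sub>m n). sqnorm (\<Psi> (rep D) \<xi>)) = 0"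
        by (simp only: of_real_sum)
      then have "(\<Sum>D\<in>conv_support ?\<phi> (1\<^sub>m n). sqnorm (\<Psi> (rep D) \<xi>)) = 0" by (simp only: of_real_eq_0_iff)
      then have "sqnorm (\<Psi> (rep C) \<xi>) = 0"
        using sum_nonneg_eq_0_iff[OF fin, of "\<lambda>D. sqnorm (\<Psi> (rep D) \<xi>)"] sqnorm_nonneg C by blast
      then show ?thesis by (rule sqnorm_zero[OF linear_maps_in[OF Hbar_endo[OF \<Psi> r[OF C]] \<xi>]])
    qed
    let ?C = "J #>\<^bsub>GL n\<^esub> g"
    have C: "?C \<in> rcosets\<^bsub>GL n\<^esub> J" unfolding RCOSETS_def using g by blast
    have "rep ?C \<in> ?C" by (rule rep(1)[OF C])
    then obtain j where j: "rep ?C = j * g" "j \<in> J" unfolding right_coset_eq[of g] by (rule imageE)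
    have dc: "rep ?C \<in> double_coset g"
    proof -
      have "rep ?C = j * g * 1\<^sub>m n" unfolding j(1) by (rule GLn_one(2)[OF GLn_mult[OF J_sub[OF j(2)] g], symmetric])
      then show ?thesis unfolding double_coset_def using j(2) J_one by blast
    qed
    note r = rep(2)[OF C]
    have zero: "\<Psi> (rep ?C) \<xi> = 0" if \<xi>: "\<xi> \<in> W'" for \<xi>
    proof (cases "?C \<in> conv_support ?\<phi> (1\<^sub>m n)")
      case True
      then show ?thesis by (rule kill[OF _ \<xi>])
    next
      case False
      then have "adjoint (\<Psi> (rep ?C)) = 0" using C val[OF C dc] by simp
      then have "complex_of_real (sqnorm (\<Psi> (rep ?C) \<xi>)) = ip 0 \<xi>"
        using summand[OF r \<xi>] by (simp only: comp_apply zero_fun_apply)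
      then have "sqnorm (\<Psi> (rep ?C) \<xi>) = 0" by (simp only: ip_zero_left of_real_eq_0_iff)
      then show ?thesis by (rule sqnorm_zero[OF linear_maps_in[OF Hbar_endo[OF \<Psi> r] \<xi>]])
    qed
    have "g = inv\<^bsub>GL n\<^esub> j * rep ?C * 1\<^sub>m n"
    proof -
      have m: "j \<in> GLn" "inv\<^bsub>GL n\<^esub> j \<in> GLn" using J_sub[OF j(2)] by simp_all
      have "inv\<^bsub>GL n\<^esub> j * rep ?C = g"
        unfolding j(1) using GLn_assoc[OF m(2,1) g] GLn_inv(1)[OF m(1)] GLn_one(1)[OF g] by simp
      then show ?thesis using GLn_one(2)[OF g] by simp
    qed
    then have "\<Psi> g = lam_dual (inv\<^bsub>GL n\<^esub> j) \<circ> \<Psi> (rep ?C) \<circ> lam_dual (1\<^sub>m n)"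
      using Hbar_equivariant[OF \<Psi> J_inv[OF j(2)] J_one r] by simp
    then have val_g: "\<Psi> g \<xi> = 0" if \<xi>: "\<xi> \<in> W'" for \<xi>
      by (simp only: comp_apply zero[OF lam_dual_in[OF J_one \<xi>]]
          linear_maps_0[OF lam_dual_endo[OF J_inv[OF j(2)]] W'_csubspace])
    have "\<Psi> g = 0"
      by (rule linear_maps_eqI[OF Hbar_endo[OF \<Psi> g] zero_in_csubspace[OF csubspace_linear_maps[OF W'_csubspace]]])
        (simp only: val_g zero_fun_apply)
    then show ?thesis by simp
  qed
qed

text \<open>The hypothesis \<open>schur\<close> makes \<open>\<Psi>(1)\<close> a scalar, and nondegeneracy makes \<open>\<Psi> \<mapsto> \<Psi>(1)\<close> injective
  on the eigenspace.\<close>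

lemma eigenspace_at_most_one_dimensional:
  assumes schur: "\<And>T. T \<in> endomorphisms W' \<Longrightarrow>
      (\<And>j \<zeta>. j \<in> J \<Longrightarrow> \<zeta> \<in> W' \<Longrightarrow> T (\<zeta> \<circ> lam j) = T \<zeta> \<circ> lam j) \<Longrightarrow>
      \<exists>c. \<forall>\<zeta>\<in>W'. T \<zeta> = c *\<^sub>C \<zeta>"
  shows "(\<exists>B. finite B \<and> cspan B = Hecke_eigenspace absF n J W lam chi)
    \<and> cdim (Hecke_eigenspace absF n J W lam chi) \<le> 1"
proof -
  let ?E = "Hecke_eigenspace absF n J W lam chi"
  note E = csubspace_eigenspace[of chi]
  have E_Hbar: "\<Psi> \<in> Hbar" if "\<Psi> \<in> ?E" for \<Psi> using that unfolding Hecke_eigenspace_def by blast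
  have scalar: "\<exists>c. \<forall>\<zeta>\<in>W'. \<Psi> (1\<^sub>m n) \<zeta> = c *\<^sub>C \<zeta>" if \<Psi>: "\<Psi> \<in> Hbar" for \<Psi>
  proof (rule schur[OF Hbar_endo[OF \<Psi> one_GLn]])
    fix j \<zeta> assume j: "j \<in> J" and \<zeta>: "\<zeta> \<in> W'"
    let ?T = "\<Psi> (1\<^sub>m n)" and ?j = "inv\<^bsub>GL n\<^esub> j"
    note j' = J_inv[OF j]
    have jj: "inv\<^bsub>GL n\<^esub> ?j = j" by (rule G.inv_inv[OF J_sub[OF j]])
    have "?j * 1\<^sub>m n * j = 1\<^sub>m n" using GLn_one(2)[OF J_sub[OF j']] GLn_inv(1)[OF J_sub[OF j]] by simp
    then have T: "?T = lam_dual ?j \<circ> ?T \<circ> lam_dual j" using Hbar_equivariant[OF \<Psi> j' j one_GLn] by simp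
    have c: "lam_dual ?j \<xi> = \<xi> \<circ> lam j" if "\<xi> \<in> W'" for \<xi> using lam_dual_eq[OF j' that] unfolding jj .
    have "lam_dual j (lam_dual ?j \<zeta>) = \<zeta>" using lam_dual_inv_cancel[OF j' \<zeta>] unfolding jj .
    moreover have "?T (lam_dual ?j \<zeta>) = lam_dual ?j (?T (lam_dual j (lam_dual ?j \<zeta>)))" using fun_cong[OF T, of "lam_dual ?j \<zeta>"] by (simp only: comp_apply)
    ultimately have "?T (lam_dual ?j \<zeta>) = lam_dual ?j (?T \<zeta>)" by simp
    then show "?T (\<zeta> \<circ> lam j) = ?T \<zeta> \<circ> lam j"
      unfolding c[OF \<zeta>] c[OF linear_maps_in[OF Hbar_endo[OF \<Psi> one_GLn] \<zeta>]] .
  qed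
  have inj: "\<Psi> = 0" if \<Psi>: "\<Psi> \<in> ?E" and z: "\<forall>\<zeta>\<in>W'. \<Psi> (1\<^sub>m n) \<zeta> = 0" for \<Psi>
  proof (rule Hecke_pairing_nondegenerate[OF E_Hbar[OF \<Psi>]])
    fix \<phi> assume \<phi>: "\<phi> \<in> HA"
    have "\<Psi> (1\<^sub>m n) = 0"
      by (rule linear_maps_eqI[OF Hbar_endo[OF E_Hbar[OF \<Psi>] one_GLn]
            zero_in_csubspace[OF csubspace_linear_maps[OF W'_csubspace]]])
        (use z in \<open>simp only: zero_fun_apply\<close>)
    moreover have "Hecke_conv n J \<phi> \<Psi> = chi \<phi> *\<^sub>C \<Psi>" using \<Psi> \<phi> unfolding Hecke_eigenspace_def by blast
    ultimately show "Hecke_conv n J \<phi> \<Psi> (1\<^sub>m n) = 0"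
      by (simp only: scaleC_fun_apply[of "chi \<phi>" \<Psi>] cvec.scale_zero_right)
  qed
  have "\<exists>\<Psi>0. ?E = cspan {\<Psi>0}"
  proof (cases "?E = {0}")
    case True
    have "cspan {0} = {0 :: ('F, 'w) hecke_fun}"
      using cvec.span_insert_0[of "{}"] by simp
    then show ?thesis using True by metis
  next
    case False
    then obtain \<Psi>0 where \<Psi>0: "\<Psi>0 \<in> ?E" "\<Psi>0 \<noteq> 0" using zero_in_csubspace[OF E] by blast
    obtain c0 where c0: "\<forall>\<zeta>\<in>W'. \<Psi>0 (1\<^sub>m n) \<zeta> = c0 *\<^sub>C \<zeta>" using scalar[OF E_Hbar[OF \<Psi>0(1)]] by blast
    have "c0 \<noteq> 0"
    proof
      assume "c0 = 0"
      then have "\<forall>\<zeta>\<in>W'. \<Psi>0 (1\<^sub>m n) \<zeta> = 0" using c0 by (simp only: cvec.scale_zero_left)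
      then show False using inj[OF \<Psi>0(1)] \<Psi>0(2) by blast
    qed
    have "\<Psi> \<in> cspan {\<Psi>0}" if \<Psi>: "\<Psi> \<in> ?E" for \<Psi>
    proof -
      obtain c where c: "\<forall>\<zeta>\<in>W'. \<Psi> (1\<^sub>m n) \<zeta> = c *\<^sub>C \<zeta>" using scalar[OF E_Hbar[OF \<Psi>]] by blast
      let ?D = "\<Psi> + (- (c / c0)) *\<^sub>C \<Psi>0"
      have "?D = 0"
      proof (rule inj)
        show "?D \<in> ?E" by (intro cvec.subspace_add[OF E \<Psi>] cvec.subspace_scale[OF E \<Psi>0(1)])
        show "\<forall>\<zeta>\<in>W'. ?D (1\<^sub>m n) \<zeta> = 0"
        proof
          fix \<zeta> assume \<zeta>: "\<zeta> \<in> W'"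
          have "?D (1\<^sub>m n) \<zeta> = c *\<^sub>C \<zeta> + (- (c / c0)) *\<^sub>C c0 *\<^sub>C \<zeta>"
            unfolding plus_fun_apply[of \<Psi>] plus_fun_apply[of "\<Psi> (1\<^sub>m n)"] scaleC_fun_apply[of _ \<Psi>0]
              scaleC_fun_apply[of _ "\<Psi>0 (1\<^sub>m n)"] using c c0 \<zeta> by (simp only:)
          also have "\<dots> = (c + (- (c / c0)) * c0) *\<^sub>C \<zeta>"
            by (simp only: cvec.scale_scale cvec.scale_left_distrib)
          also have "c + (- (c / c0)) * c0 = 0" using \<open>c0 \<noteq> 0\<close> by simp
          finally show "?D (1\<^sub>m n) \<zeta> = 0" by (simp only: cvec.scale_zero_left)
        qed
      qed
      then have "\<Psi> = (c / c0) *\<^sub>C \<Psi>0" by (simp only: cvec.scale_minus_left add_eq_0_iff2 minus_minus)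
      then show ?thesis by (simp only: cvec.span_scale cvec.span_base insertI1)
    qed
    moreover have "cspan {\<Psi>0} \<subseteq> ?E" by (rule cvec.span_minimal[OF _ E]) (use \<Psi>0 in simp)
    ultimately show ?thesis by blast
  qed
  then obtain \<Psi>0 where E0: "?E = cspan {\<Psi>0}" by blast
  have "cdim ?E \<le> card {\<Psi>0}" by (rule cvec.dim_le_card) (simp_all add: E0)
  then show ?thesis using E0 by auto
qed

end

section \<open>The eigenspace of the Hecke algebra\<close>

lemma (in block_type) type_eigenspace_at_most_one_dimensional:
  "(\<exists>B. finite B \<and> cspan B = Hecke_eigenspace absF n J W lam chi)
    \<and> cdim (Hecke_eigenspace absF n J W lam chi) \<le> 1"
proof -
  obtain BW where BW: "finite BW" "cspan BW = W" by (rule W_finite_dimensional)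
  interpret hecke: hecke_pair absF red n J W lam BW
  proof (rule hecke_pair.intro[OF nonarch_local_field_axioms], rule hecke_pair_axioms.intro)
    show "lam j \<in> endomorphisms W" if "j \<in> J" for j by (rule lam_endo[OF that])
    show "lam (j * k) = lam j \<circ> lam k" if "j \<in> J" "k \<in> J" for j k by (rule lam_mult[OF that])
    show "lam (1\<^sub>m n) w = w" if "w \<in> W" for w by (rule lam_one[OF that])
  qed (rule type_group_subgroup openin_type_group compactin_type_group BW finite_lam)+
  show ?thesis
  proof (rule hecke.eigenspace_at_most_one_dimensional)
    fix T assume T: "T \<in> endomorphisms (dual_space W)"
      and "\<And>j \<zeta>. j \<in> J \<Longrightarrow> \<zeta> \<in> dual_space W \<Longrightarrow> T (\<zeta> \<circ> lam j) = T \<zeta> \<circ> lam j"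
    then show "\<exists>c. \<forall>\<zeta>\<in>dual_space W. T \<zeta> = c *\<^sub>C \<zeta>" by (rule lam_dual_commutant)
  qed
qed

theorem proposition3p3:
  fixes absF :: "'F::field \<Rightarrow> real" and red :: "'F \<Rightarrow> 'k::field"
    and n e f :: nat
    and X0 :: "'x::complex_vector set" and lambar0 :: "'k mat \<Rightarrow> 'x \<Rightarrow> 'x"
    and Lam0 :: "'F mat \<Rightarrow> 'x \<Rightarrow> 'x"
    and U :: "'u::complex_vector set" and \<tau> :: "'F mat \<Rightarrow> 'u \<Rightarrow> 'u"
    and V :: "'v::complex_vector set" and \<pi> :: "'F mat \<Rightarrow> 'v \<Rightarrow> 'v"
    and J :: "'F mat set" and W :: "'x tensor set" and lam :: "'F mat \<Rightarrow> 'x tensor \<Rightarrow> 'x tensor"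
    and chi :: "('F, 'x tensor) hecke_fun \<Rightarrow> complex"
  assumes F: "nonarch_local_field absF red"
    and n: "n \<ge> 2" and e: "e > 0" and f: "f > 0" and ef: "e * f = n"
    and \<tau>_irreducible: "irreducible_rep (GL f) U \<tau>"
    and \<tau>_unitary: "unitary_rep (GL f) U \<tau>"
    and \<tau>_level_zero: "level_zero_supercuspidal absF red f X0 lambar0 Lam0 U \<tau>"
    and \<pi>: "generalized_Steinberg absF e f U \<tau> V \<pi>"
    and J: "J = type_group absF e f"
    and W: "W = tensor_power e X0"
    and lam: "lam = type_rep red e f X0 lambar0"
    and chi: "affords_character absF n J W lam V \<pi> chi"
  shows "(\<exists>B. finite B \<and> cspan B = Hecke_eigenspace absF n J W lam chi)
    \<and> cdim (Hecke_eigenspace absF n J W lam chi) \<le> 1"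
proof -
  have "irreducible_rep (GL f) X0 lambar0"
    using \<tau>_level_zero unfolding level_zero_supercuspidal_def by (elim conjE)
  then interpret block_type absF red e f X0 lambar0
    using F f by (intro block_type.intro block_group.intro block_group_axioms.intro block_type_axioms.intro)
  show ?thesis
    unfolding J W lam ef[symmetric] by (rule type_eigenspace_at_most_one_dimensional)
qed

end
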